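(* Let $K$ be a field of characteristic zero and $n\geq 1$. Consider the group homomorphism $\mathrm{Aut}_{K\text{-alg}}(P_n)\to \mathrm{Aut}_{\mathrm{Lie}}(\mathfrak{div}_n^0)$ sending $\sigma$ to the automorphism $\partial\mapsto \sigma\partial\sigma^{-1}$. Then: (a) if $n\geq 2$, this homomorphism is an isomorphism, i.e. $\mathrm{Aut}_{\mathrm{Lie}}(\mathfrak{div}_n^0)=G_n$; (b) if $n=1$, this homomorphism induces an isomorphism $\mathrm{Aut}_{\mathrm{Lie}}(\mathfrak{div}_1^0)= G_1/\mathrm{Sh}_1$, and $G_1/\mathrm{Sh}_1\simeq K^*$.
   Context: $P_n=K[x_1,\ldots,x_n]$ is the polynomial algebra, $G_n=\mathrm{Aut}_{K\text{-alg}}(P_n)$, $\partial_i=\partial/\partial x_i$, $D_n=\mathrm{Der}_K(P_n)=\bigoplus_{i=1}^n P_n\partial_i$ with bracket $[\partial,\delta]=\partial\delta-\delta\partial$. For $\partial=\sum_{i=1}^n a_i\partial_i\in D_n$, the divergence is $\mathrm{div}(\partial)=\sum_{i=1}^n \partial a_i/\partial x_i$. $\mathfrak{div}_n^0=\{\partial\in D_n : \mathrm{div}(\partial)=0\}$, a Lie subalgebra of $D_n$ stable under $\partial\mapsto\sigma\partial\sigma^{-1}$ for $\sigma\in G_n$. $\mathrm{Aut}_{\mathrm{Lie}}$ denotes the group of $K$-Lie algebra automorphisms. $\mathrm{Sh}_n=\{s_\lambda\in G_n : s_\lambda(x_i)=x_i+\lambda_i,\ i=1,\ldots,n;\ \lambda=(\lambda_1,\ldots,\lambda_n)\in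 K^n\}$ is the shift group. $K^*$ is the multiplicative group of $K$. *)

theory Defs
  imports "HOL-Algebra.Bij" "HOL-Algebra.Coset" "HOL-Library.Poly_Mapping" "HOL-Library.Cardinality"
begin

text \<open>The polynomial algebra over \<open>'k\<close> in the variables \<open>x\<^sub>i\<close>, with \<open>i\<close> ranging over a finite
  index type \<open>'n\<close>; thus \<open>n = CARD('n)\<close>. A polynomial is a finitely supported map from exponent
  vectors to coefficients, and multiplication is the convolution product of \<open>Poly_Mapping\<close>.\<close>

type_synonym ('n, 'k) mpoly = "('n \<Rightarrow>\<^sub>0 nat) \<Rightarrow>\<^sub>0 'k"

definition pconst :: "'k::zero \<Rightarrow> ('n, 'k) mpoly" where
  "pconst c = Poly_Mapping.single 0 c"

definition pvar :: "'n \<Rightarrow> ('n, 'k::{zero,one}) mpoly" where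
  "pvar i = Poly_Mapping.single (Poly_Mapping.single i 1) 1"

text \<open>\<open>\<partial>\<^sub>i (\<Sum>\<^sub>m c\<^sub>m x\<^sup>m) = \<Sum>\<^sub>m c\<^sub>m m\<^sub>i x\<^bsup>m - e\<^sub>i\<^esup>\<close>; where the truncated subtraction \<open>m - e\<^sub>i\<close> is
  not a true one, the coefficient \<open>m\<^sub>i\<close> is zero.\<close>

definition partial :: "'n \<Rightarrow> ('n, 'k::comm_ring_1) mpoly \<Rightarrow> ('n, 'k) mpoly" where
  "partial i p = (\<Sum>m\<in>Poly_Mapping.keys p.
     Poly_Mapping.single (m - Poly_Mapping.single i 1)
       (Poly_Mapping.lookup p m * of_nat (Poly_Mapping.lookup m i)))"

definition derivations :: "(('n, 'k::comm_ring_1) mpoly \<Rightarrow> ('n, 'k) mpoly) set" where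
  "derivations = {\<delta>.
     (\<forall>p q. \<delta> (p + q) = \<delta> p + \<delta> q) \<and>
     (\<forall>c p. \<delta> (pconst c * p) = pconst c * \<delta> p) \<and>
     (\<forall>p q. \<delta> (p * q) = \<delta> p * q + p * \<delta> q)}"

text \<open>The coefficients of \<open>\<delta> = \<Sum>\<^sub>i a\<^sub>i \<partial>\<^sub>i\<close> are \<open>a\<^sub>i = \<delta> x\<^sub>i\<close>; see \<open>derivation_unique_expansion\<close>
  below.\<close>

definition divergence ::
    "(('n::finite, 'k::comm_ring_1) mpoly \<Rightarrow> ('n, 'k) mpoly) \<Rightarrow> ('n, 'k) mpoly" where
  "divergence \<delta> = (\<Sum>i\<in>UNIV. partial i (\<delta> (pvar i)))"

definition div0 :: "(('n::finite, 'k::comm_ring_1) mpoly \<Rightarrow> ('n, 'k) mpoly) set" where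
  "div0 = {\<delta> \<in> derivations. divergence \<delta> = 0}"

definition op_plus :: "('a \<Rightarrow> 'b::plus) \<Rightarrow> ('a \<Rightarrow> 'b) \<Rightarrow> 'a \<Rightarrow> 'b" where
  "op_plus \<delta> \<epsilon> = (\<lambda>p. \<delta> p + \<epsilon> p)"

definition op_scale :: "'k::comm_ring_1 \<Rightarrow> ('a \<Rightarrow> ('n, 'k) mpoly) \<Rightarrow> 'a \<Rightarrow> ('n, 'k) mpoly" where
  "op_scale c \<delta> = (\<lambda>p. pconst c * \<delta> p)"

definition bracket :: "('a \<Rightarrow> 'a::minus) \<Rightarrow> ('a \<Rightarrow> 'a) \<Rightarrow> 'a \<Rightarrow> 'a" where
  "bracket \<delta> \<epsilon> = (\<lambda>p. \<delta> (\<epsilon> p) - \<epsilon> (\<delta> p))"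

definition alg_aut_group :: "(('n, 'k::comm_ring_1) mpoly \<Rightarrow> ('n, 'k) mpoly) monoid" where
  "alg_aut_group = BijGroup UNIV \<lparr>carrier := {\<sigma> \<in> Bij UNIV.
     (\<forall>p q. \<sigma> (p + q) = \<sigma> p + \<sigma> q) \<and>
     (\<forall>p q. \<sigma> (p * q) = \<sigma> p * \<sigma> q) \<and>
     (\<forall>c. \<sigma> (pconst c) = pconst c)}\<rparr>"

text \<open>Automorphisms of a Lie algebra \<open>L\<close> of operators are represented by extensional functions,
  i.e. they take the value \<open>undefined\<close> outside \<open>L\<close>, as usual with \<open>BijGroup\<close>.\<close>

definition lie_aut_group ::
    "(('n, 'k::comm_ring_1) mpoly \<Rightarrow> ('n, 'k) mpoly) set
      \<Rightarrow> ((('n, 'k) mpoly \<Rightarrow> ('n, 'k) mpoly) \<Rightarrow> (('n, 'k) mpoly \<Rightarrow> ('n, 'k) mpoly)) monoid" where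
  "lie_aut_group L = BijGroup L \<lparr>carrier := {\<phi> \<in> Bij L.
     (\<forall>\<delta>\<in>L. \<forall>\<epsilon>\<in>L. \<phi> (op_plus \<delta> \<epsilon>) = op_plus (\<phi> \<delta>) (\<phi> \<epsilon>)) \<and>
     (\<forall>c. \<forall>\<delta>\<in>L. \<phi> (op_scale c \<delta>) = op_scale c (\<phi> \<delta>)) \<and>
     (\<forall>\<delta>\<in>L. \<forall>\<epsilon>\<in>L. \<phi> (bracket \<delta> \<epsilon>) = bracket (\<phi> \<delta>) (\<phi> \<epsilon>))}\<rparr>"

definition conj_action ::
    "(('n::finite, 'k::comm_ring_1) mpoly \<Rightarrow> ('n, 'k) mpoly)
      \<Rightarrow> (('n, 'k) mpoly \<Rightarrow> ('n, 'k) mpoly) \<Rightarrow> (('n, 'k) mpoly \<Rightarrow> ('n, 'k) mpoly)" where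
  "conj_action \<sigma> = (\<lambda>\<delta>\<in>div0. \<sigma> \<circ> \<delta> \<circ> inv_into UNIV \<sigma>)"

definition shifts :: "(('n, 'k::comm_ring_1) mpoly \<Rightarrow> ('n, 'k) mpoly) set" where
  "shifts = {\<sigma> \<in> carrier alg_aut_group. \<exists>l. \<forall>i. \<sigma> (pvar i) = pvar i + pconst (l i)}"

definition mult_group :: "'k::field monoid" where
  "mult_group = \<lparr>carrier = UNIV - {0}, monoid.mult = (*), one = 1\<rparr>"


section \<open>Basic properties\<close>

lemma pconst_simps:
  "pconst (0::'k::comm_ring_1) = 0" "pconst (1::'k) = 1"
  "pconst (a + b) = pconst a + pconst (b::'k)" "pconst (a * b) = pconst a * pconst (b::'k)"
  by (simp_all add: pconst_def single_add mult_single)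

lemma lookup_pconst_mult:
  "Poly_Mapping.lookup (pconst (c::'k::comm_ring_1) * p) m = c * Poly_Mapping.lookup p m"
  unfolding pconst_def mult_map_scale_conv_mult[symmetric]
  by (simp add: Poly_Mapping.map.rep_eq when_def)

lemma single_eq_pconst_mult:
  "Poly_Mapping.single m (c::'k::comm_ring_1) = pconst c * Poly_Mapping.single m 1"
  by (simp add: pconst_def mult_single)

lemma poly_expansion:
  "(p::('n, 'k::comm_ring_1) mpoly)
    = (\<Sum>m\<in>Poly_Mapping.keys p. Poly_Mapping.single m (Poly_Mapping.lookup p m))"
  by (rule poly_mapping_eqI)
    (auto simp: lookup_sum lookup_single when_def in_keys_iff)

lemma monomial_induct [case_names zero add]:
  assumes "P 0" and "\<And>m c p. P p \<Longrightarrow> P (Poly_Mapping.single m c + p)"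
  shows "P (p::('n, 'k::comm_ring_1) mpoly)"
proof -
  have "P (\<Sum>m\<in>A. Poly_Mapping.single m (Poly_Mapping.lookup p m))" if "finite A" for A
    using that by induction (simp_all add: assms)
  then show ?thesis by (subst poly_expansion) simp
qed

lemma partial_single:
  "partial i (Poly_Mapping.single m (c::'k::comm_ring_1))
    = Poly_Mapping.single (m - Poly_Mapping.single i 1) (c * of_nat (Poly_Mapping.lookup m i))"
  by (simp add: partial_def)

lemma partial_superset:
  assumes "finite A" "Poly_Mapping.keys p \<subseteq> A"
  shows "partial i (p::('n, 'k::comm_ring_1) mpoly)
    = (\<Sum>m\<in>A. Poly_Mapping.single (m - Poly_Mapping.single i 1)
       (Poly_Mapping.lookup p m * of_nat (Poly_Mapping.lookup m i)))"
  unfolding partial_def using assms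
  by (intro sum.mono_neutral_left) (auto simp: in_keys_iff)

lemma partial_add: "partial i (p + q) = partial i p + partial i (q::('n, 'k::comm_ring_1) mpoly)"
proof -
  let ?A = "Poly_Mapping.keys p \<union> Poly_Mapping.keys q"
  have "partial i (p + q) = (\<Sum>m\<in>?A. Poly_Mapping.single (m - Poly_Mapping.single i 1)
       (Poly_Mapping.lookup (p + q) m * of_nat (Poly_Mapping.lookup m i)))"
    by (rule partial_superset) (use Poly_Mapping.keys_add[of p q] in auto)
  also have "\<dots> = partial i p + partial i q"
    by (simp add: partial_superset[of ?A] lookup_add ring_distribs single_add sum.distrib)
  finally show ?thesis .
qed

lemma partial_zero: "partial i 0 = 0"
  by (simp add: partial_def)

lemma partial_pconst_mult: "partial i (pconst c * p) = pconst c * partial i p"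
proof (induction p rule: monomial_induct)
  case (add m d p)
  then show ?case
    by (simp add: ring_distribs partial_add)
      (simp add: pconst_def mult_single partial_single mult.assoc)
qed (simp add: partial_zero)

lemma single_diff_add:
  fixes m m' :: "'n \<Rightarrow>\<^sub>0 nat"
  assumes "Poly_Mapping.lookup m i \<noteq> 0"
  shows "m - Poly_Mapping.single i 1 + m' = m + m' - Poly_Mapping.single i 1"
  using assms by (intro poly_mapping_eqI) (auto simp: lookup_add lookup_minus lookup_single when_def)

lemma partial_mult_single:
  fixes m m' :: "'n \<Rightarrow>\<^sub>0 nat" and c d :: "'k::comm_ring_1"
  shows "partial i (Poly_Mapping.single m c * Poly_Mapping.single m' d)
    = partial i (Poly_Mapping.single m c) * Poly_Mapping.single m' d
      + Poly_Mapping.single m c * partial i (Poly_Mapping.single m' d)"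
proof -
  let ?e = "Poly_Mapping.single i 1" and ?M = "m + m'"
  have l: "partial i (Poly_Mapping.single m c) * Poly_Mapping.single m' d
      = Poly_Mapping.single (?M - ?e) (c * d * of_nat (Poly_Mapping.lookup m i))"
    by (cases "Poly_Mapping.lookup m i = 0")
      (simp_all del: One_nat_def add: partial_single mult_single single_diff_add
        mult.assoc mult.commute[of _ d])
  have r: "Poly_Mapping.single m c * partial i (Poly_Mapping.single m' d)
      = Poly_Mapping.single (?M - ?e) (c * d * of_nat (Poly_Mapping.lookup m' i))"
    by (cases "Poly_Mapping.lookup m' i = 0")
      (simp_all del: One_nat_def add: partial_single mult_single add.commute[of m]
        single_diff_add mult.assoc)
  show ?thesis
    unfolding l r by (simp add: mult_single partial_single lookup_add ring_distribs single_add)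
qed

lemma partial_mult:
  "partial i (p * q) = partial i p * q + p * partial i (q::('n, 'k::comm_ring_1) mpoly)"
proof (induction p rule: monomial_induct)
  case (add m c p)
  have "partial i (Poly_Mapping.single m c * q)
    = partial i (Poly_Mapping.single m c) * q + Poly_Mapping.single m c * partial i q"
  proof (induction q rule: monomial_induct)
    case (add m' d q)
    show ?case
      by (simp only: distrib_left partial_add add.IH partial_mult_single) (simp add: ac_simps)
  qed (simp add: partial_zero)
  then show ?case
    by (simp add: distrib_right distrib_left partial_add add.IH ac_simps)
qed (simp add: partial_zero)

lemma partial_derivation: "partial i \<in> derivations"
  unfolding derivations_def
  by (intro CollectI conjI allI partial_add partial_pconst_mult partial_mult)

lemma partial_pvar: "partial i (pvar j) = (if i = j then 1 else 0)"
  by (auto simp: pvar_def partial_single lookup_single when_def)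

context
  fixes \<delta> :: "('n::finite, 'k::comm_ring_1) mpoly \<Rightarrow> ('n, 'k) mpoly"
  assumes d: "\<delta> \<in> derivations"
begin

lemma derivation_add: "\<delta> (p + q) = \<delta> p + \<delta> q"
  and derivation_pconst_mult: "\<delta> (pconst c * p) = pconst c * \<delta> p"
  and derivation_mult: "\<delta> (p * q) = \<delta> p * q + p * \<delta> q"
  using d unfolding derivations_def by blast+

lemma derivation_zero: "\<delta> 0 = 0"
  using derivation_add[of 0 0] by simp

lemma derivation_one: "\<delta> 1 = 0"
  using derivation_mult[of 1 1] by simp

lemma derivation_diff: "\<delta> (p - q) = \<delta> p - \<delta> q"
  using derivation_add[of "p - q" q] by simp

lemma derivation_sum: "\<delta> (\<Sum>i\<in>A. f i) = (\<Sum>i\<in>A. \<delta> (f i))"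
  by (induction A rule: infinite_finite_induct) (simp_all add: derivation_zero derivation_add)

end

lemma expansion_derivation:
  fixes a :: "'n::finite \<Rightarrow> ('n, 'k::comm_ring_1) mpoly"
  shows "(\<lambda>p. \<Sum>i\<in>UNIV. a i * partial i p) \<in> derivations"
proof -
  have "(\<Sum>i\<in>UNIV. a i * partial i (p + q))
      = (\<Sum>i\<in>UNIV. a i * partial i p) + (\<Sum>i\<in>UNIV. a i * partial i q)"
    "(\<Sum>i\<in>UNIV. a i * partial i (pconst c * p)) = pconst c * (\<Sum>i\<in>UNIV. a i * partial i p)"
    "(\<Sum>i\<in>UNIV. a i * partial i (p * q))
      = (\<Sum>i\<in>UNIV. a i * partial i p) * q + p * (\<Sum>i\<in>UNIV. a i * partial i q)" for p q c
  proof -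
    show "(\<Sum>i\<in>UNIV. a i * partial i (p + q))
        = (\<Sum>i\<in>UNIV. a i * partial i p) + (\<Sum>i\<in>UNIV. a i * partial i q)"
      by (simp add: partial_add distrib_left sum.distrib)
    show "(\<Sum>i\<in>UNIV. a i * partial i (pconst c * p))
        = pconst c * (\<Sum>i\<in>UNIV. a i * partial i p)"
      unfolding partial_pconst_mult sum_distrib_left by (simp add: ac_simps)
    show "(\<Sum>i\<in>UNIV. a i * partial i (p * q))
        = (\<Sum>i\<in>UNIV. a i * partial i p) * q + p * (\<Sum>i\<in>UNIV. a i * partial i q)"
      by (simp add: partial_mult distrib_left sum.distrib sum_distrib_left sum_distrib_right
          ac_simps)
  qed
  then show ?thesis unfolding derivations_def by blast
qed

lemma exponent_induct [case_names zero add]: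
  assumes "P 0" and "\<And>i m. P m \<Longrightarrow> P (Poly_Mapping.single i 1 + m)"
  shows "P (m::'n::finite \<Rightarrow>\<^sub>0 nat)"
proof (induction "\<Sum>i\<in>UNIV. Poly_Mapping.lookup m i" arbitrary: m)
  case 0
  then have "m = 0" by (intro poly_mapping_eqI) simp
  then show ?case using assms(1) by simp
next
  case (Suc k)
  then obtain i where i: "Poly_Mapping.lookup m i \<noteq> 0"
    by (metis (no_types, lifting) nat.distinct(1) sum.neutral)
  define m' where "m' = m - Poly_Mapping.single i 1"
  have m: "m = Poly_Mapping.single i 1 + m'"
    using i unfolding m'_def
    by (intro poly_mapping_eqI) (auto simp: lookup_add lookup_minus lookup_single when_def)
  have "Suc k = Suc (\<Sum>j\<in>UNIV. Poly_Mapping.lookup m' j)"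
    unfolding Suc(2) by (subst m) (simp add: lookup_add lookup_single sum.distrib when_def)
  then have "P m'" using Suc(1) by simp
  then show ?case by (subst m) (rule assms(2))
qed

lemma derivations_eqI:
  fixes \<delta> \<epsilon> :: "('n::finite, 'k::comm_ring_1) mpoly \<Rightarrow> ('n, 'k) mpoly"
  assumes d: "\<delta> \<in> derivations" and e: "\<epsilon> \<in> derivations" and v: "\<And>i. \<delta> (pvar i) = \<epsilon> (pvar i)"
  shows "\<delta> = \<epsilon>"
proof
  have mon: "\<delta> (Poly_Mapping.single m 1) = \<epsilon> (Poly_Mapping.single m 1)" for m
  proof (induction m rule: exponent_induct)
    case zero
    then show ?case by (simp add: derivation_one[OF d] derivation_one[OF e])
  next
    case (add i m)
    have "Poly_Mapping.single (Poly_Mapping.single i 1 + m) (1::'k)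
        = pvar i * Poly_Mapping.single m 1"
      by (simp add: pvar_def mult_single)
    then show ?case by (simp add: derivation_mult[OF d] derivation_mult[OF e] v add)
  qed
  show "\<delta> p = \<epsilon> p" for p
  proof (induction p rule: monomial_induct)
    case (add m c p)
    then show ?case
      by (subst (1 2) single_eq_pconst_mult)
        (simp add: derivation_add[OF d] derivation_add[OF e]
          derivation_pconst_mult[OF d] derivation_pconst_mult[OF e] mon)
  qed (simp add: derivation_zero[OF d] derivation_zero[OF e])
qed

lemma expansion_pvar: "(\<Sum>i\<in>UNIV. a i * partial i (pvar j)) = a (j::'n::finite)"
  by (simp add: partial_pvar if_distrib[of "\<lambda>x. _ * x"] cong: if_cong)

lemma derivation_unique_expansion:
  fixes \<delta> :: "('n::finite, 'k::comm_ring_1) mpoly \<Rightarrow> ('n, 'k) mpoly"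
  assumes "\<delta> \<in> derivations"
  shows "\<delta> = (\<lambda>p. \<Sum>i\<in>UNIV. a i * partial i p) \<longleftrightarrow> a = (\<lambda>i. \<delta> (pvar i))"
proof
  assume "\<delta> = (\<lambda>p. \<Sum>i\<in>UNIV. a i * partial i p)"
  then show "a = (\<lambda>i. \<delta> (pvar i))" by (simp add: expansion_pvar)
next
  assume "a = (\<lambda>i. \<delta> (pvar i))"
  then show "\<delta> = (\<lambda>p. \<Sum>i\<in>UNIV. a i * partial i p)"
    by (intro derivations_eqI[OF assms expansion_derivation]) (simp add: expansion_pvar)
qed

lemma op_plus_derivation:
  "\<delta> \<in> derivations \<Longrightarrow> \<epsilon> \<in> derivations \<Longrightarrow> op_plus \<delta> \<epsilon> \<in> derivations"
  by (auto simp: derivations_def op_plus_def algebra_simps)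

lemma op_scale_derivation: "\<delta> \<in> derivations \<Longrightarrow> op_scale c \<delta> \<in> derivations"
  by (auto simp: derivations_def op_scale_def algebra_simps)

lemma bracket_derivation:
  fixes \<delta> \<epsilon> :: "('n::finite, 'k::comm_ring_1) mpoly \<Rightarrow> ('n, 'k) mpoly"
  assumes "\<delta> \<in> derivations" "\<epsilon> \<in> derivations"
  shows "bracket \<delta> \<epsilon> \<in> derivations"
proof -
  note add = derivation_add[OF assms(1)] derivation_add[OF assms(2)]
    and scale = derivation_pconst_mult[OF assms(1)] derivation_pconst_mult[OF assms(2)]
    and mult = derivation_mult[OF assms(1)] derivation_mult[OF assms(2)]
  have "bracket \<delta> \<epsilon> (p + q) = bracket \<delta> \<epsilon> p + bracket \<delta> \<epsilon> q"
    "bracket \<delta> \<epsilon> (pconst c * p) = pconst c * bracket \<delta> \<epsilon> p"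
    "bracket \<delta> \<epsilon> (p * q) = bracket \<delta> \<epsilon> p * q + p * bracket \<delta> \<epsilon> q" for p q c
    unfolding bracket_def
    subgoal by (simp add: add)
    subgoal by (simp only: scale right_diff_distrib)
    subgoal by (simp add: add mult algebra_simps)
    done
  then show ?thesis unfolding derivations_def by blast
qed

lemma partial_commute:
  "partial i (partial j p) = partial j (partial i (p::('n::finite, 'k::comm_ring_1) mpoly))"
proof -
  have "bracket (partial i) (partial j) = (\<lambda>p::('n, 'k) mpoly. 0)"
  proof (rule derivations_eqI)
    show "(\<lambda>p::('n, 'k) mpoly. 0) \<in> derivations" by (simp add: derivations_def)
    show "bracket (partial i) (partial j) (pvar k) = 0" for k :: 'n
      by (simp add: bracket_def partial_pvar derivation_zero[OF partial_derivation]
          derivation_one[OF partial_derivation])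
  qed (intro bracket_derivation partial_derivation)
  then show ?thesis by (auto simp: bracket_def fun_eq_iff)
qed

lemma divergence_bracket:
  assumes d: "\<delta> \<in> derivations" and e: "\<epsilon> \<in> derivations"
  shows "divergence (bracket \<delta> \<epsilon>) = \<delta> (divergence \<epsilon>) - \<epsilon> (divergence \<delta>)"
proof -
  have dx: "\<delta> p = (\<Sum>j\<in>UNIV. \<delta> (pvar j) * partial j p)"
    and ex: "\<epsilon> p = (\<Sum>j\<in>UNIV. \<epsilon> (pvar j) * partial j p)" for p
    using derivation_unique_expansion[OF d] derivation_unique_expansion[OF e] by metis+
  have *: "(\<Sum>i\<in>UNIV. partial i (\<Sum>j\<in>UNIV. a j * partial j (b i)))
      = (\<Sum>i\<in>UNIV. \<Sum>j\<in>UNIV. partial i (a j) * partial j (b i))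
        + (\<Sum>j\<in>UNIV. a j * partial j (\<Sum>i\<in>UNIV. partial i (b i)))"
    for a b :: "'a \<Rightarrow> ('a, 'b) mpoly"
    by (simp add: derivation_sum[OF partial_derivation] partial_mult sum.distrib sum_distrib_left
        partial_commute) (subst sum.swap, simp add: partial_commute)
  have sw: "(\<Sum>i\<in>UNIV. \<Sum>j\<in>UNIV. partial i (\<delta> (pvar j)) * partial j (\<epsilon> (pvar i)))
      = (\<Sum>i\<in>UNIV. \<Sum>j\<in>UNIV. partial i (\<epsilon> (pvar j)) * partial j (\<delta> (pvar i)))"
    by (subst sum.swap) (simp add: mult.commute)
  have "divergence (bracket \<delta> \<epsilon>)
      = (\<Sum>i\<in>UNIV. partial i (\<delta> (\<epsilon> (pvar i)))) - (\<Sum>i\<in>UNIV. partial i (\<epsilon> (\<delta> (pvar i))))"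
    by (simp add: divergence_def bracket_def derivation_diff[OF partial_derivation] sum_subtractf)
  also have "\<dots> = \<delta> (divergence \<epsilon>) - \<epsilon> (divergence \<delta>)"
    unfolding dx[of "\<epsilon> _"] ex[of "\<delta> _"] dx[of "divergence _"] ex[of "divergence _"]
    unfolding * sw by (simp add: divergence_def)
  finally show ?thesis .
qed

lemma div0_op_plus: "\<delta> \<in> div0 \<Longrightarrow> \<epsilon> \<in> div0 \<Longrightarrow> op_plus \<delta> \<epsilon> \<in> div0"
  by (simp add: div0_def op_plus_derivation)
    (simp add: divergence_def op_plus_def partial_add sum.distrib)

lemma div0_op_scale: "\<delta> \<in> div0 \<Longrightarrow> op_scale c \<delta> \<in> div0"
  by (simp add: div0_def op_scale_derivation)
    (simp add: divergence_def op_scale_def partial_pconst_mult sum_distrib_left[symmetric])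

lemma div0_bracket: "\<delta> \<in> div0 \<Longrightarrow> \<epsilon> \<in> div0 \<Longrightarrow> bracket \<delta> \<epsilon> \<in> div0"
  by (simp add: div0_def bracket_derivation divergence_bracket derivation_zero)

lemma subgroup_update:
  assumes "subgroup H (BijGroup S)"
  shows "group (BijGroup S \<lparr>carrier := H\<rparr>)"
  using assms group_BijGroup subgroup.subgroup_is_group by blast

lemma group_alg_aut_group: "group (alg_aut_group :: (('n, 'k::comm_ring_1) mpoly \<Rightarrow> _) monoid)"
proof -
  let ?H = "{\<sigma> \<in> Bij (UNIV :: ('n, 'k) mpoly set).
     (\<forall>p q. \<sigma> (p + q) = \<sigma> p + \<sigma> q) \<and> (\<forall>p q. \<sigma> (p * q) = \<sigma> p * \<sigma> q) \<and>
     (\<forall>c. \<sigma> (pconst c) = pconst c)}"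
  have "subgroup ?H (BijGroup UNIV)"
  proof
    show "inv\<^bsub>BijGroup UNIV\<^esub> \<sigma> \<in> ?H" if s: "\<sigma> \<in> ?H" for \<sigma>
    proof -
      have "bij \<sigma>" using s by (simp add: Bij_def)
      then have i: "inv_into UNIV \<sigma> (\<sigma> p) = p" "\<sigma> (inv_into UNIV \<sigma> p) = p" for p
        by (simp_all add: bij_is_inj bij_is_surj surj_f_inv_f)
      have eq: "p = inv_into UNIV \<sigma> q" if "\<sigma> p = q" for p q
        using that i(1) by metis
      have "inv_into UNIV \<sigma> (p + q) = inv_into UNIV \<sigma> p + inv_into UNIV \<sigma> q"
        "inv_into UNIV \<sigma> (p * q) = inv_into UNIV \<sigma> p * inv_into UNIV \<sigma> q"
        "inv_into UNIV \<sigma> (pconst c) = pconst c" for p q c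
        using s by (auto intro!: eq[symmetric] simp: i)
      then show ?thesis
        using s restrict_inv_into_Bij[of \<sigma> UNIV] by (simp add: inv_BijGroup)
    qed
  qed (use id_Bij[of UNIV] in
      \<open>auto simp: BijGroup_def compose_Bij\<close>, auto simp: compose_def)
  then show ?thesis unfolding alg_aut_group_def by (rule subgroup_update)
qed

lemma group_lie_aut_group:
  assumes L: "\<And>\<delta> \<epsilon>. \<delta> \<in> L \<Longrightarrow> \<epsilon> \<in> L \<Longrightarrow> op_plus \<delta> \<epsilon> \<in> L"
    "\<And>c \<delta>. \<delta> \<in> L \<Longrightarrow> op_scale c \<delta> \<in> L"
    "\<And>\<delta> \<epsilon>. \<delta> \<in> L \<Longrightarrow> \<epsilon> \<in> L \<Longrightarrow> bracket \<delta> \<epsilon> \<in> L"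
  shows "group (lie_aut_group (L :: (('n, 'k::comm_ring_1) mpoly \<Rightarrow> _) set))"
proof -
  let ?H = "{\<phi> \<in> Bij L.
     (\<forall>\<delta>\<in>L. \<forall>\<epsilon>\<in>L. \<phi> (op_plus \<delta> \<epsilon>) = op_plus (\<phi> \<delta>) (\<phi> \<epsilon>)) \<and>
     (\<forall>c. \<forall>\<delta>\<in>L. \<phi> (op_scale c \<delta>) = op_scale c (\<phi> \<delta>)) \<and>
     (\<forall>\<delta>\<in>L. \<forall>\<epsilon>\<in>L. \<phi> (bracket \<delta> \<epsilon>) = bracket (\<phi> \<delta>) (\<phi> \<epsilon>))}"
  have "subgroup ?H (BijGroup L)"
  proof
    show "?H \<subseteq> carrier (BijGroup L)" by (auto simp: BijGroup_def)
    show "\<one>\<^bsub>BijGroup L\<^esub> \<in> ?H" using id_Bij[of L] L by (simp add: BijGroup_def)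
    show "\<phi> \<otimes>\<^bsub>BijGroup L\<^esub> \<psi> \<in> ?H" if h: "\<phi> \<in> ?H" "\<psi> \<in> ?H" for \<phi> \<psi>
    proof -
      have m: "\<psi> \<delta> \<in> L" if "\<delta> \<in> L" for \<delta>
        using h that Bij_imp_funcset by blast
      show ?thesis
        using h by (simp add: BijGroup_def compose_Bij) (simp add: compose_def L m)
    qed
    show "inv\<^bsub>BijGroup L\<^esub> \<phi> \<in> ?H" if h: "\<phi> \<in> ?H" for \<phi>
    proof -
      have b: "\<phi> \<in> Bij L" using h by simp
      have m: "inv_into L \<phi> \<delta> \<in> L" "\<phi> (inv_into L \<phi> \<delta>) = \<delta>" if "\<delta> \<in> L" for \<delta>
        using b that by (simp_all add: Bij_inv_into_mem)
          (auto simp: Bij_def bij_betw_inv_into_right)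
      have eq: "inv_into L \<phi> \<epsilon> = \<delta>" if "\<phi> \<delta> = \<epsilon>" "\<delta> \<in> L" for \<delta> \<epsilon>
        using b that by (auto simp: Bij_def bij_betw_inv_into_left)
      have "inv_into L \<phi> (op_plus \<delta> \<epsilon>) = op_plus (inv_into L \<phi> \<delta>) (inv_into L \<phi> \<epsilon>)"
        "inv_into L \<phi> (op_scale c \<delta>) = op_scale c (inv_into L \<phi> \<delta>)"
        "inv_into L \<phi> (bracket \<delta> \<epsilon>) = bracket (inv_into L \<phi> \<delta>) (inv_into L \<phi> \<epsilon>)"
        if "\<delta> \<in> L" "\<epsilon> \<in> L" for \<delta> \<epsilon> c
        using h that by (auto intro!: eq simp: m L)
      then show ?thesis
        using b restrict_inv_into_Bij[of \<phi> L] by (simp add: inv_BijGroup L)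
    qed
  qed
  then show ?thesis unfolding lie_aut_group_def by (rule subgroup_update)
qed

lemma group_lie_aut_group_div0: "group (lie_aut_group div0)"
  by (intro group_lie_aut_group div0_op_plus div0_op_scale div0_bracket)

end

theory Submission
  imports Defs "HOL-Analysis.Determinants" "HOL-Computational_Algebra.Polynomial"
begin

text \<open>Let \<open>n \<ge> 2\<close>, let \<open>\<phi>\<close> be an automorphism of \<open>div0\<close> and \<open>D\<^sub>i = \<phi>(\<partial>\<^sub>i)\<close>. The elements whose image
  vanishes at the origin form a subalgebra of codimension \<open>n\<close>; it contains no constant field
  \<open>v \<noteq> 0\<close>, because \<open>ad v\<close> is locally nilpotent and onto. Hence the Jacobian \<open>J\<close> of the \<open>D\<^sub>i\<close> is nonzero
  at the origin. As the \<open>D\<^sub>i\<close> commute and have divergence \<open>0\<close>, Liouville's formula gives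
  \<open>D\<^sub>i J = 0\<close>, so \<open>J\<close> is a unit and the \<open>D\<^sub>i\<close> are a basis of all derivations. For
  \<open>h = \<Sum>\<^sub>k h\<^sub>k x\<^sub>k \<partial>\<^sub>k\<close> with all \<open>h\<^sub>k \<noteq> 0\<close>, the coefficients of \<open>\<phi>(h)\<close> in this basis yield
  \<open>y\<^sub>k\<close> with \<open>D\<^sub>i y\<^sub>k = \<delta>\<^sub>i\<^sub>k\<close>. The locally nilpotent elements for the \<open>D\<^sub>i\<close> are a \<open>div0\<close>-stable
  subalgebra containing the \<open>y\<^sub>k\<close>, hence everything, and so \<open>\<sigma> : x\<^sub>k \<mapsto> y\<^sub>k\<close> is an automorphism.
  Finally \<open>\<sigma>\<^sup>-\<^sup>1 \<phi> \<sigma>\<close> fixes the \<open>\<partial>\<^sub>i\<close> and \<open>h\<close>; comparing weights it fixes all fields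
  \<open>x\<^sup>m \<partial>\<^sub>j\<close> with \<open>m\<^sub>j = 0\<close>, and these generate \<open>div0\<close>. The same Liouville formula, with \<open>J\<close> a unit and
  therefore constant, shows that conjugation preserves \<open>div0\<close>.\<close>

section \<open>Polynomials\<close>

lemma poly_induct [case_names const var add mult]:
  fixes p :: "('n::finite, 'k::comm_ring_1) mpoly"
  assumes const: "\<And>c. P (pconst c)" and var: "\<And>i. P (pvar i)"
    and add: "\<And>p q. P p \<Longrightarrow> P q \<Longrightarrow> P (p + q)"
    and mult: "\<And>p q. P p \<Longrightarrow> P q \<Longrightarrow> P (p * q)"
  shows "P p"
proof -
  have mono: "P (Poly_Mapping.single m 1)" for m
  proof (induction m rule: exponent_induct)
    case zero
    show ?case using const[of 1] by (simp add: pconst_def)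
  next
    case (add i m)
    have "Poly_Mapping.single (Poly_Mapping.single i 1 + m) (1::'k)
        = pvar i * Poly_Mapping.single m 1"
      by (simp add: pvar_def mult_single)
    then show ?case using mult[OF var add] by simp
  qed
  show ?thesis
  proof (induction p rule: monomial_induct)
    case zero
    show ?case using const[of 0] by (simp add: pconst_simps)
  next
    case (add m c p)
    then show ?case
      by (subst single_eq_pconst_mult) (intro assms mono)
  qed
qed

lemma pconst_diff: "pconst (a - b) = pconst a - pconst (b::'k::comm_ring_1)"
  by (simp add: pconst_def single_diff)

lemma pconst_uminus: "pconst (- b) = - pconst (b::'k::comm_ring_1)"
  by (simp add: pconst_def single_uminus)

lemma pconst_inject: "pconst a = pconst b \<longleftrightarrow> a = b"
  by (metis lookup_single_eq pconst_def)

lemma partial_pconst: "partial i (pconst c) = 0"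
  by (simp add: pconst_def partial_single)

lemma lookup_zero_pconst: "Poly_Mapping.lookup (pconst c) 0 = c"
  by (simp add: pconst_def)

text \<open>The coefficient at \<open>0\<close> is the value at the origin; it is multiplicative
  because a sum of exponent vectors is \<open>0\<close> only if both summands are.\<close>

lemma lookup_zero_mult:
  "Poly_Mapping.lookup (p * q) 0
    = Poly_Mapping.lookup p 0 * Poly_Mapping.lookup (q::('n::finite, 'k::comm_ring_1) mpoly) 0"
proof (induction p rule: monomial_induct)
  case (add m c p)
  have "Poly_Mapping.lookup (Poly_Mapping.single m c * q) 0
      = Poly_Mapping.lookup (Poly_Mapping.single m c) 0 * Poly_Mapping.lookup q 0"
  proof (induction q rule: monomial_induct)
    case (add m' d q)
    have "m + m' = 0 \<longleftrightarrow> m = 0 \<and> m' = 0"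
      by (auto simp: poly_mapping_eq_iff fun_eq_iff plus_poly_mapping.rep_eq)
    then have "Poly_Mapping.lookup (Poly_Mapping.single m c * Poly_Mapping.single m' d) 0
      = Poly_Mapping.lookup (Poly_Mapping.single m c) 0
        * Poly_Mapping.lookup (Poly_Mapping.single m' d) 0"
      by (auto simp: mult_single lookup_single when_def)
    then show ?case using add by (simp add: distrib_left lookup_add)
  qed simp
  then show ?case using add by (simp add: distrib_right lookup_add)
qed simp

section \<open>Coefficients of derivatives, antiderivatives and closed systems\<close>

lemma lookup_partial:
  "Poly_Mapping.lookup (partial i (p::('n, 'k::comm_ring_1) mpoly)) m
    = Poly_Mapping.lookup p (m + Poly_Mapping.single i 1) * of_nat (Suc (Poly_Mapping.lookup m i))"
proof (induction p rule: monomial_induct)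
  case (add m' c p)
  have "Poly_Mapping.lookup (partial i (Poly_Mapping.single m' c)) m
    = Poly_Mapping.lookup (Poly_Mapping.single m' c) (m + Poly_Mapping.single i 1)
      * of_nat (Suc (Poly_Mapping.lookup m i))"
  proof (cases "Poly_Mapping.lookup m' i = 0")
    case True
    then have "m' \<noteq> m + Poly_Mapping.single i 1" by (auto simp: lookup_add)
    then show ?thesis using True by (simp add: partial_single lookup_single when_def)
  next
    case False
    then have *: "m' - Poly_Mapping.single i 1 = m \<longleftrightarrow> m' = m + Poly_Mapping.single i 1"
      by (auto simp: poly_mapping_eq_iff fun_eq_iff lookup_add lookup_minus lookup_single when_def
          split: if_splits)
    show ?thesis
      by (auto simp: partial_single lookup_single when_def * lookup_add ac_simps simp del: One_nat_def)
  qed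
  then show ?case using add
    by (simp add: partial_add lookup_add distrib_right del: of_nat_Suc)
qed (simp add: partial_zero)

text \<open>In characteristic zero the factor \<open>m\<^sub>i\<close> produced by differentiation
  does not vanish, so a monomial containing \<open>x\<^sub>i\<close> would survive.\<close>

lemma partial_eq_0_keys:
  fixes p :: "('n, 'k::field_char_0) mpoly"
  assumes "partial i p = 0" "m \<in> Poly_Mapping.keys p"
  shows "Poly_Mapping.lookup m i = 0"
proof (rule ccontr)
  assume nz: "Poly_Mapping.lookup m i \<noteq> 0"
  define m' where "m' = m - Poly_Mapping.single i 1"
  have "m = m' + Poly_Mapping.single i 1"
    using nz unfolding m'_def
    by (intro poly_mapping_eqI) (auto simp: lookup_add lookup_minus lookup_single when_def)
  then have "Poly_Mapping.lookup p m * of_nat (Suc (Poly_Mapping.lookup m' i)) = 0"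
    using lookup_partial[of i p m'] assms(1) by simp
  then show False
    using assms(2) by (simp add: in_keys_iff del: of_nat_Suc)
qed

lemma constant_if_partials_zero:
  fixes p :: "('n::finite, 'k::field_char_0) mpoly"
  assumes "\<And>i. partial i p = 0"
  shows "p = pconst (Poly_Mapping.lookup p 0)"
proof (rule poly_mapping_eqI)
  fix m
  show "Poly_Mapping.lookup p m = Poly_Mapping.lookup (pconst (Poly_Mapping.lookup p 0)) m"
  proof (cases "m = 0")
    case True
    then show ?thesis by (simp add: lookup_zero_pconst)
  next
    case False
    then have "m \<notin> Poly_Mapping.keys p"
      using partial_eq_0_keys[OF assms] by (metis poly_mapping_eqI lookup_zero)
    then show ?thesis using False
      by (simp add: pconst_def lookup_single in_keys_iff)
  qed
qed

lemma partial_sum: "partial i (\<Sum>a\<in>A. f a) = (\<Sum>a\<in>A. partial i (f a :: ('n::finite, 'k::comm_ring_1) mpoly))"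
  by (rule derivation_sum[OF partial_derivation])

text \<open>The antiderivative is taken termwise. It leaves the exponents of the other variables
  alone, which gives the second property.\<close>

lemma integration:
  fixes p :: "('n::finite, 'k::field_char_0) mpoly"
  obtains q where "partial j q = p" "\<And>i. i \<noteq> j \<Longrightarrow> partial i p = 0 \<Longrightarrow> partial i q = 0"
proof
  let ?e = "Poly_Mapping.single j 1"
  let ?q = "\<Sum>m\<in>Poly_Mapping.keys p. Poly_Mapping.single (m + ?e)
    (Poly_Mapping.lookup p m / of_nat (Suc (Poly_Mapping.lookup m j)))"
  show "partial j ?q = p"
    by (subst (4) poly_expansion)
      (simp add: partial_sum partial_single lookup_add del: of_nat_Suc)
  show "partial i ?q = 0" if "i \<noteq> j" "partial i p = 0" for i
    unfolding partial_sum
    using partial_eq_0_keys[OF that(2)] that(1)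
    by (intro sum.neutral ballI) (simp add: partial_single lookup_add lookup_single)
qed

text \<open>The equations are solved for one more variable at a time: by closedness the error
  \<open>q j - partial j p\<close> does not involve the variables treated before, so integrating it
  in direction \<open>j\<close> does not disturb their equations.\<close>

lemma polynomial_poincare:
  fixes q :: "'n::finite \<Rightarrow> ('n, 'k::field_char_0) mpoly"
  assumes closed: "\<And>i j. partial i (q j) = partial j (q i)"
  obtains p where "\<And>i. partial i p = q i"
proof -
  have "\<exists>p. \<forall>i\<in>S. partial i p = q i" for S :: "'n set"
  proof (induction S rule: infinite_finite_induct)
    case (insert j S)
    then obtain p where p: "\<forall>i\<in>S. partial i p = q i" by blast
    obtain s where s: "partial j s = q j - partial j p"
      "\<And>i. i \<noteq> j \<Longrightarrow> partial i (q j - partial j p) = 0 \<Longrightarrow> partial i s = 0"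
      by (rule integration[of j "q j - partial j p"]) blast
    have "partial i s = 0" if "i \<in> S" for i
    proof (rule s(2))
      show "i \<noteq> j" using that insert.hyps by blast
      show "partial i (q j - partial j p) = 0"
        using that p closed[of i j] partial_commute[of i j p]
        by (simp add: derivation_diff[OF partial_derivation])
    qed
    then have "\<forall>i\<in>insert j S. partial i (p + s) = q i"
      using p s insert.hyps by (auto simp: partial_add)
    then show ?case by blast
  qed auto
  from this[of UNIV] show ?thesis using that by auto
qed

section \<open>Substitution homomorphisms\<close>

definition psubst :: "('n::finite \<Rightarrow> ('n, 'k::comm_ring_1) mpoly) \<Rightarrow> ('n, 'k) mpoly \<Rightarrow> ('n, 'k) mpoly"
  where "psubst y p = (\<Sum>m\<in>Poly_Mapping.keys p.
    pconst (Poly_Mapping.lookup p m) * (\<Prod>i\<in>UNIV. y i ^ Poly_Mapping.lookup m i))"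

definition alg_hom :: "(('n, 'k::comm_ring_1) mpoly \<Rightarrow> ('n, 'k) mpoly) \<Rightarrow> bool" where
  "alg_hom \<sigma> \<longleftrightarrow> (\<forall>p q. \<sigma> (p + q) = \<sigma> p + \<sigma> q) \<and> (\<forall>p q. \<sigma> (p * q) = \<sigma> p * \<sigma> q) \<and>
     (\<forall>c. \<sigma> (pconst c) = pconst c)"

lemma psubst_superset:
  assumes "finite A" "Poly_Mapping.keys p \<subseteq> A"
  shows "psubst y p = (\<Sum>m\<in>A. pconst (Poly_Mapping.lookup p m) * (\<Prod>i\<in>UNIV. y i ^ Poly_Mapping.lookup m i))"
  unfolding psubst_def using assms
  by (intro sum.mono_neutral_left) (auto simp: in_keys_iff pconst_simps)

lemma psubst_single:
  "psubst y (Poly_Mapping.single m c) = pconst c * (\<Prod>i\<in>UNIV. y i ^ Poly_Mapping.lookup m i)"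
  by (subst psubst_superset[of "{m}"]) auto

lemma psubst_add: "psubst y (p + q) = psubst y p + psubst y q"
proof -
  let ?A = "Poly_Mapping.keys p \<union> Poly_Mapping.keys q"
  have "psubst y (p + q) = (\<Sum>m\<in>?A. pconst (Poly_Mapping.lookup (p + q) m)
      * (\<Prod>i\<in>UNIV. y i ^ Poly_Mapping.lookup m i))"
    by (rule psubst_superset) (use Poly_Mapping.keys_add[of p q] in auto)
  also have "\<dots> = psubst y p + psubst y q"
    by (simp add: psubst_superset[of ?A] lookup_add pconst_simps ring_distribs sum.distrib)
  finally show ?thesis .
qed

lemma psubst_zero: "psubst y 0 = 0"
  by (simp add: psubst_def)

lemma psubst_mult: "psubst y (p * q) = psubst y p * psubst y q"
proof (induction p rule: monomial_induct)
  case (add m c p)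
  have "psubst y (Poly_Mapping.single m c * q) = psubst y (Poly_Mapping.single m c) * psubst y q"
  proof (induction q rule: monomial_induct)
    case (add m' d q)
    have "psubst y (Poly_Mapping.single m c * Poly_Mapping.single m' d)
        = psubst y (Poly_Mapping.single m c) * psubst y (Poly_Mapping.single m' d)"
      by (simp add: mult_single psubst_single lookup_add power_add prod.distrib pconst_simps ac_simps)
    then show ?case using add by (simp add: distrib_left psubst_add)
  qed (simp add: psubst_zero)
  then show ?case using add by (simp add: distrib_right psubst_add)
qed (simp add: psubst_zero)

lemma alg_hom_psubst: "alg_hom (psubst y)"
  by (simp add: alg_hom_def psubst_add psubst_mult) (simp add: pconst_def psubst_single)

lemma psubst_pvar: "psubst y (pvar j) = y j"
proof -
  have "(\<Prod>i\<in>UNIV. y i ^ Poly_Mapping.lookup (Poly_Mapping.single j 1) i)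
      = (\<Prod>i\<in>UNIV. if j = i then y i else 1)"
    by (intro prod.cong) (auto simp: lookup_single when_def)
  then show ?thesis by (simp add: pvar_def psubst_single pconst_simps)
qed

lemma alg_hom_add: "alg_hom \<sigma> \<Longrightarrow> \<sigma> (p + q) = \<sigma> p + \<sigma> q"
  and alg_hom_mult: "alg_hom \<sigma> \<Longrightarrow> \<sigma> (p * q) = \<sigma> p * \<sigma> q"
  and alg_hom_pconst: "alg_hom \<sigma> \<Longrightarrow> \<sigma> (pconst c) = pconst c"
  by (simp_all add: alg_hom_def)

lemma alg_hom_zero: "alg_hom \<sigma> \<Longrightarrow> \<sigma> 0 = 0"
  and alg_hom_one: "alg_hom \<sigma> \<Longrightarrow> \<sigma> 1 = 1"
  using alg_hom_pconst[of \<sigma> 0] alg_hom_pconst[of \<sigma> 1] by (simp_all add: pconst_simps)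

lemma alg_hom_diff: "alg_hom \<sigma> \<Longrightarrow> \<sigma> (p - q) = \<sigma> p - \<sigma> q"
  using alg_hom_add[of \<sigma> "p - q" q] by simp

lemma alg_hom_sum: "alg_hom \<sigma> \<Longrightarrow> \<sigma> (\<Sum>i\<in>A. f i) = (\<Sum>i\<in>A. \<sigma> (f i))"
  by (induction A rule: infinite_finite_induct) (simp_all add: alg_hom_zero alg_hom_add)

lemma alg_hom_eqI:
  fixes \<sigma> \<tau> :: "('n::finite, 'k::comm_ring_1) mpoly \<Rightarrow> ('n, 'k) mpoly"
  assumes "alg_hom \<sigma>" "alg_hom \<tau>" "\<And>i. \<sigma> (pvar i) = \<tau> (pvar i)"
  shows "\<sigma> = \<tau>"
proof
  show "\<sigma> p = \<tau> p" for p
    by (induction p rule: poly_induct)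
      (simp_all add: assms alg_hom_add alg_hom_mult alg_hom_pconst)
qed

lemma derivation_pconst: "\<delta> \<in> derivations \<Longrightarrow> \<delta> (pconst c) = (0 :: ('n::finite, 'k::comm_ring_1) mpoly)"
  using derivation_pconst_mult[of \<delta> c 1] derivation_one[of \<delta>] by simp

text \<open>Both sides obey the same Leibniz rule along \<open>\<sigma>\<close>, so agreement on the
  variables suffices.\<close>

lemma chain_rule:
  fixes \<sigma> :: "('n::finite, 'k::comm_ring_1) mpoly \<Rightarrow> ('n, 'k) mpoly"
  assumes s: "alg_hom \<sigma>" and d: "\<delta> \<in> derivations" and e: "\<epsilon> \<in> derivations"
    and v: "\<And>j. \<delta> (\<sigma> (pvar j)) = \<sigma> (\<epsilon> (pvar j))"
  shows "\<delta> (\<sigma> p) = \<sigma> (\<epsilon> p)"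
  by (induction p rule: poly_induct)
    (simp_all add: v alg_hom_add[OF s] alg_hom_mult[OF s] alg_hom_pconst[OF s] alg_hom_zero[OF s]
      derivation_add[OF d] derivation_add[OF e] derivation_mult[OF d] derivation_mult[OF e]
      derivation_pconst[OF d] derivation_pconst[OF e])

section \<open>Units\<close>

text \<open>Kronecker's substitution: \<open>x\<^sub>i \<mapsto> X ^ (N ^ k)\<close> if \<open>i\<close> is the \<open>k\<close>-th variable of the list.\<close>

primrec kronecker :: "nat \<Rightarrow> 'n list \<Rightarrow> ('n \<Rightarrow>\<^sub>0 nat) \<Rightarrow> nat" where
  "kronecker N [] m = 0"
| "kronecker N (i # is) m = Poly_Mapping.lookup m i + N * kronecker N is m"

lemma kronecker_add: "kronecker N is (m + m') = kronecker N is m + kronecker N is m'"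
  by (induction "is") (simp_all add: lookup_add algebra_simps)

lemma kronecker_zero: "kronecker N is 0 = 0"
  by (induction "is") simp_all

text \<open>\<open>kronecker\<close> reads the exponents as digits in base \<open>N\<close>; the
  residue modulo \<open>N\<close> is the digit of the first variable in the list.\<close>

lemma kronecker_inj:
  assumes "kronecker N is m = kronecker N is m'"
    and "\<And>i. i \<in> set is \<Longrightarrow> Poly_Mapping.lookup m i < N"
    and "\<And>i. i \<in> set is \<Longrightarrow> Poly_Mapping.lookup m' i < N"
    and "i \<in> set is"
  shows "Poly_Mapping.lookup m i = Poly_Mapping.lookup m' i"
  using assms
proof (induction "is")
  case (Cons j "is")
  let ?a = "Poly_Mapping.lookup m j" and ?b = "Poly_Mapping.lookup m' j"
  have lt: "?a < N" "?b < N" using Cons.prems by auto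
  have eq: "?a + N * kronecker N is m = ?b + N * kronecker N is m'" using Cons.prems by simp
  have "(?a + N * kronecker N is m) mod N = (?b + N * kronecker N is m') mod N" using eq by simp
  then have ab: "?a = ?b" using lt by simp
  then have "kronecker N is m = kronecker N is m'" using eq lt by simp
  then show ?case using Cons ab by auto
qed simp

definition kronecker_hom :: "nat \<Rightarrow> 'n list \<Rightarrow> ('n, 'k::comm_ring_1) mpoly \<Rightarrow> 'k poly" where
  "kronecker_hom N is p
    = (\<Sum>m\<in>Poly_Mapping.keys p. monom (Poly_Mapping.lookup p m) (kronecker N is m))"

lemma kronecker_hom_superset:
  assumes "finite A" "Poly_Mapping.keys p \<subseteq> A"
  shows "kronecker_hom N is p = (\<Sum>m\<in>A. monom (Poly_Mapping.lookup p m) (kronecker N is m))"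
  unfolding kronecker_hom_def using assms
  by (intro sum.mono_neutral_left) (auto simp: in_keys_iff)

lemma kronecker_hom_single:
  "kronecker_hom N is (Poly_Mapping.single m c) = monom c (kronecker N is m)"
  by (subst kronecker_hom_superset[of "{m}"]) auto

lemma kronecker_hom_add: "kronecker_hom N is (p + q) = kronecker_hom N is p + kronecker_hom N is q"
proof -
  let ?A = "Poly_Mapping.keys p \<union> Poly_Mapping.keys q"
  have "kronecker_hom N is (p + q)
      = (\<Sum>m\<in>?A. monom (Poly_Mapping.lookup (p + q) m) (kronecker N is m))"
    by (rule kronecker_hom_superset) (use Poly_Mapping.keys_add[of p q] in auto)
  also have "\<dots> = kronecker_hom N is p + kronecker_hom N is q"
    by (simp add: kronecker_hom_superset[of ?A] lookup_add add_monom[symmetric] sum.distrib)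
  finally show ?thesis .
qed

lemma kronecker_hom_zero: "kronecker_hom N is 0 = 0"
  by (simp add: kronecker_hom_def)

lemma kronecker_hom_mult: "kronecker_hom N is (p * q) = kronecker_hom N is p * kronecker_hom N is q"
proof (induction p rule: monomial_induct)
  case (add m c p)
  have "kronecker_hom N is (Poly_Mapping.single m c * q)
      = kronecker_hom N is (Poly_Mapping.single m c) * kronecker_hom N is q"
  proof (induction q rule: monomial_induct)
    case (add m' d q)
    have "kronecker_hom N is (Poly_Mapping.single m c * Poly_Mapping.single m' d)
        = kronecker_hom N is (Poly_Mapping.single m c) * kronecker_hom N is (Poly_Mapping.single m' d)"
      by (simp add: mult_single kronecker_hom_single kronecker_add mult_monom)
    then show ?case using add by (simp add: distrib_left kronecker_hom_add)
  qed (simp add: kronecker_hom_zero)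
  then show ?case using add by (simp add: distrib_right kronecker_hom_add)
qed (simp add: kronecker_hom_zero)

text \<open>If \<open>N\<close> exceeds all exponents of \<open>p\<close>, Kronecker's substitution
  keeps the monomials of \<open>p\<close> apart. The image of \<open>p\<close> is a unit in one
  variable, hence of degree 0, so no monomial other than 1 occurs in \<open>p\<close>.\<close>

lemma unit_is_constant:
  fixes p q :: "('n::finite, 'k::field) mpoly"
  assumes unit: "p * q = 1"
  shows "p = pconst (Poly_Mapping.lookup p 0)"
proof -
  obtain "is" :: "'n list" where vars: "set is = UNIV" using finite_list[of "UNIV :: 'n set"] by auto
  obtain N where N: "\<And>m i. m \<in> Poly_Mapping.keys p \<Longrightarrow> Poly_Mapping.lookup m i < N"
  proof
    let ?B = "(\<lambda>(m, i). Poly_Mapping.lookup m i) ` (Poly_Mapping.keys p \<times> UNIV)"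
    show "Poly_Mapping.lookup m i < Suc (Max ?B)" if "m \<in> Poly_Mapping.keys p" for m i
      using that by (intro le_imp_less_Suc Max_ge) auto
  qed
  let ?\<theta> = "kronecker_hom N is"
  have one: "?\<theta> 1 = 1"
    using kronecker_hom_single[of N "is" 0 1] by (simp add: kronecker_zero monom_0 one_pCons)
  have "?\<theta> p dvd 1" using unit kronecker_hom_mult one by (metis dvd_triv_left)
  then have deg: "degree (?\<theta> p) = 0" by (auto simp: is_unit_poly_iff)
  have "m = 0" if m: "m \<in> Poly_Mapping.keys p" for m
  proof -
    have inj: "m' = m \<longleftrightarrow> kronecker N is m' = kronecker N is m" if "m' \<in> Poly_Mapping.keys p" for m'
      using kronecker_inj[of N "is" m' m] N m that vars by (auto intro!: poly_mapping_eqI)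
    have "coeff (?\<theta> p) (kronecker N is m)
        = (\<Sum>m'\<in>Poly_Mapping.keys p. if m' = m then Poly_Mapping.lookup p m' else 0)"
      unfolding kronecker_hom_def coeff_sum by (intro sum.cong) (auto simp: inj)
    also have "\<dots> = Poly_Mapping.lookup p m" using m by simp
    finally have "coeff (?\<theta> p) (kronecker N is m) \<noteq> 0" using m by (simp add: in_keys_iff)
    then have k0: "kronecker N is m = 0" using deg le_degree by fastforce
    \<comment> \<open>The comparison vector \<open>0\<close> must have digits below \<open>N\<close>
      as well.\<close>
    have "0 < N" using N[OF m] by (metis gr_zeroI not_less_zero)
    then show "m = 0"
      using kronecker_inj[of N "is" m 0] k0 N[OF m] vars
      by (auto intro!: poly_mapping_eqI simp: kronecker_zero)
  qed
  then show ?thesis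
    by (intro poly_mapping_eqI) (auto simp: pconst_def lookup_single when_def in_keys_iff)
qed

section \<open>Determinants over commutative rings\<close>

text \<open>By multilinearity in row \<open>k\<close>; for \<open>m \<noteq> k\<close> the summand
  has two equal rows, so only the term of \<open>row k A\<close> survives.\<close>

lemma det_row_combination:
  fixes A :: "'a::comm_ring_1^'n^'n"
  shows "det (\<chi> i. if i = k then (\<Sum>m\<in>UNIV. b m *s row m A) else row i A) = b k * det A"
proof -
  have "det (\<chi> i. if i = k then b m *s row m A else row i A)
      = (if m = k then b k * det A else 0)" for m
  proof -
    have "det (\<chi> i. if i = k then b m *s row m A else row i A)
        = b m * det (\<chi> i. if i = k then row m A else row i A)"
      using det_row_mul[of k "b m" "\<lambda>_. row m A" "\<lambda>i. row i A"] by simp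
    moreover have "det (\<chi> i. if i = k then row m A else row i A) = 0" if "m \<noteq> k"
      using that by (intro det_identical_rows[of m k]) (auto simp: row_def vec_eq_iff)
    moreover have "(\<chi> i. if i = k then row k A else row i A) = A"
      by (auto simp: row_def vec_eq_iff)
    ultimately show ?thesis by auto
  qed
  then show ?thesis
    by (simp add: det_linear_row_sum)
qed

text \<open>The witness is the adjugate: its entry \<open>(j, k)\<close> is the determinant with row
  \<open>k\<close> replaced by the \<open>j\<close>-th unit vector, a cofactor. Entry
  \<open>(m, k)\<close> of the product is then the determinant with row \<open>k\<close> replaced by
  row \<open>m\<close>.\<close>

lemma mult_adjugate:
  fixes A :: "'a::comm_ring_1^'n^'n"
  obtains X where "A ** X = mat (det A)"
proof
  let ?X = "(\<chi> j k. det (\<chi> i. if i = k then axis j 1 else row i A))"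
  have "(A ** ?X) $ m $ k = mat (det A) $ m $ k" for m k
  proof -
    have "(A ** ?X) $ m $ k
        = (\<Sum>j\<in>UNIV. A $ m $ j * det (\<chi> i. if i = k then axis j 1 else row i A))"
      by (simp add: matrix_matrix_mult_def)
    also have "\<dots> = (\<Sum>j\<in>UNIV. det (\<chi> i. if i = k then A $ m $ j *s axis j 1 else row i A))"
      by (intro sum.cong refl)
        (subst det_row_mul[of k _ "\<lambda>_. axis _ 1" "\<lambda>i. row i A"], simp)
    also have "\<dots> = det (\<chi> i. if i = k then (\<Sum>j\<in>UNIV. A $ m $ j *s axis j 1) else row i A)"
      by (subst det_linear_row_sum) simp_all
    \<comment> \<open>Row \<open>m\<close> is written as a trivial combination of rows, the form
      that \<open>det_row_combination\<close> expects.\<close>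
    also have "(\<Sum>j\<in>UNIV. A $ m $ j *s axis j 1) = (\<Sum>l\<in>UNIV. (if l = m then 1 else 0) *s row l A)"
      by (simp add: vec_eq_iff row_def axis_def if_distrib[of "\<lambda>x. _ * x"]
          if_distrib[of "\<lambda>x. x * _"] cong: if_cong)
    also have "det (\<chi> i. if i = k then (\<Sum>l\<in>UNIV. (if l = m then 1 else 0) *s row l A) else row i A)
        = (if k = m then 1 else 0) * det A"
      by (rule det_row_combination)
    finally show ?thesis by (simp add: mat_def)
  qed
  then show "A ** ?X = mat (det A)" by (simp add: vec_eq_iff)
qed

lemma mat_mult_mat: "mat a ** mat b = (mat (a * b) :: 'a::comm_ring_1^'n^'n)"
  by (simp add: vec_eq_iff matrix_matrix_mult_def mat_def if_distrib[of "\<lambda>x. _ * x"]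
      if_distrib[of "\<lambda>x. x * _"] cong: if_cong)

text \<open>The adjugate gives a right inverse of \<open>A\<close> and, applied to the transpose, a
  left inverse; the two coincide by associativity.\<close>

lemma matrix_inverse_if_unit_det:
  fixes A :: "'a::comm_ring_1^'n^'n"
  assumes u: "det A * u = 1"
  obtains X where "A ** X = mat 1" "X ** A = mat 1"
proof -
  have right: "\<exists>X. B ** X = mat 1" if "det B = det A" for B :: "'a^'n^'n"
  proof -
    obtain Y where "B ** Y = mat (det B)" by (rule mult_adjugate)
    then have "B ** (Y ** mat u) = mat 1"
      using that u by (simp add: matrix_mul_assoc mat_mult_mat)
    then show ?thesis by blast
  qed
  obtain X where X: "A ** X = mat 1" using right by blast
  obtain Y where "transpose A ** Y = mat 1" using right[of "transpose A"] by auto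
  then have Y: "transpose Y ** A = mat 1"
    by (metis matrix_transpose_mul transpose_mat transpose_transpose)
  have "transpose Y = X"
    by (metis X Y matrix_mul_assoc matrix_mul_lid matrix_mul_rid)
  then show ?thesis using that X Y by blast
qed

section \<open>Determinants under derivations\<close>

lemma leibniz_prod:
  fixes d :: "'a::comm_ring_1 \<Rightarrow> 'a"
  assumes mult: "\<And>x y. d (x * y) = d x * y + x * d y" and "finite S"
  shows "d (\<Prod>i\<in>S. f i) = (\<Sum>k\<in>S. \<Prod>i\<in>S. if i = k then d (f i) else f i)"
  using \<open>finite S\<close>
proof induction
  case empty
  show ?case using mult[of 1 1] by simp
next
  case (insert j S)
  have "(\<Sum>k\<in>S. (if j = k then d (f j) else f j) * (\<Prod>i\<in>S. if i = k then d (f i) else f i))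
      = f j * (\<Sum>k\<in>S. \<Prod>i\<in>S. if i = k then d (f i) else f i)"
    unfolding sum_distrib_left using insert.hyps by (intro sum.cong) auto
  moreover have "(\<Prod>i\<in>S. if i = j then d (f i) else f i) = (\<Prod>i\<in>S. f i)"
    using insert.hyps by (intro prod.cong) auto
  ultimately show ?case using insert by (simp add: mult)
qed

lemma leibniz_det:
  fixes d :: "'a::comm_ring_1 \<Rightarrow> 'a" and A :: "'a^'n^'n"
  assumes add: "\<And>x y. d (x + y) = d x + d y" and mult: "\<And>x y. d (x * y) = d x * y + x * d y"
  shows "d (det A) = (\<Sum>k\<in>UNIV. det (\<chi> i. if i = k then (\<chi> j. d (A $ k $ j)) else row i A))"
proof -
  have zero: "d 0 = 0" using add[of 0 0] by simp
  have sum: "d (\<Sum>x\<in>S. f x) = (\<Sum>x\<in>S. d (f x))" for f :: "('n \<Rightarrow> 'n) \<Rightarrow> 'a" and S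
    by (induction S rule: infinite_finite_induct) (simp_all add: zero add)
  have one: "d 1 = 0" using mult[of 1 1] by simp
  have minus: "d (- 1) = 0" using add[of 1 "- 1"] zero one by (simp only: add.right_inverse add_0_left)
  have const: "d (of_int (sign p) * x) = of_int (sign p) * d x" for p :: "'n \<Rightarrow> 'n" and x
    by (simp only: mult) (simp add: sign_def one minus)
  let ?P = "{p. p permutes (UNIV :: 'n set)}"
  have "d (det A) = (\<Sum>p\<in>?P. of_int (sign p) *
      (\<Sum>k\<in>UNIV. \<Prod>i\<in>UNIV. if i = k then d (A $ i $ p i) else A $ i $ p i))"
    by (simp add: det_def sum const leibniz_prod[OF mult])
  also have "\<dots> = (\<Sum>k\<in>UNIV. \<Sum>p\<in>?P. of_int (sign p) *
      (\<Prod>i\<in>UNIV. if i = k then d (A $ i $ p i) else A $ i $ p i))"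
    by (simp add: sum_distrib_left) (rule sum.swap)
  also have "\<dots> = (\<Sum>k\<in>UNIV. det (\<chi> i. if i = k then (\<chi> j. d (A $ k $ j)) else row i A))"
    unfolding det_def
    by (intro sum.cong refl arg_cong2[of _ _ _ _ "(*)"] prod.cong) (simp add: row_def)
  finally show ?thesis .
qed

text \<open>Each differentiated row is a combination of the rows of \<open>A\<close>, and
  \<open>det_row_combination\<close> retains only the diagonal of \<open>B\<close>, whence the
  trace.\<close>

lemma liouville_det:
  fixes d :: "'a::comm_ring_1 \<Rightarrow> 'a" and A :: "'a^'n^'n"
  assumes add: "\<And>x y. d (x + y) = d x + d y" and mult: "\<And>x y. d (x * y) = d x * y + x * d y"
    and lin: "\<And>k j. d (A $ k $ j) = (\<Sum>m\<in>UNIV. B k m * A $ m $ j)"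
  shows "d (det A) = (\<Sum>k\<in>UNIV. B k k) * det A"
proof -
  have "(\<chi> j. d (A $ k $ j)) = (\<Sum>m\<in>UNIV. B k m *s row m A)" for k
    by (simp add: vec_eq_iff lin row_def)
  then have "d (det A) = (\<Sum>k\<in>UNIV. B k k * det A)"
    by (simp only: leibniz_det[of d, OF add mult] det_row_combination)
  then show ?thesis by (simp add: sum_distrib_right)
qed

text \<open>Cramer's rule for a homogeneous system over a ring: putting the vanishing combination
  into row \<open>k\<close> multiplies the determinant by \<open>g k\<close> and yields 0.\<close>

lemma cramer_zero:
  fixes A :: "'a::comm_ring_1^'n^'n"
  assumes "\<And>i. (\<Sum>k\<in>UNIV. g k * A $ k $ i) = 0"
  shows "g k * det A = 0"
proof -
  have "(\<Sum>m\<in>UNIV. g m *s row m A) = 0"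
    using assms by (simp add: vec_eq_iff row_def)
  then show ?thesis
    using det_row_combination[of k g A] det_row_0[of k "\<lambda>i. row i A"] by (simp only:)
qed

section \<open>Vector fields\<close>

lemma pconst_sum: "pconst (\<Sum>i\<in>A. w i) = (\<Sum>i\<in>A. pconst (w i :: 'k::comm_ring_1))"
  by (induction A rule: infinite_finite_induct) (simp_all add: pconst_simps)

lemma derivation_uminus: "\<delta> \<in> derivations \<Longrightarrow> \<delta> (- p) = - \<delta> (p :: ('n::finite, 'k::comm_ring_1) mpoly)"
  using derivation_diff[of \<delta> 0 p] derivation_zero[of \<delta>] by simp

definition vector_field ::
    "('n::finite \<Rightarrow> ('n, 'k::comm_ring_1) mpoly) \<Rightarrow> ('n, 'k) mpoly \<Rightarrow> ('n, 'k) mpoly" where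
  "vector_field a p = (\<Sum>i\<in>UNIV. a i * partial i p)"

definition const_field ::
    "('n::finite \<Rightarrow> 'k::comm_ring_1) \<Rightarrow> ('n, 'k) mpoly \<Rightarrow> ('n, 'k) mpoly" where
  "const_field v = vector_field (\<lambda>i. pconst (v i))"

definition diag_field ::
    "('n::finite \<Rightarrow> 'k::comm_ring_1) \<Rightarrow> ('n, 'k) mpoly \<Rightarrow> ('n, 'k) mpoly" where
  "diag_field w = vector_field (\<lambda>i. pconst (w i) * pvar i)"

text \<open>The Hamiltonian field of \<open>f\<close>, that is \<open>p \<mapsto> {f, p}\<close> for
  the Poisson bracket in the variables \<open>x\<^sub>i\<close>, \<open>x\<^sub>j\<close>; its
  divergence vanishes because partial derivatives commute.\<close>

definition ham_field ::
    "'n \<Rightarrow> 'n \<Rightarrow> ('n::finite, 'k::comm_ring_1) mpoly \<Rightarrow> ('n, 'k) mpoly \<Rightarrow> ('n, 'k) mpoly" where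
  "ham_field i j f p = partial i f * partial j p - partial j f * partial i p"

lemma vector_field_derivation: "vector_field a \<in> derivations"
  unfolding vector_field_def[abs_def] by (rule expansion_derivation)

lemma vector_field_pvar: "vector_field a (pvar j) = a j"
  by (simp add: vector_field_def expansion_pvar)

lemma derivation_eq_vector_field:
  "\<delta> \<in> derivations \<Longrightarrow> \<delta> p = vector_field (\<lambda>i. \<delta> (pvar i)) p"
  using derivation_unique_expansion[of \<delta> "\<lambda>i. \<delta> (pvar i)"]
  unfolding vector_field_def by metis

lemma ham_field_eq_vector_field:
  "ham_field i j f = vector_field
    (\<lambda>k. (if k = j then partial i f else 0) - (if k = i then partial j f else 0))"
  by (simp add: fun_eq_iff ham_field_def vector_field_def left_diff_distrib sum_subtractf
      if_distrib[of "\<lambda>x. x * _"] cong: if_cong)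

lemma ham_field_derivation: "ham_field i j f \<in> derivations"
  by (simp add: ham_field_eq_vector_field vector_field_derivation)

lemma ham_field_pvar:
  "ham_field i j f (pvar k) = (if k = j then partial i f else 0) - (if k = i then partial j f else 0)"
  by (simp add: ham_field_eq_vector_field vector_field_pvar)

lemma const_field_pvar: "const_field v (pvar k) = pconst (v k)"
  by (simp add: const_field_def vector_field_pvar)

lemma diag_field_pvar: "diag_field w (pvar k) = pconst (w k) * pvar k"
  by (simp add: diag_field_def vector_field_pvar)

lemma const_field_derivation: "const_field v \<in> derivations"
  by (simp add: const_field_def vector_field_derivation)

lemma diag_field_derivation: "diag_field w \<in> derivations"
  by (simp add: diag_field_def vector_field_derivation)

lemma div0_derivation: "\<delta> \<in> div0 \<Longrightarrow> \<delta> \<in> derivations"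
  by (simp add: div0_def)

lemma const_field_div0: "const_field v \<in> div0"
  by (simp add: div0_def const_field_derivation divergence_def const_field_pvar partial_pconst)

lemma partial_div0: "partial i \<in> div0"
  by (simp add: div0_def partial_derivation divergence_def partial_pvar)
    (intro sum.neutral ballI, simp add: derivation_one[OF partial_derivation] partial_zero)

lemma diag_field_div0: "(\<Sum>i\<in>UNIV. w i) = 0 \<Longrightarrow> diag_field w \<in> div0"
  by (simp add: div0_def diag_field_derivation divergence_def diag_field_pvar partial_pconst_mult
      partial_pvar pconst_sum[symmetric] pconst_simps)

lemma ham_field_div0: "ham_field i j f \<in> div0"
  by (simp add: div0_def ham_field_derivation divergence_def ham_field_pvar
      derivation_diff[OF partial_derivation] sum_subtractf if_distrib[of "partial _"] partial_zero
      partial_commute[of i j] cong: if_cong)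

lemma ham_field_add: "ham_field i j (f + g) = op_plus (ham_field i j f) (ham_field i j g)"
  by (simp add: fun_eq_iff ham_field_def op_plus_def partial_add algebra_simps)

text \<open>The Jacobi identity of the Poisson bracket, checked on the variables. It makes the field
  of a Poisson bracket accessible from the fields of its two arguments.\<close>

lemma bracket_ham_field:
  assumes "i \<noteq> j"
  shows "bracket (ham_field i j f) (ham_field i j g) = ham_field i j (ham_field i j f g)"
proof (rule derivations_eqI)
  show "bracket (ham_field i j f) (ham_field i j g) (pvar k) = ham_field i j (ham_field i j f g) (pvar k)" for k
    using assms derivation_zero[OF ham_field_derivation]
    by (auto simp: bracket_def ham_field_pvar)
      (simp_all add: ham_field_def partial_add partial_mult partial_zero
        derivation_diff[OF partial_derivation] derivation_diff[OF ham_field_derivation]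
        derivation_uminus[OF partial_derivation]
        partial_commute[of i j] algebra_simps)
qed (intro bracket_derivation ham_field_derivation)+

text \<open>A constant field commutes with all \<open>partial i\<close>, so its adjoint action on
  Hamiltonian fields is just its action on the Hamiltonian.\<close>

lemma bracket_const_field_ham_field:
  "bracket (const_field v) (ham_field i j f) = ham_field i j (const_field v f)"
proof (rule derivations_eqI)
  have c: "const_field v (partial i f) = partial i (const_field v f)" for i f
    unfolding const_field_def vector_field_def
    by (simp add: partial_sum partial_pconst_mult partial_commute[of i])
  show "bracket (const_field v) (ham_field i j f) (pvar k) = ham_field i j (const_field v f) (pvar k)" for k
    by (simp add: bracket_def ham_field_pvar const_field_pvar derivation_pconst[OF ham_field_derivation]
        derivation_diff[OF const_field_derivation] c derivation_zero[OF const_field_derivation])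
qed (intro bracket_derivation ham_field_derivation const_field_derivation)+

lemma exists_other_index:
  fixes i :: "'n::finite"
  assumes "2 \<le> CARD('n)"
  obtains j where "j \<noteq> i"
proof (rule ccontr)
  assume "\<not> thesis"
  then have "UNIV = {i}" using that by auto
  then have "CARD('n) = card {i}" by simp
  then show False using assms by simp
qed

text \<open>Clearing the coefficients in the directions \<open>i \<noteq> l\<close> by fields \<open>D\<^sub>i\<^sub>l f\<close> leaves \<open>b \<partial>\<^sub>l\<close> with
  \<open>\<partial>\<^sub>l b = 0\<close>, which is again of this form.\<close>

lemma div0_induct [consumes 2, case_names zero add ham]:
  fixes \<delta> :: "('n::finite, 'k::field_char_0) mpoly \<Rightarrow> ('n, 'k) mpoly"
  assumes "2 \<le> CARD('n)" and \<delta>: "\<delta> \<in> div0"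
    and zero: "P (\<lambda>_. 0)"
    and add: "\<And>\<delta> \<epsilon>. \<delta> \<in> div0 \<Longrightarrow> \<epsilon> \<in> div0 \<Longrightarrow> P \<delta> \<Longrightarrow> P \<epsilon> \<Longrightarrow> P (op_plus \<delta> \<epsilon>)"
    and ham: "\<And>i j f. i \<noteq> j \<Longrightarrow> P (ham_field i j f)"
  shows "P \<delta>"
proof -
  fix l :: 'n
  obtain j where jl: "j \<noteq> l" by (rule exists_other_index[OF assms(1)])
  \<comment> \<open>For \<open>i \<noteq> l\<close> the coefficient of
    \<open>ham_field i l f\<close> at \<open>x\<^sub>i\<close> is \<open>- partial l f\<close>,
    hence the sign.\<close>
  have "\<exists>f. partial l f = - \<delta> (pvar i)" for i
    by (rule integration[of l "- \<delta> (pvar i)"]) blast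
  then obtain f where f: "\<And>i. partial l (f i) = - \<delta> (pvar i)" by metis
  define E where "E S p = (\<Sum>i\<in>S. ham_field i l (f i) p)" for S p
  have E: "E S \<in> div0 \<and> P (E S)" if "l \<notin> S" for S
    using finite[of S] that
  proof induction
    case empty
    have "(\<lambda>_. 0) \<in> div0"
      using const_field_div0[of "\<lambda>_. 0"]
      by (simp add: const_field_def vector_field_def[abs_def] pconst_simps)
    then show ?case by (simp add: E_def[abs_def] zero)
  next
    case (insert i S)
    then have "E (insert i S) = op_plus (ham_field i l (f i)) (E S)"
      by (simp add: E_def fun_eq_iff op_plus_def)
    then show ?case using insert by (auto intro!: add ham ham_field_div0 div0_op_plus)
  qed
  let ?E = "E (UNIV - {l})"
  have Ek: "?E (pvar k) = \<delta> (pvar k)" if "k \<noteq> l" for k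
    using that by (simp add: E_def ham_field_pvar f sum_negf if_distrib[of uminus] cong: if_cong)
  have split: "(\<Sum>k\<in>UNIV. partial k (\<epsilon> (pvar k)))
      = partial l (\<epsilon> (pvar l)) + (\<Sum>k\<in>UNIV - {l}. partial k (\<epsilon> (pvar k)))"
    for \<epsilon> :: "('n, 'k) mpoly \<Rightarrow> ('n, 'k) mpoly"
    by (rule sum.remove) auto
  have "(\<Sum>k\<in>UNIV. partial k (?E (pvar k))) = (\<Sum>k\<in>UNIV. partial k (\<delta> (pvar k)))"
    using E[of "UNIV - {l}"] \<delta> by (simp add: div0_def divergence_def)
  moreover have "(\<Sum>k\<in>UNIV - {l}. partial k (?E (pvar k))) = (\<Sum>k\<in>UNIV - {l}. partial k (\<delta> (pvar k)))"
    using Ek by (intro sum.cong) auto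
  \<comment> \<open>\<open>?E\<close> and \<open>\<delta>\<close> both have divergence 0 and agree
    outside direction \<open>l\<close>, so their terms in direction \<open>l\<close> agree
    too.\<close>
  ultimately have "partial l (?E (pvar l)) = partial l (\<delta> (pvar l))"
    unfolding split by simp
  then have b: "partial l (\<delta> (pvar l) - ?E (pvar l)) = 0"
    by (simp add: derivation_diff[OF partial_derivation])
  \<comment> \<open>Since \<open>g\<close> is independent of \<open>x\<^sub>l\<close>, the field
    \<open>ham_field j l g\<close> is exactly the remaining multiple of
    \<open>\<partial>\<^sub>l\<close>.\<close>
  obtain g where g: "partial j g = \<delta> (pvar l) - ?E (pvar l)" "partial l g = 0"
  proof (rule integration[of j "\<delta> (pvar l) - ?E (pvar l)"])
    fix q
    assume "partial j q = \<delta> (pvar l) - ?E (pvar l)"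
      and "\<And>i. i \<noteq> j \<Longrightarrow> partial i (\<delta> (pvar l) - ?E (pvar l)) = 0 \<Longrightarrow> partial i q = 0"
    then show thesis using that[of q] b jl by simp
  qed
  have "\<delta> = op_plus ?E (ham_field j l g)"
  proof (rule derivations_eqI)
    show "\<delta> (pvar k) = op_plus ?E (ham_field j l g) (pvar k)" for k
      using Ek[of k] g jl by (auto simp: op_plus_def ham_field_pvar)
  qed (use \<delta> E[of "UNIV - {l}"] in
      \<open>simp_all add: op_plus_derivation ham_field_derivation div0_derivation\<close>)
  then show ?thesis using E[of "UNIV - {l}"] add[OF _ ham_field_div0] ham jl by auto
qed

section \<open>Joint nilpotency\<close>

text \<open>For additive \<open>d i\<close>, level \<open>m\<close> consists of the elements killed
  by every word of length \<open>m\<close> in the \<open>d i\<close>. For \<open>partial\<close> in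
  characteristic zero these are the polynomials of degree below \<open>m\<close>, so nonzero
  constants first appear at level 1.\<close>

primrec nilpotent_level :: "('i \<Rightarrow> 'a \<Rightarrow> 'a::zero) \<Rightarrow> nat \<Rightarrow> 'a set" where
  "nilpotent_level d 0 = {0}"
| "nilpotent_level d (Suc m) = {p. \<forall>i. d i p \<in> nilpotent_level d m}"

context
  fixes d :: "'i \<Rightarrow> ('n::finite, 'k::comm_ring_1) mpoly \<Rightarrow> ('n, 'k) mpoly"
  assumes d: "\<And>i. d i \<in> derivations"
begin

lemma nilpotent_level_zero: "0 \<in> nilpotent_level d m"
  by (induction m) (simp_all add: derivation_zero[OF d])

lemma nilpotent_level_add:
  "p \<in> nilpotent_level d m \<Longrightarrow> q \<in> nilpotent_level d m \<Longrightarrow> p + q \<in> nilpotent_level d m"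
  by (induction m arbitrary: p q) (simp_all add: derivation_add[OF d])

lemma nilpotent_level_Suc: "p \<in> nilpotent_level d m \<Longrightarrow> p \<in> nilpotent_level d (Suc m)"
proof (induction m arbitrary: p)
  case 0
  then show ?case by (simp add: derivation_zero[OF d])
next
  case (Suc m)
  then show ?case by simp
qed

lemma nilpotent_level_mono:
  assumes "p \<in> nilpotent_level d m" "m \<le> m'"
  shows "p \<in> nilpotent_level d m'"
  using assms(2,1) by (induction rule: dec_induct) (simp_all add: nilpotent_level_Suc del: nilpotent_level.simps)

text \<open>Induction on \<open>a + b\<close>: by the Leibniz rule \<open>d i\<close> lowers the
  level of one factor in each summand.\<close>

lemma nilpotent_level_mult:
  "p \<in> nilpotent_level d a \<Longrightarrow> q \<in> nilpotent_level d b \<Longrightarrow> p * q \<in> nilpotent_level d (a + b)"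
proof (induction "a + b" arbitrary: a b p q)
  case 0
  then show ?case by simp
next
  case (Suc m)
  show ?case
  proof (cases "a = 0 \<or> b = 0")
    case True
    then show ?thesis using Suc.prems nilpotent_level_zero by auto
  next
    case False
    then obtain a' b' where ab: "a = Suc a'" "b = Suc b'" by (metis not0_implies_Suc)
    have "d i (p * q) \<in> nilpotent_level d m" for i
    proof -
      have "d i p * q \<in> nilpotent_level d m"
        using Suc.hyps(1)[of a' b "d i p" q] Suc.hyps(2) Suc.prems ab by simp
      moreover have "p * d i q \<in> nilpotent_level d m"
        using Suc.hyps(1)[of a b' p "d i q"] Suc.hyps(2) Suc.prems ab by simp
      ultimately show ?thesis by (simp only: derivation_mult[OF d] nilpotent_level_add)
    qed
    then show ?thesis using Suc.hyps(2)[symmetric] by simp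
  qed
qed

lemma nilpotent_level_pconst: "pconst c \<in> nilpotent_level d (Suc 0)"
  by (simp add: derivation_pconst[OF d])

lemma locally_nilpotent_add:
  "\<exists>m. p \<in> nilpotent_level d m \<Longrightarrow> \<exists>m. q \<in> nilpotent_level d m \<Longrightarrow> \<exists>m. p + q \<in> nilpotent_level d m"
  by (meson nilpotent_level_add nilpotent_level_mono nat_le_linear)

text \<open>Locally nilpotent elements are closed under sums and products and include the constants,
  so they are everything once they include the variables.\<close>

lemma locally_nilpotent_if_pvar:
  assumes "\<And>i. \<exists>m. pvar i \<in> nilpotent_level d m"
  shows "\<exists>m. p \<in> nilpotent_level d m"
proof (induction p rule: poly_induct)
  case (const c)
  then show ?case using nilpotent_level_pconst by blast
next
  case (mult p q)
  then show ?case using nilpotent_level_mult by blast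
qed (use assms locally_nilpotent_add in blast)+

end

lemma partial_locally_nilpotent:
  "\<exists>m. (p::('n::finite, 'k::comm_ring_1) mpoly) \<in> nilpotent_level partial m"
proof (rule locally_nilpotent_if_pvar[OF partial_derivation])
  have "pvar i \<in> nilpotent_level partial 2" for i :: 'n
    by (auto simp: numeral_2_eq_2 partial_pvar derivation_one[OF partial_derivation] partial_zero)
  then show "\<exists>m. (pvar i :: ('n, 'k) mpoly) \<in> nilpotent_level partial m" for i by blast
qed

section \<open>Conjugation\<close>

lemma alg_aut_carrier: "\<sigma> \<in> carrier alg_aut_group \<longleftrightarrow> bij \<sigma> \<and> alg_hom \<sigma>"
  by (simp add: alg_aut_group_def Bij_def alg_hom_def extensional_def)

lemma alg_aut_inv:
  assumes "bij \<sigma>" "alg_hom \<sigma>"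
  shows "\<sigma> (inv_into UNIV \<sigma> p) = p" "inv_into UNIV \<sigma> (\<sigma> p) = p"
    "bij (inv_into UNIV \<sigma>)" "alg_hom (inv_into UNIV \<sigma>)"
proof -
  have i: "\<sigma> (inv_into UNIV \<sigma> p) = p" "inv_into UNIV \<sigma> (\<sigma> p) = p" for p
    using assms(1) by (simp_all add: bij_is_inj bij_is_surj surj_f_inv_f)
  show "\<sigma> (inv_into UNIV \<sigma> p) = p" "inv_into UNIV \<sigma> (\<sigma> p) = p" by (rule i)+
  show "bij (inv_into UNIV \<sigma>)" using assms(1) by (rule bij_imp_bij_inv)
  show "alg_hom (inv_into UNIV \<sigma>)"
    unfolding alg_hom_def
  proof (intro conjI allI)
    have inj: "inv_into UNIV \<sigma> p = q" if "p = \<sigma> q" for p q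
      using that i by simp
    show "inv_into UNIV \<sigma> (p + q) = inv_into UNIV \<sigma> p + inv_into UNIV \<sigma> q" for p q
      by (rule inj) (simp add: alg_hom_add[OF assms(2)] i)
    show "inv_into UNIV \<sigma> (p * q) = inv_into UNIV \<sigma> p * inv_into UNIV \<sigma> q" for p q
      by (rule inj) (simp add: alg_hom_mult[OF assms(2)] i)
    show "inv_into UNIV \<sigma> (pconst c) = pconst c" for c
      by (rule inj) (simp add: alg_hom_pconst[OF assms(2)])
  qed
qed

text \<open>As the fields commute, \<open>E j (E i (pvar k)) = E i (E j (pvar k))\<close>. Expanding
  \<open>E i\<close> in partial derivatives exhibits the Jacobian matrix of the coefficients of
  \<open>E j\<close> as the matrix \<open>B\<close> of \<open>liouville_det\<close>; its trace is
  the divergence.\<close>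

lemma liouville_jacobian:
  fixes E :: "'n::finite \<Rightarrow> ('n, 'k::comm_ring_1) mpoly \<Rightarrow> ('n, 'k) mpoly"
  assumes E: "\<And>i. E i \<in> derivations" and comm: "\<And>i j p. E i (E j p) = E j (E i p)"
  shows "E j (det (\<chi> k i. E i (pvar k))) = divergence (E j) * det (\<chi> k i. E i (pvar k))"
  unfolding divergence_def
proof (rule liouville_det[OF derivation_add[OF E] derivation_mult[OF E],
    where B = "\<lambda>k m. partial m (E j (pvar k))"])
  show "E j ((\<chi> k i. E i (pvar k)) $ k $ i)
      = (\<Sum>m\<in>UNIV. partial m (E j (pvar k)) * (\<chi> k i. E i (pvar k)) $ m $ i)" for k i
    using derivation_eq_vector_field[OF E, of i "E j (pvar k)"] comm[of j i "pvar k"]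
    by (simp add: vector_field_def mult.commute)
qed

lemma conj_derivation:
  fixes \<sigma> :: "('n::finite, 'k::comm_ring_1) mpoly \<Rightarrow> ('n, 'k) mpoly"
  assumes "bij \<sigma>" "alg_hom \<sigma>" "\<delta> \<in> derivations"
  shows "\<sigma> \<circ> \<delta> \<circ> inv_into UNIV \<sigma> \<in> derivations"
  unfolding derivations_def
  by (simp add: alg_aut_inv[OF assms(1,2)] alg_hom_add[OF assms(2)] alg_hom_mult[OF assms(2)]
      alg_hom_pconst[OF assms(2)] alg_hom_add[OF alg_aut_inv(4)[OF assms(1,2)]]
      alg_hom_mult[OF alg_aut_inv(4)[OF assms(1,2)]] alg_hom_pconst[OF alg_aut_inv(4)[OF assms(1,2)]]
      derivation_add[OF assms(3)] derivation_mult[OF assms(3)] derivation_pconst[OF assms(3)])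

text \<open>The fields \<open>E i\<close> commute, and their coefficient matrix is inverse to the
  Jacobian matrix of \<open>\<sigma>\<close>, so its determinant is constant and Liouville's formula
  makes them divergence free. The conjugate has coefficients
  \<open>\<sigma> (\<delta> (pvar i))\<close> with respect to the \<open>E i\<close>, whence its
  divergence is the image of that of \<open>\<delta>\<close> under \<open>\<sigma>\<close>.\<close>

lemma conj_div0:
  fixes \<sigma> :: "('n::finite, 'k::field_char_0) mpoly \<Rightarrow> ('n, 'k) mpoly"
  assumes \<sigma>: "bij \<sigma>" "alg_hom \<sigma>" and \<delta>: "\<delta> \<in> div0"
  shows "\<sigma> \<circ> \<delta> \<circ> inv_into UNIV \<sigma> \<in> div0"
proof -
  note inv = alg_aut_inv[OF \<sigma>]
  define E where "E i = \<sigma> \<circ> partial i \<circ> inv_into UNIV \<sigma>" for i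
  have E: "E i \<in> derivations" for i
    unfolding E_def by (intro conj_derivation \<sigma> partial_derivation)
  have E\<sigma>: "E i (\<sigma> p) = \<sigma> (partial i p)" for i p
    by (simp add: E_def inv)
  have comm: "E i (E j p) = E j (E i p)" for i j p
    by (simp add: E_def inv partial_commute[of i j])
  define A :: "(('n, 'k) mpoly)^'n^'n" where "A = (\<chi> k i. E i (pvar k))"
  define M :: "(('n, 'k) mpoly)^'n^'n" where "M = (\<chi> j k. partial k (\<sigma> (pvar j)))"
  have "(M ** A) $ j $ i = mat 1 $ j $ i" for i j
  proof -
    have "(M ** A) $ j $ i = E i (\<sigma> (pvar j))"
      unfolding derivation_eq_vector_field[OF E, of i "\<sigma> (pvar j)"]
      by (simp add: M_def A_def matrix_matrix_mult_def vector_field_def mult.commute)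
    then show ?thesis by (simp add: E\<sigma> partial_pvar mat_def alg_hom_zero[OF \<sigma>(2)] alg_hom_one[OF \<sigma>(2)])
  qed
  then have "M ** A = mat 1" by (simp add: vec_eq_iff)
  then have unit: "det A * det M = 1" by (metis det_I det_mul mult.commute)
  have divE: "divergence (E i) = 0" for i
  proof -
    have "divergence (E i) * det A = E i (det A)"
      using liouville_jacobian[of E, OF E comm, of i] by (simp add: A_def)
    also have "\<dots> = 0"
      using unit_is_constant[OF unit] derivation_pconst[OF E] by metis
    finally have "divergence (E i) * (det A * det M) = 0" by (simp add: mult.assoc[symmetric])
    then show ?thesis by (simp add: unit)
  qed
  let ?a = "\<lambda>i. \<sigma> (\<delta> (pvar i))"
  have x: "(\<sigma> \<circ> \<delta> \<circ> inv_into UNIV \<sigma>) p = (\<Sum>i\<in>UNIV. ?a i * E i p)" for p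
    using derivation_eq_vector_field[OF div0_derivation[OF \<delta>], of "inv_into UNIV \<sigma> p"]
    by (simp add: vector_field_def E_def alg_hom_sum[OF \<sigma>(2)] alg_hom_mult[OF \<sigma>(2)])
  have "divergence (\<sigma> \<circ> \<delta> \<circ> inv_into UNIV \<sigma>)
      = (\<Sum>k\<in>UNIV. \<Sum>i\<in>UNIV. partial k (?a i) * E i (pvar k) + ?a i * partial k (E i (pvar k)))"
    by (simp add: divergence_def x[unfolded comp_def] partial_sum partial_mult)
  also have "\<dots> = (\<Sum>i\<in>UNIV. \<Sum>k\<in>UNIV. partial k (?a i) * E i (pvar k) + ?a i * partial k (E i (pvar k)))"
    by (rule sum.swap)
  also have "\<dots> = (\<Sum>i\<in>UNIV. E i (?a i) + ?a i * divergence (E i))"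
    unfolding derivation_eq_vector_field[OF E, of _ "?a _"]
    by (simp add: sum.distrib vector_field_def divergence_def sum_distrib_left mult.commute)
  also have "\<dots> = \<sigma> (divergence \<delta>)"
    by (simp add: divE E\<sigma>) (simp add: divergence_def alg_hom_sum[OF \<sigma>(2)])
  also have "\<dots> = 0" using \<delta> by (simp add: div0_def alg_hom_zero[OF \<sigma>(2)])
  finally show ?thesis
    using conj_derivation[OF \<sigma> div0_derivation[OF \<delta>]] by (simp add: div0_def)
qed

section \<open>Rigidity\<close>

text \<open>Neither bijectivity nor extensionality is demanded, so that the notion also applies to
  the unrestricted map \<open>\<theta>\<close> in \<open>lie_end_is_conjugation\<close>.\<close>

definition lie_end ::
    "((('n::finite, 'k::comm_ring_1) mpoly \<Rightarrow> ('n, 'k) mpoly) \<Rightarrow> (('n, 'k) mpoly \<Rightarrow> ('n, 'k) mpoly)) \<Rightarrow> bool"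
  where "lie_end \<phi> \<longleftrightarrow> (\<forall>\<delta>\<in>div0. \<phi> \<delta> \<in> div0) \<and>
     (\<forall>\<delta>\<in>div0. \<forall>\<epsilon>\<in>div0. \<phi> (op_plus \<delta> \<epsilon>) = op_plus (\<phi> \<delta>) (\<phi> \<epsilon>)) \<and>
     (\<forall>c. \<forall>\<delta>\<in>div0. \<phi> (op_scale c \<delta>) = op_scale c (\<phi> \<delta>)) \<and>
     (\<forall>\<delta>\<in>div0. \<forall>\<epsilon>\<in>div0. \<phi> (bracket \<delta> \<epsilon>) = bracket (\<phi> \<delta>) (\<phi> \<epsilon>))"

lemma op_scale_zero: "op_scale 0 \<delta> = (\<lambda>_. 0)"
  by (simp add: op_scale_def pconst_simps)

lemma div0_zero: "(\<lambda>_. 0) \<in> div0"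
  using div0_op_scale[OF partial_div0, of 0] by (simp add: op_scale_zero)

lemma div0_sum:
  assumes "\<And>i. \<epsilon> i \<in> div0"
  shows "(\<lambda>p. \<Sum>i\<in>S. pconst (c i) * \<epsilon> i p) \<in> div0"
proof (induction S rule: infinite_finite_induct)
  case (insert i S)
  have "(\<lambda>p. \<Sum>i\<in>insert i S. pconst (c i) * \<epsilon> i p)
      = op_plus (op_scale (c i) (\<epsilon> i)) (\<lambda>p. \<Sum>i\<in>S. pconst (c i) * \<epsilon> i p)"
    using insert.hyps by (simp add: fun_eq_iff op_plus_def op_scale_def)
  then show ?case using insert.IH assms by (simp add: div0_op_plus div0_op_scale)
qed (simp_all add: div0_zero)

context
  fixes \<phi> :: "(('n::finite, 'k::comm_ring_1) mpoly \<Rightarrow> ('n, 'k) mpoly) \<Rightarrow> (('n, 'k) mpoly \<Rightarrow> ('n, 'k) mpoly)"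
  assumes \<phi>: "lie_end \<phi>"
begin

lemma lie_end_div0: "\<delta> \<in> div0 \<Longrightarrow> \<phi> \<delta> \<in> div0"
  and lie_end_plus: "\<delta> \<in> div0 \<Longrightarrow> \<epsilon> \<in> div0 \<Longrightarrow> \<phi> (op_plus \<delta> \<epsilon>) = op_plus (\<phi> \<delta>) (\<phi> \<epsilon>)"
  and lie_end_scale: "\<delta> \<in> div0 \<Longrightarrow> \<phi> (op_scale c \<delta>) = op_scale c (\<phi> \<delta>)"
  and lie_end_bracket: "\<delta> \<in> div0 \<Longrightarrow> \<epsilon> \<in> div0 \<Longrightarrow> \<phi> (bracket \<delta> \<epsilon>) = bracket (\<phi> \<delta>) (\<phi> \<epsilon>)"
  using \<phi> unfolding lie_end_def by blast+

lemma lie_end_zero: "\<phi> (\<lambda>_. 0) = (\<lambda>_. 0)"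
  using lie_end_scale[OF partial_div0, of 0] by (simp add: op_scale_zero)

lemma lie_end_sum:
  assumes \<epsilon>: "\<And>i. \<epsilon> i \<in> div0"
  shows "\<phi> (\<lambda>p. \<Sum>i\<in>S. pconst (c i) * \<epsilon> i p) = (\<lambda>p. \<Sum>i\<in>S. pconst (c i) * \<phi> (\<epsilon> i) p)"
proof (induction S rule: infinite_finite_induct)
  case (insert i S)
  have "(\<lambda>p. \<Sum>i\<in>insert i S. pconst (c i) * \<epsilon> i p)
      = op_plus (op_scale (c i) (\<epsilon> i)) (\<lambda>p. \<Sum>i\<in>S. pconst (c i) * \<epsilon> i p)"
    using insert.hyps by (simp add: fun_eq_iff op_plus_def op_scale_def)
  then have "\<phi> (\<lambda>p. \<Sum>i\<in>insert i S. pconst (c i) * \<epsilon> i p)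
      = op_plus (op_scale (c i) (\<phi> (\<epsilon> i))) (\<lambda>p. \<Sum>i\<in>S. pconst (c i) * \<phi> (\<epsilon> i) p)"
    by (simp add: lie_end_plus lie_end_scale \<epsilon> div0_op_scale div0_sum insert.IH)
  then show ?case using insert.hyps by (simp add: fun_eq_iff op_plus_def op_scale_def)
qed (simp_all add: lie_end_zero)

end

lemma const_field_eq_sum: "const_field v = (\<lambda>p. \<Sum>i\<in>UNIV. pconst (v i) * partial i p)"
  by (simp add: const_field_def vector_field_def fun_eq_iff)

section \<open>Monomial fields as weight vectors of diagonal fields\<close>

definition monomial_field ::
    "('n::finite \<Rightarrow>\<^sub>0 nat) \<Rightarrow> 'n \<Rightarrow> ('n, 'k::comm_ring_1) mpoly \<Rightarrow> ('n, 'k) mpoly" where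
  "monomial_field m j p = Poly_Mapping.single m 1 * partial j p"

lemma monomial_field_pvar:
  "monomial_field m j (pvar k) = (if k = j then Poly_Mapping.single m 1 else 0)"
  by (simp add: monomial_field_def partial_pvar)

lemma monomial_field_derivation: "monomial_field m j \<in> derivations"
  by (simp add: derivations_def monomial_field_def partial_add partial_pconst partial_mult
      algebra_simps)

lemma monomial_field_div0:
  assumes "Poly_Mapping.lookup m j = 0"
  shows "monomial_field m j \<in> div0"
proof -
  have "partial k (monomial_field m j (pvar k)) = (0 :: ('a, 'b) mpoly)" for k
    using assms by (simp add: monomial_field_pvar partial_single partial_zero)
  then show ?thesis
    by (simp add: div0_def monomial_field_derivation divergence_def)
qed

lemma bracket_partial_monomial_field:
  "bracket (partial i) (monomial_field m j)
    = op_scale (of_nat (Poly_Mapping.lookup m i)) (monomial_field (m - Poly_Mapping.single i 1) j)"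
proof (rule derivations_eqI)
  show "bracket (partial i) (monomial_field m j) (pvar k)
    = op_scale (of_nat (Poly_Mapping.lookup m i)) (monomial_field (m - Poly_Mapping.single i 1) j) (pvar k)" for k
    by (simp add: bracket_def op_scale_def monomial_field_pvar partial_pvar partial_zero partial_single
        derivation_zero[OF monomial_field_derivation] derivation_one[OF monomial_field_derivation]
        single_eq_pconst_mult[of _ "of_nat _"])
qed (intro bracket_derivation op_scale_derivation partial_derivation monomial_field_derivation)+

lemma diag_field_single:
  "diag_field w (Poly_Mapping.single m 1)
    = pconst (\<Sum>i\<in>UNIV. of_nat (Poly_Mapping.lookup m i) * w i) * Poly_Mapping.single m 1"
proof -
  have "pvar i * Poly_Mapping.single (m - Poly_Mapping.single i 1) (of_nat (Poly_Mapping.lookup m i))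
      = Poly_Mapping.single m (of_nat (Poly_Mapping.lookup m i) :: 'b)" for i
  proof (cases "Poly_Mapping.lookup m i = 0")
    case False
    then have "Poly_Mapping.single i 1 + (m - Poly_Mapping.single i 1) = m"
      by (intro poly_mapping_eqI) (auto simp: lookup_add lookup_minus lookup_single when_def)
    then show ?thesis by (simp add: pvar_def mult_single)
  qed simp
  then show ?thesis
    by (simp add: diag_field_def vector_field_def partial_single mult.assoc pconst_sum
        sum_distrib_right) (simp add: pconst_def mult_single mult.commute)
qed

lemma bracket_diag_monomial_field:
  "bracket (diag_field w) (monomial_field m j)
    = op_scale ((\<Sum>i\<in>UNIV. of_nat (Poly_Mapping.lookup m i) * w i) - w j) (monomial_field m j)"
proof (rule derivations_eqI)
  show "bracket (diag_field w) (monomial_field m j) (pvar k)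
    = op_scale ((\<Sum>i\<in>UNIV. of_nat (Poly_Mapping.lookup m i) * w i) - w j) (monomial_field m j) (pvar k)" for k
    by (simp add: bracket_def op_scale_def monomial_field_pvar diag_field_pvar diag_field_single
        derivation_pconst_mult[OF monomial_field_derivation] derivation_zero[OF diag_field_derivation]
        pconst_diff left_diff_distrib)
qed (intro bracket_derivation op_scale_derivation diag_field_derivation monomial_field_derivation)+

lemma bracket_partial_diag_field:
  "bracket (partial i) (diag_field w) = op_scale (w i) (partial i)"
proof (rule derivations_eqI)
  show "bracket (partial i) (diag_field w) (pvar k) = op_scale (w i) (partial i) (pvar k)" for k
    by (simp add: bracket_def op_scale_def diag_field_pvar partial_pvar partial_pconst_mult
        derivation_zero[OF diag_field_derivation] derivation_one[OF diag_field_derivation])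
qed (intro bracket_derivation op_scale_derivation diag_field_derivation partial_derivation)+

lemma bracket_diag_fields: "bracket (diag_field w) (diag_field u) = (\<lambda>_. 0)"
proof (rule derivations_eqI)
  show "bracket (diag_field w) (diag_field u) (pvar k) = 0" for k
    by (simp add: bracket_def diag_field_pvar derivation_pconst_mult[OF diag_field_derivation] mult.left_commute)
qed (simp_all add: bracket_derivation diag_field_derivation div0_derivation[OF div0_zero])

lemma ham_field_swap: "ham_field i j f = op_scale (- 1) (ham_field j i f)"
  by (simp add: ham_field_def op_scale_def fun_eq_iff pconst_uminus pconst_simps)

lemma ham_field_single:
  assumes "Poly_Mapping.lookup m j = 0"
  shows "ham_field i j (Poly_Mapping.single m c)
    = op_scale (c * of_nat (Poly_Mapping.lookup m i)) (monomial_field (m - Poly_Mapping.single i 1) j)"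
  using assms
  by (simp add: ham_field_def op_scale_def monomial_field_def fun_eq_iff partial_single
      mult.assoc[symmetric] single_eq_pconst_mult[symmetric])

section \<open>Endomorphisms fixing all \<open>\<partial>\<^sub>i\<close> and one diagonal
  field\<close>

context
  fixes \<theta> :: "(('n::finite, 'k::field_char_0) mpoly \<Rightarrow> ('n, 'k) mpoly) \<Rightarrow> (('n, 'k) mpoly \<Rightarrow> ('n, 'k) mpoly)"
    and h :: "'n \<Rightarrow> 'k"
  assumes \<theta>: "lie_end \<theta>"
    and fix_partial: "\<And>i. \<theta> (partial i) = partial i"
    and h: "(\<Sum>i\<in>UNIV. h i) = 0" "\<And>i. h i \<noteq> 0"
    and fix_h: "\<theta> (diag_field h) = diag_field h"
begin

text \<open>Bracketing with \<open>partial i\<close> differentiates the coefficients of a field. As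
  \<open>\<theta>\<close> fixes \<open>partial i\<close> and the bracket, the coefficients of
  \<open>\<theta> \<delta>\<close> and \<open>\<delta>\<close> have the same derivatives.\<close>

lemma fixed_up_to_constants:
  assumes \<delta>: "\<delta> \<in> div0" and fixed: "\<And>i. \<theta> (bracket (partial i) \<delta>) = bracket (partial i) \<delta>"
  shows "\<exists>c. \<forall>k. \<theta> \<delta> (pvar k) = \<delta> (pvar k) + pconst (c k)"
proof -
  have "partial i (\<theta> \<delta> (pvar k) - \<delta> (pvar k)) = 0" for i k
  proof -
    have *: "bracket (partial i) \<epsilon> (pvar k) = partial i (\<epsilon> (pvar k))"
      if "\<epsilon> \<in> div0" for \<epsilon> :: "('n, 'k) mpoly \<Rightarrow> ('n, 'k) mpoly"
      using that by (simp add: bracket_def partial_pvar derivation_zero[OF div0_derivation]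
          derivation_one[OF div0_derivation])
    have "bracket (partial i) (\<theta> \<delta>) = bracket (partial i) \<delta>"
      using lie_end_bracket[OF \<theta> partial_div0 \<delta>, of i] fixed fix_partial by simp
    then show ?thesis
      using *[OF \<delta>] *[OF lie_end_div0[OF \<theta> \<delta>]] by (simp add: derivation_diff[OF partial_derivation])
  qed
  then show ?thesis
    using constant_if_partials_zero[of "\<theta> \<delta> (pvar k) - \<delta> (pvar k)" for k]
    by (intro exI[of _ "\<lambda>k. Poly_Mapping.lookup (\<theta> \<delta> (pvar k) - \<delta> (pvar k)) 0"])
      (simp add: diff_eq_eq add.commute)
qed

text \<open>The difference of \<open>\<theta> \<delta>\<close> and \<open>\<delta>\<close> is a
  constant field that also has weight \<open>e\<close> for \<open>diag_field w\<close>. But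
  \<open>partial k\<close> has weight \<open>- w k\<close>, which differs from \<open>e\<close>, so
  its component vanishes.\<close>

lemma fixed_eigenvector:
  assumes \<delta>: "\<delta> \<in> div0" and fixed: "\<And>i. \<theta> (bracket (partial i) \<delta>) = bracket (partial i) \<delta>"
    and w: "(\<Sum>i\<in>UNIV. w i) = 0" "\<theta> (diag_field w) = diag_field w"
    and eigen: "bracket (diag_field w) \<delta> = op_scale e \<delta>" and e: "\<And>k. e + w k \<noteq> 0"
  shows "\<theta> \<delta> = \<delta>"
proof -
  obtain c where c: "\<And>k. \<theta> \<delta> (pvar k) = \<delta> (pvar k) + pconst (c k)"
    using fixed_up_to_constants[OF \<delta> fixed] by blast
  note d = div0_derivation[OF \<delta>] div0_derivation[OF lie_end_div0[OF \<theta> \<delta>]]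
  have eigen': "bracket (diag_field w) (\<theta> \<delta>) = op_scale e (\<theta> \<delta>)"
    using lie_end_bracket[OF \<theta> diag_field_div0[OF w(1)] \<delta>] lie_end_scale[OF \<theta> \<delta>, of e] eigen w(2)
    by simp
  have "c k = 0" for k
  proof -
    have "diag_field w (\<delta> (pvar k)) = pconst e * \<delta> (pvar k) + pconst (w k) * \<delta> (pvar k)"
      using fun_cong[OF eigen, of "pvar k"]
      by (simp add: bracket_def op_scale_def diag_field_pvar derivation_pconst_mult[OF d(1)]
          diff_eq_eq)
    moreover have "diag_field w (\<delta> (pvar k))
        = pconst e * (\<delta> (pvar k) + pconst (c k)) + pconst (w k) * (\<delta> (pvar k) + pconst (c k))"
      using fun_cong[OF eigen', of "pvar k"]
      by (simp add: bracket_def op_scale_def diag_field_pvar derivation_pconst_mult[OF d(2)]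
          diff_eq_eq c derivation_add[OF diag_field_derivation] derivation_pconst[OF diag_field_derivation])
    ultimately have "pconst ((e + w k) * c k) = (0 :: ('n, 'k) mpoly)"
      by (simp add: pconst_simps algebra_simps)
    then show ?thesis using e[of k] by (metis mult_eq_0_iff pconst_inject pconst_simps(1))
  qed
  then show ?thesis
    by (intro derivations_eqI d) (simp add: c pconst_simps)
qed

text \<open>Diagonal fields commute, so the weight for \<open>h\<close> is 0; it differs from the
  weights \<open>- h k\<close> of the constant fields because no \<open>h k\<close>
  vanishes.\<close>

lemma diag_field_fixed:
  assumes w: "(\<Sum>i\<in>UNIV. w i) = 0"
  shows "\<theta> (diag_field w) = diag_field w"
proof (rule fixed_eigenvector[where w = h and e = 0])
  show "\<theta> (bracket (partial i) (diag_field w)) = bracket (partial i) (diag_field w)" for i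
    by (simp add: bracket_partial_diag_field lie_end_scale[OF \<theta> partial_div0] fix_partial)
qed (use h fix_h w in \<open>simp_all add: bracket_diag_fields op_scale_zero diag_field_div0\<close>)

text \<open>Induction on the total degree, which bracketing with \<open>partial k\<close>
  lowers.\<close>

lemma monomial_field_fixed:
  "Poly_Mapping.lookup m j = 0 \<Longrightarrow> \<theta> (monomial_field m j) = monomial_field m j"
proof (induction "\<Sum>i\<in>UNIV. Poly_Mapping.lookup m i" arbitrary: m rule: less_induct)
  case less
  show ?case
  proof (cases "m = 0")
    case True
    then have "monomial_field m j = (partial j :: ('n, 'k) mpoly \<Rightarrow> _)"
      by (simp add: monomial_field_def fun_eq_iff)
    then show ?thesis by (simp add: fix_partial)
  next
    case False
    then obtain i where i: "Poly_Mapping.lookup m i \<noteq> 0" by (metis lookup_zero poly_mapping_eqI)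
    then have ij: "i \<noteq> j" using less.prems by auto
    \<comment> \<open>A diagonal field is needed that separates this monomial field from the
      constant ones. With this \<open>w\<close> the weight is \<open>m\<^sub>i + 1\<close>, and
      adding \<open>w k\<close> gives \<open>m\<^sub>i + 2\<close>, \<open>m\<^sub>i\<close> or
      \<open>m\<^sub>i + 1\<close>, never 0.\<close>
    define w :: "'n \<Rightarrow> 'k" where "w k = (if k = i then 1 else 0) - (if k = j then 1 else 0)" for k
    have w: "(\<Sum>k\<in>UNIV. w k) = 0" by (simp add: w_def sum_subtractf)
    show ?thesis
    proof (rule fixed_eigenvector[where w = w])
      show "monomial_field m j \<in> div0" by (rule monomial_field_div0[OF less.prems])
      show "\<theta> (bracket (partial k) (monomial_field m j)) = bracket (partial k) (monomial_field m j)" for k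
      proof -
        let ?m = "m - Poly_Mapping.single k 1"
        have z: "Poly_Mapping.lookup ?m j = 0" using less.prems by (simp add: lookup_minus)
        have "\<theta> (monomial_field ?m j) = monomial_field ?m j" if k: "Poly_Mapping.lookup m k \<noteq> 0"
        proof (rule less.hyps[OF _ z])
          have "Poly_Mapping.lookup ?m i \<le> Poly_Mapping.lookup m i" for i
            by (simp add: lookup_minus)
          moreover have "Poly_Mapping.lookup ?m k < Poly_Mapping.lookup m k"
            using k by (simp add: lookup_minus lookup_single)
          ultimately show "(\<Sum>i\<in>UNIV. Poly_Mapping.lookup ?m i) < (\<Sum>i\<in>UNIV. Poly_Mapping.lookup m i)"
            by (intro sum_strict_mono_ex1) auto
        qed
        then show ?thesis
          by (cases "Poly_Mapping.lookup m k = 0")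
            (simp_all add: bracket_partial_monomial_field lie_end_scale[OF \<theta> monomial_field_div0[OF z]]
              op_scale_zero lie_end_zero[OF \<theta>] del: One_nat_def)
      qed
      show "(\<Sum>i\<in>UNIV. w i) = 0" "\<theta> (diag_field w) = diag_field w"
        using w diag_field_fixed by auto
      have "(\<Sum>k\<in>UNIV. of_nat (Poly_Mapping.lookup m k) * w k) - w j
          = of_nat (Poly_Mapping.lookup m i) + 1"
        using ij less.prems by (simp add: w_def right_diff_distrib sum_subtractf
            if_distrib[of "\<lambda>x. _ * x"] cong: if_cong)
      then show "bracket (diag_field w) (monomial_field m j)
          = op_scale (of_nat (Poly_Mapping.lookup m i) + 1) (monomial_field m j)"
        by (simp add: bracket_diag_monomial_field)
      have "of_nat (Poly_Mapping.lookup m i) + 1 + w k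
          = of_nat (Poly_Mapping.lookup m i + (if k = i then 2 else if k = j then 0 else 1))" for k
        using ij by (simp add: w_def)
      then show "of_nat (Poly_Mapping.lookup m i) + 1 + w k \<noteq> 0" for k
        using i by (simp only: of_nat_eq_0_iff add_is_0) simp
    qed
  qed
qed

text \<open>The field is \<open>(\<partial>\<^sub>i f) \<partial>\<^sub>j\<close>, a combination of
  monomial fields in which \<open>x\<^sub>j\<close> has exponent 0.\<close>

lemma ham_field_independent_fixed:
  assumes "partial j f = 0"
  shows "\<theta> (ham_field i j f) = ham_field i j f"
proof -
  \<comment> \<open>The induction runs over subsets of the support of \<open>f\<close>, whose
    monomials are all free of \<open>x\<^sub>j\<close>.\<close>
  have "\<theta> (ham_field i j (\<Sum>m\<in>A. Poly_Mapping.single m (Poly_Mapping.lookup f m)))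
      = ham_field i j (\<Sum>m\<in>A. Poly_Mapping.single m (Poly_Mapping.lookup f m))"
    if "A \<subseteq> Poly_Mapping.keys f" for A
    using finite_subset[OF that finite_keys] that
  proof induction
    case empty
    have "ham_field i j 0 = (\<lambda>_. 0 :: ('n, 'k) mpoly)"
      by (simp add: ham_field_def fun_eq_iff partial_zero)
    then show ?case by (simp add: lie_end_zero[OF \<theta>])
  next
    case (insert m A)
    have m: "Poly_Mapping.lookup m j = 0" using partial_eq_0_keys[OF assms] insert.prems by auto
    then have m': "Poly_Mapping.lookup (m - Poly_Mapping.single i 1) j = 0" by (simp add: lookup_minus)
    have "\<theta> (ham_field i j (Poly_Mapping.single m c)) = ham_field i j (Poly_Mapping.single m c)" for c
      by (simp add: ham_field_single[OF m] lie_end_scale[OF \<theta> monomial_field_div0[OF m']]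
          monomial_field_fixed[OF m'] del: One_nat_def)
    then show ?case using insert
      by (simp add: ham_field_add lie_end_plus[OF \<theta> ham_field_div0 ham_field_div0])
  qed
  from this[of "Poly_Mapping.keys f"] show ?thesis by (simp add: poly_expansion[symmetric])
qed

text \<open>A monomial \<open>x\<^sub>i\<^bsup>a\<^esup> x\<^sub>j\<^bsup>b\<^esup> u\<close> is up to a factor the Poisson bracket of \<open>x\<^sub>i\<^bsup>a + 1\<^esup> u\<close> and \<open>x\<^sub>j\<^bsup>b + 1\<^esup>\<close>.\<close>

lemma ham_field_fixed:
  assumes ij: "i \<noteq> j"
  shows "\<theta> (ham_field i j f) = ham_field i j f"
proof (induction f rule: monomial_induct)
  case zero
  then show ?case by (intro ham_field_independent_fixed) (simp add: partial_zero)
next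
  case (add m c f)
  let ?a = "Poly_Mapping.lookup m i" and ?b = "Poly_Mapping.lookup m j"
  \<comment> \<open>\<open>m'\<close> strips the power of \<open>x\<^sub>j\<close> from
    \<open>m\<close>; the denominators in \<open>?F\<close> cancel the factors produced by
    \<open>partial i ?F\<close> and \<open>partial j ?G\<close>.\<close>
  define m' where "m' = m - Poly_Mapping.single j ?b"
  let ?F = "Poly_Mapping.single (m' + Poly_Mapping.single i 1) (c / (of_nat (Suc ?a) * of_nat (Suc ?b)))"
  let ?G = "Poly_Mapping.single (Poly_Mapping.single j (Suc ?b)) 1 :: ('n, 'k) mpoly"
  have m': "Poly_Mapping.lookup m' i = ?a" "Poly_Mapping.lookup m' j = 0"
    "m' + Poly_Mapping.single j ?b = m"
    using ij by (auto simp: m'_def lookup_minus lookup_single lookup_add when_def intro!: poly_mapping_eqI)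
  have F: "partial j ?F = 0" "partial i ?F = Poly_Mapping.single m' (c / of_nat (Suc ?b))"
    using ij m' by (simp_all add: partial_single lookup_add lookup_single del: of_nat_Suc)
  have "Poly_Mapping.single j (Suc ?b) - Poly_Mapping.single j 1 = Poly_Mapping.single j ?b"
    by (simp flip: single_diff)
  then have G: "partial i ?G = 0" "partial j ?G = Poly_Mapping.single (Poly_Mapping.single j ?b) (of_nat (Suc ?b))"
    using ij by (simp_all add: partial_single lookup_single del: of_nat_Suc)
  have "ham_field i j ?F ?G = Poly_Mapping.single m c"
    unfolding ham_field_def F G by (simp add: mult_single m' del: of_nat_Suc)
  then have "ham_field i j (Poly_Mapping.single m c) = bracket (ham_field i j ?F) (ham_field i j ?G)"
    by (simp only: bracket_ham_field[OF ij])
  moreover have "\<theta> (ham_field i j ?F) = ham_field i j ?F"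
    using F by (intro ham_field_independent_fixed)
  \<comment> \<open>\<open>?G\<close> is independent of \<open>x\<^sub>i\<close> rather than of
    \<open>x\<^sub>j\<close>, so the two indices are exchanged at the cost of a sign.\<close>
  moreover have "\<theta> (ham_field i j ?G) = ham_field i j ?G"
    using ham_field_independent_fixed[OF G(1), of j]
    by (simp only: ham_field_swap[of i j] lie_end_scale[OF \<theta> ham_field_div0])
  ultimately have "\<theta> (ham_field i j (Poly_Mapping.single m c)) = ham_field i j (Poly_Mapping.single m c)"
    by (simp only: lie_end_bracket[OF \<theta> ham_field_div0 ham_field_div0])
  then show ?case using add
    by (simp add: ham_field_add lie_end_plus[OF \<theta> ham_field_div0 ham_field_div0])
qed

text \<open>Fixed fields are closed under sums, and Hamiltonian fields generate \<open>div0\<close>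
  additively.\<close>

lemma rigidity: "2 \<le> CARD('n) \<Longrightarrow> \<delta> \<in> div0 \<Longrightarrow> \<theta> \<delta> = \<delta>"
  by (induction \<delta> rule: div0_induct)
    (simp_all add: lie_end_zero[OF \<theta>] lie_end_plus[OF \<theta>] ham_field_fixed)

end

section \<open>Constant fields\<close>

lemma partial_level:
  obtains L where "\<And>p :: ('n::finite, 'k::comm_ring_1) mpoly. p \<in> nilpotent_level partial (L p)"
proof -
  have "\<exists>L. \<forall>p :: ('n, 'k) mpoly. p \<in> nilpotent_level partial (L p)"
    by (intro choice allI partial_locally_nilpotent)
  then show ?thesis using that by blast
qed

text \<open>Evaluating the expansion of \<open>\<delta>\<close> at the origin kills every
  coefficient. Hence fields vanishing at the origin are closed under brackets.\<close>

lemma lookup_zero_derivation: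
  fixes \<delta> :: "('n::finite, 'k::comm_ring_1) mpoly \<Rightarrow> ('n, 'k) mpoly"
  assumes "\<delta> \<in> derivations" "\<And>k. Poly_Mapping.lookup (\<delta> (pvar k)) 0 = 0"
  shows "Poly_Mapping.lookup (\<delta> p) 0 = 0"
  using derivation_eq_vector_field[OF assms(1), of p]
  by (simp add: vector_field_def lookup_sum lookup_zero_mult assms(2))

lemma lookup_zero_det:
  fixes A :: "(('n::finite, 'k::comm_ring_1) mpoly)^'m^'m"
  shows "Poly_Mapping.lookup (det A) 0 = det (\<chi> i j. Poly_Mapping.lookup (A $ i $ j) 0)"
proof -
  have s: "Poly_Mapping.lookup (of_int (sign p) * x) 0 = of_int (sign p) * Poly_Mapping.lookup x 0"
    for p :: "'m \<Rightarrow> 'm" and x :: "('n, 'k) mpoly"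
    by (simp add: sign_def)
  have p: "Poly_Mapping.lookup (\<Prod>i\<in>S. f i) 0 = (\<Prod>i\<in>S. Poly_Mapping.lookup (f i) 0)"
    for f :: "'m \<Rightarrow> ('n, 'k) mpoly" and S
    by (induction S rule: infinite_finite_induct) (simp_all add: lookup_zero_mult lookup_one)
  show ?thesis by (simp add: det_def lookup_sum s p)
qed

text \<open>Induction on the exponents outside direction \<open>l\<close>: the derivative of
  \<open>?g\<close> along \<open>v\<close> is the given monomial plus terms \<open>?r\<close> in
  which one unit of such an exponent has moved to \<open>x\<^sub>l\<close>.\<close>

lemma const_field_surj:
  fixes v :: "'n::finite \<Rightarrow> 'k::field_char_0"
  assumes l: "v l \<noteq> 0"
  shows "\<exists>g. const_field v g = f"
proof -
  note add = derivation_add[OF const_field_derivation] and diff = derivation_diff[OF const_field_derivation]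
  let ?im = "range (const_field v)"
  have zero: "0 \<in> ?im" using derivation_zero[OF const_field_derivation] by (metis rangeI)
  have sum: "(\<Sum>i\<in>S. q i) \<in> ?im" if "\<And>i. i \<in> S \<Longrightarrow> q i \<in> ?im" for S and q :: "'n \<Rightarrow> _"
    using that
  proof (induction S rule: infinite_finite_induct)
    case (insert i S)
    then obtain a b where "q i = const_field v a" "(\<Sum>i\<in>S. q i) = const_field v b" by blast
    then have "(\<Sum>i\<in>insert i S. q i) = const_field v (a + b)" using insert.hyps by (simp add: add)
    then show ?case by blast
  qed (simp_all add: zero)
  let ?e = "\<lambda>i::'n. Poly_Mapping.single i 1"
  have mono: "Poly_Mapping.single m c \<in> ?im" for m c
  proof (induction "\<Sum>i\<in>UNIV - {l}. Poly_Mapping.lookup m i" arbitrary: m c rule: less_induct)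
    case less
    let ?c = "c / (v l * of_nat (Suc (Poly_Mapping.lookup m l)))"
    let ?g = "Poly_Mapping.single (m + ?e l) ?c"
    let ?r = "\<Sum>i\<in>UNIV - {l}. Poly_Mapping.single (m + ?e l - ?e i)
      (v i * (?c * of_nat (Poly_Mapping.lookup m i)))"
    have "const_field v ?g = pconst (v l) * partial l ?g + (\<Sum>i\<in>UNIV - {l}. pconst (v i) * partial i ?g)"
      unfolding const_field_def vector_field_def by (rule sum.remove) auto
    also have "pconst (v l) * partial l ?g = Poly_Mapping.single m c"
      using l by (simp add: partial_single lookup_add pconst_def mult_single del: of_nat_Suc)
    also have "(\<Sum>i\<in>UNIV - {l}. pconst (v i) * partial i ?g) = ?r"
      by (intro sum.cong refl) (simp add: partial_single lookup_add lookup_single pconst_def mult_single)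
    finally have eq: "Poly_Mapping.single m c = const_field v ?g - ?r" by simp
    have "Poly_Mapping.single (m + ?e l - ?e i) (v i * (?c * of_nat (Poly_Mapping.lookup m i))) \<in> ?im"
      if i: "i \<in> UNIV - {l}" for i
    proof (cases "Poly_Mapping.lookup m i = 0")
      case True
      then show ?thesis using zero by simp
    next
      case False
      show ?thesis
      proof (rule less)
        show "(\<Sum>k\<in>UNIV - {l}. Poly_Mapping.lookup (m + ?e l - ?e i) k)
            < (\<Sum>k\<in>UNIV - {l}. Poly_Mapping.lookup m k)"
          using i False
          by (intro sum_strict_mono_ex1)
            (auto simp: lookup_add lookup_minus lookup_single when_def intro!: bexI[of _ i])
      qed
    qed
    then have "?r \<in> ?im" by (rule sum)
    then obtain r where "?r = const_field v r" by blast
    then have "Poly_Mapping.single m c = const_field v (?g - r)" using eq by (simp add: diff)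
    then show ?case by blast
  qed
  show ?thesis
  proof (induction f rule: monomial_induct)
    case zero
    then show ?case using \<open>0 \<in> ?im\<close> by auto
  next
    case (add m c p)
    then obtain a where "const_field v a = p" by blast
    moreover obtain b where "Poly_Mapping.single m c = const_field v b" using mono by blast
    ultimately have "const_field v (b + a) = Poly_Mapping.single m c + p"
      using derivation_add[OF const_field_derivation] by metis
    then show ?case by blast
  qed
qed

text \<open>The derivative along \<open>v\<close> is a combination of partial derivatives with
  constant coefficients, so each application lowers the level.\<close>

lemma const_field_funpow_eq_0:
  "p \<in> nilpotent_level partial m \<Longrightarrow> (const_field v ^^ m) p = 0"
proof (induction m arbitrary: p)
  case (Suc m)
  have mult: "pconst c * q \<in> nilpotent_level partial m" if "q \<in> nilpotent_level partial m"
    for c and q :: "('a, 'b) mpoly"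
    using that
    by (induction m arbitrary: q) (simp_all add: partial_pconst_mult)
  have "(\<Sum>i\<in>S. pconst (v i) * partial i p) \<in> nilpotent_level partial m" for S
    using Suc.prems
    by (induction S rule: infinite_finite_induct)
      (auto intro!: nilpotent_level_add[OF partial_derivation] mult
        nilpotent_level_zero[OF partial_derivation])
  then have "const_field v p \<in> nilpotent_level partial m"
    by (simp add: const_field_def vector_field_def)
  then show ?case by (simp only: funpow_Suc_right comp_apply Suc.IH)
qed simp

lemma bracket_apply: "bracket \<delta> \<epsilon> p = \<delta> (\<epsilon> p) - \<epsilon> (\<delta> p)"
  by (simp add: bracket_def)

lemma funpow_bracket_div0: "\<epsilon> \<in> div0 \<Longrightarrow> \<delta> \<in> div0 \<Longrightarrow> (bracket \<epsilon> ^^ N) \<delta> \<in> div0"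
  by (induction N) (simp_all add: div0_bracket)

text \<open>The coefficients of \<open>const_field v\<close> are constants, killed by every
  derivation; hence each bracket merely differentiates the coefficients of the field along
  \<open>v\<close>.\<close>

lemma funpow_bracket_const_field_pvar:
  "\<delta> \<in> div0 \<Longrightarrow> (bracket (const_field v) ^^ N) \<delta> (pvar k) = (const_field v ^^ N) (\<delta> (pvar k))"
proof (induction N)
  case (Suc N)
  have "(bracket (const_field v) ^^ N) \<delta> (pconst c) = 0" for c
    using Suc.prems by (intro derivation_pconst div0_derivation funpow_bracket_div0 const_field_div0)
  moreover have "(bracket (const_field v) ^^ Suc N) \<delta> (pvar k)
      = const_field v ((bracket (const_field v) ^^ N) \<delta> (pvar k))
        - (bracket (const_field v) ^^ N) \<delta> (const_field v (pvar k))"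
    by (simp only: funpow.simps comp_apply) (rule bracket_apply)
  ultimately show ?case
    using Suc by (simp only: const_field_pvar diff_zero funpow.simps comp_apply)
qed simp

lemma funpow_bracket_ham_field:
  "(bracket (const_field v) ^^ N) (ham_field i j f) = ham_field i j ((const_field v ^^ N) f)"
  by (induction N) (simp_all add: bracket_const_field_ham_field)

section \<open>Images of the partial derivatives\<close>

context
  fixes \<phi> :: "(('n::finite, 'k::field_char_0) mpoly \<Rightarrow> ('n, 'k) mpoly) \<Rightarrow> (('n, 'k) mpoly \<Rightarrow> ('n, 'k) mpoly)"
  assumes \<phi>: "lie_end \<phi>" and surj: "\<And>\<delta>. \<delta> \<in> div0 \<Longrightarrow> \<exists>\<epsilon>\<in>div0. \<phi> \<epsilon> = \<delta>"
    and n2: "2 \<le> CARD('n)"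
begin

text \<open>The fields whose image vanishes at the origin form a subalgebra of finite codimension. If it
  contained the constant field \<open>v\<close>, then \<open>ad v\<close> would act nilpotently modulo this subalgebra; but
  \<open>ad v\<close> is onto, so the subalgebra would be everything.\<close>

lemma image_const_field_nonzero_at_origin:
  assumes v: "v l \<noteq> 0"
  shows "\<exists>k. Poly_Mapping.lookup (\<phi> (const_field v) (pvar k)) 0 \<noteq> 0"
proof (rule ccontr)
  assume "\<not> ?thesis"
  then have v0: "Poly_Mapping.lookup (\<phi> (const_field v) (pvar k)) 0 = 0" for k by blast
  \<comment> \<open>\<open>ev k\<close> reads the \<open>k\<close>-th coefficient of the image at
    the origin; the subalgebra in question is the common kernel of all \<open>ev k\<close>.\<close>
  define ev where "ev k \<delta> = Poly_Mapping.lookup (\<phi> \<delta> (pvar k)) 0" for k \<delta>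
  let ?A = "bracket (const_field v)"
  have step: "ev k (?A \<delta>) = 0" if \<delta>: "\<delta> \<in> div0" "\<And>k. ev k \<delta> = 0" for \<delta> k
  proof -
    have "Poly_Mapping.lookup (\<phi> (const_field v) p) 0 = 0" for p
      by (rule lookup_zero_derivation[OF div0_derivation[OF lie_end_div0[OF \<phi> const_field_div0]] v0])
    moreover have "Poly_Mapping.lookup (\<phi> \<delta> p) 0 = 0" for p
      by (rule lookup_zero_derivation[OF div0_derivation[OF lie_end_div0[OF \<phi> \<delta>(1)]]])
        (use \<delta>(2) in \<open>simp add: ev_def\<close>)
    ultimately show ?thesis
      by (simp add: ev_def lie_end_bracket[OF \<phi> const_field_div0 \<delta>(1)] bracket_apply lookup_minus)
  qed
  have steps: "ev k ((?A ^^ N) \<delta>) = 0" if "\<delta> \<in> div0" "\<And>k. ev k \<delta> = 0" for \<delta> k N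
    using that by (induction N arbitrary: k) (simp_all add: step funpow_bracket_div0 const_field_div0)
  \<comment> \<open>Preimages of the \<open>partial k\<close> span a complement of that
    subalgebra.\<close>
  have "\<exists>\<epsilon>\<in>div0. \<phi> \<epsilon> = partial k" for k by (rule surj[OF partial_div0])
  then obtain \<epsilon> where \<epsilon>: "\<And>k. \<epsilon> k \<in> div0" "\<And>k. \<phi> (\<epsilon> k) = partial k" by metis
  have ev_\<epsilon>: "ev j (\<epsilon> k) = (if k = j then 1 else 0)" for j k
    by (simp add: ev_def \<epsilon> partial_pvar lookup_one)
  obtain L where L: "\<And>p :: ('n, 'k) mpoly. p \<in> nilpotent_level partial (L p)"
    by (rule partial_level) blast
  define M where "M k j = L (\<epsilon> k (pvar j))" for k j
  have M: "\<epsilon> k (pvar j) \<in> nilpotent_level partial (M k j)" for k j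
    by (simp add: M_def L)
  \<comment> \<open>The sum bounds all levels at once, so \<open>N\<close> derivatives along
    \<open>v\<close> kill every coefficient of every \<open>\<epsilon> k\<close>.\<close>
  define N where "N = (\<Sum>k\<in>UNIV. \<Sum>j\<in>UNIV. M k j)"
  have "M k j \<le> N" for k j
  proof -
    have "M k j \<le> (\<Sum>j\<in>UNIV. M k j)" by (rule member_le_sum) auto
    also have "\<dots> \<le> N" unfolding N_def by (rule member_le_sum) auto
    finally show ?thesis .
  qed
  then have kill: "(const_field v ^^ N) (\<epsilon> k (pvar j)) = 0" for k j
    by (intro const_field_funpow_eq_0 nilpotent_level_mono[OF partial_derivation M])
  have cv_add: "(const_field v ^^ m) (p + q) = (const_field v ^^ m) p + (const_field v ^^ m) q" for m p q
    by (induction m) (simp_all add: derivation_add[OF const_field_derivation])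
  have cv_scale: "(const_field v ^^ m) (pconst c * p) = pconst c * (const_field v ^^ m) p" for m c p
    by (induction m) (simp_all add: derivation_pconst_mult[OF const_field_derivation])
  have cv_0: "(const_field v ^^ m) 0 = 0" for m
    by (induction m) (simp_all add: derivation_zero[OF const_field_derivation])
  have all: "ev j ((?A ^^ N) \<delta>) = 0" if \<delta>: "\<delta> \<in> div0" for j \<delta>
  proof -
    \<comment> \<open>Adding \<open>\<eta>\<close> moves \<open>\<delta>\<close> into the
      subalgebra, which \<open>?A\<close> preserves, while \<open>?A ^^ N\<close> kills the
      correction \<open>\<eta>\<close> itself.\<close>
    define \<eta> where "\<eta> = (\<lambda>p. \<Sum>k\<in>UNIV. pconst (- ev k \<delta>) * \<epsilon> k p)"
    have \<eta>: "\<eta> \<in> div0" unfolding \<eta>_def by (rule div0_sum[OF \<epsilon>(1)])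
    have "\<phi> \<eta> = (\<lambda>p. \<Sum>k\<in>UNIV. pconst (- ev k \<delta>) * partial k p)"
      unfolding \<eta>_def by (simp add: lie_end_sum[OF \<phi> \<epsilon>(1)] \<epsilon>(2))
    then have "ev j \<eta> = - ev j \<delta>" for j
      by (simp add: ev_def partial_pvar if_distrib[of "\<lambda>x. _ * x"] lookup_zero_pconst cong: if_cong)
    then have "ev j (op_plus \<delta> \<eta>) = 0" for j
      by (simp add: ev_def lie_end_plus[OF \<phi> \<delta> \<eta>]) (simp add: op_plus_def lookup_add)
    then have "ev j ((?A ^^ N) (op_plus \<delta> \<eta>)) = 0"
      by (intro steps div0_op_plus \<delta> \<eta>)
    moreover have "(?A ^^ N) (op_plus \<delta> \<eta>) = (?A ^^ N) \<delta>"
    proof (rule derivations_eqI)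
      fix i
      have "(const_field v ^^ N) (\<Sum>k\<in>S. pconst (- ev k \<delta>) * \<epsilon> k (pvar i)) = 0" for S
        by (induction S rule: infinite_finite_induct) (simp_all add: cv_0 cv_add cv_scale kill)
      then show "(?A ^^ N) (op_plus \<delta> \<eta>) (pvar i) = (?A ^^ N) \<delta> (pvar i)"
        by (simp add: funpow_bracket_const_field_pvar \<delta> \<eta> div0_op_plus)
          (simp add: op_plus_def cv_add \<eta>_def)
    qed (intro div0_derivation funpow_bracket_div0 const_field_div0 div0_op_plus \<delta> \<eta>)+
    ultimately show ?thesis by simp
  qed
  have "\<forall>k. ev k \<delta> = 0" if "\<delta> \<in> div0" for \<delta>
    using n2 that
  proof (induction \<delta> rule: div0_induct)
    case zero
    then show ?case by (simp add: ev_def lie_end_zero[OF \<phi>])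
  next
    case (add \<delta> \<epsilon>)
    then show ?case by (simp add: ev_def lie_end_plus[OF \<phi>]) (simp add: op_plus_def lookup_add)
  next
    case (ham i j f)
    \<comment> \<open>Differentiation along \<open>v\<close> is onto, so every Hamiltonian field
      lies in the image of \<open>?A ^^ N\<close> and therefore in the kernel of every
      \<open>ev k\<close>.\<close>
    have "\<exists>g. (const_field v ^^ m) g = f" for m
    proof (induction m)
      case (Suc m)
      then obtain g where "(const_field v ^^ m) g = f" by blast
      moreover obtain g' where "const_field v g' = g" using const_field_surj[of v l, OF v] by blast
      ultimately have "(const_field v ^^ Suc m) g' = f" by (simp add: funpow_swap1)
      then show ?case by blast
    qed simp
    then obtain g where "(const_field v ^^ N) g = f" by blast
    then have "ham_field i j f = (?A ^^ N) (ham_field i j g)"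
      by (simp add: funpow_bracket_ham_field)
    then show ?case using all[OF ham_field_div0] by simp
  qed
  from this[OF \<epsilon>(1)[of l]] ev_\<epsilon>[of l l] show False by simp
qed

section \<open>The coefficient matrix of the fields \<open>D i\<close>\<close>

private abbreviation "D i \<equiv> \<phi> (partial i)"

definition jacobian :: "(('n, 'k) mpoly)^'n^'n" where
  "jacobian = (\<chi> k i. D i (pvar k))"

lemma D_div0: "D i \<in> div0"
  by (rule lie_end_div0[OF \<phi> partial_div0])

lemma D_derivation: "D i \<in> derivations"
  by (rule div0_derivation[OF D_div0])

lemma bracket_D: "\<delta> \<in> div0 \<Longrightarrow> D i (\<phi> \<delta> p) = \<phi> \<delta> (D i p) + \<phi> (bracket (partial i) \<delta>) p"
  by (simp add: lie_end_bracket[OF \<phi> partial_div0]) (simp add: bracket_def)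

lemma D_commute: "D i (D j p) = D j (D i p)"
proof -
  have "bracket (partial i) (partial j) = (\<lambda>_. 0 :: ('n, 'k) mpoly)"
    by (simp add: bracket_def fun_eq_iff partial_commute)
  then show ?thesis using bracket_D[OF partial_div0, of i j p] by (simp add: lie_end_zero[OF \<phi>])
qed

lemma image_const_field: "\<phi> (const_field v) p = (\<Sum>i\<in>UNIV. pconst (v i) * D i p)"
  by (simp add: const_field_eq_sum lie_end_sum[OF \<phi> partial_div0])

lemma D_expand: "D i p = (\<Sum>k\<in>UNIV. partial k p * jacobian $ k $ i)"
  using derivation_eq_vector_field[OF D_derivation, of i p]
  by (simp add: vector_field_def jacobian_def mult.commute)

text \<open>A nonzero kernel vector of the matrix at the origin would be a nonzero constant field
  whose image vanishes there.\<close>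

lemma jacobian_nonzero_at_origin: "Poly_Mapping.lookup (det jacobian) 0 \<noteq> 0"
proof -
  define A where "A = (\<chi> k i. Poly_Mapping.lookup (D i (pvar k)) 0)"
  have "x = 0" if "A *v x = 0" for x
  proof (rule ccontr)
    assume "x \<noteq> 0"
    then obtain l where "x $ l \<noteq> 0" by (auto simp: vec_eq_iff)
    then obtain k where "Poly_Mapping.lookup (\<phi> (const_field (($) x)) (pvar k)) 0 \<noteq> 0"
      using image_const_field_nonzero_at_origin by blast
    moreover have "Poly_Mapping.lookup (\<phi> (const_field (($) x)) (pvar k)) 0 = (A *v x) $ k"
      by (simp add: image_const_field lookup_sum lookup_zero_mult lookup_zero_pconst A_def
          matrix_vector_mult_def mult.commute)
    ultimately show False using that by simp
  qed
  then have "invertible A"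
    by (simp add: invertible_left_inverse matrix_left_invertible_ker)
  then show ?thesis
    by (simp add: lookup_zero_det jacobian_def A_def invertible_det_nz)
qed

text \<open>\<open>J = det jacobian\<close> satisfies \<open>J \<partial>\<^sub>k J = 0\<close>, hence \<open>J\<^sup>2\<close> is a constant.\<close>

lemma jacobian_unit: "\<exists>u. det jacobian * u = 1"
proof -
  let ?J = "det jacobian"
  have "D j ?J = 0" for j
    using liouville_jacobian[of "\<lambda>i. D i", OF D_derivation D_commute, of j] D_div0[of j]
    by (simp add: jacobian_def div0_def)
  \<comment> \<open>Cramer's rule turns the equations \<open>D i ?J = 0\<close> into equations for
    the partial derivatives; passing to the square then avoids cancelling \<open>?J\<close>.\<close>
  then have "partial k ?J * ?J = 0" for k
    using cramer_zero[of "\<lambda>k. partial k ?J" jacobian] by (simp add: D_expand)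
  then have "partial k (?J * ?J) = 0" for k
    by (simp add: partial_mult mult.commute)
  then have J2: "?J * ?J = pconst (Poly_Mapping.lookup (?J * ?J) 0)"
    by (rule constant_if_partials_zero)
  let ?c = "Poly_Mapping.lookup (?J * ?J) 0"
  have "?c \<noteq> 0" using jacobian_nonzero_at_origin by (simp add: lookup_zero_mult)
  then have "?J * (?J * pconst (1 / ?c)) = 1"
    by (subst mult.assoc[symmetric], subst J2) (simp add: pconst_simps[symmetric])
  then show ?thesis by blast
qed

lemma constant_if_D_zero:
  assumes "\<And>i. D i p = 0"
  shows "p = pconst (Poly_Mapping.lookup p 0)"
proof (rule constant_if_partials_zero)
  fix k
  obtain u where u: "det jacobian * u = 1" using jacobian_unit by blast
  have "partial k p * det jacobian = 0"
    using cramer_zero[of "\<lambda>k. partial k p" jacobian] assms by (simp add: D_expand)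
  then have "partial k p * (det jacobian * u) = 0" by (simp add: mult.assoc[symmetric])
  then show "partial k p = 0" by (simp add: u)
qed

lemma D_independent:
  assumes "\<And>k. (\<Sum>i\<in>UNIV. a i * D i (pvar k)) = 0"
  shows "a i = 0"
proof -
  obtain u where u: "det jacobian * u = 1" using jacobian_unit by blast
  have "a i * det (transpose jacobian) = 0"
    using assms by (intro cramer_zero) (simp add: transpose_def jacobian_def)
  then have "a i * (det jacobian * u) = 0" by (simp add: mult.assoc[symmetric])
  then show ?thesis by (simp add: u)
qed

text \<open>The coefficients come from the inverse of the Jacobian matrix applied to the values of
  \<open>\<delta>\<close> on the variables.\<close>

lemma D_basis:
  assumes \<delta>: "\<delta> \<in> derivations"
  shows "\<exists>F. \<forall>p. \<delta> p = (\<Sum>i\<in>UNIV. F i * D i p)"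
proof -
  obtain X where X: "jacobian ** X = mat 1"
    using jacobian_unit matrix_inverse_if_unit_det by metis
  define F where "F i = (\<Sum>k\<in>UNIV. X $ i $ k * \<delta> (pvar k))" for i
  have "(\<Sum>i\<in>UNIV. F i * D i (pvar m)) = \<delta> (pvar m)" for m
  proof -
    have "(\<Sum>i\<in>UNIV. F i * D i (pvar m))
        = (\<Sum>i\<in>UNIV. \<Sum>k\<in>UNIV. jacobian $ m $ i * X $ i $ k * \<delta> (pvar k))"
      by (simp add: F_def jacobian_def sum_distrib_right sum_distrib_left ac_simps)
    also have "\<dots> = (\<Sum>k\<in>UNIV. (jacobian ** X) $ m $ k * \<delta> (pvar k))"
      by (subst sum.swap) (simp add: matrix_matrix_mult_def sum_distrib_right)
    also have "\<dots> = \<delta> (pvar m)"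
      by (simp add: X mat_def if_distrib[of "\<lambda>x. x * _"] cong: if_cong)
    finally show ?thesis .
  qed
  moreover have "(\<lambda>p. \<Sum>i\<in>UNIV. F i * D i p) \<in> derivations"
    unfolding derivations_def
    by (simp add: derivation_add[OF D_derivation] derivation_mult[OF D_derivation]
        derivation_pconst[OF D_derivation] sum.distrib sum_distrib_left sum_distrib_right algebra_simps)
  ultimately have "\<delta> = (\<lambda>p. \<Sum>i\<in>UNIV. F i * D i p)"
    using \<delta> by (intro derivations_eqI) auto
  then show ?thesis by metis
qed

text \<open>Apply \<open>\<phi>\<close> to
  \<open>[\<partial>\<^sub>m, h] = h\<^sub>m \<partial>\<^sub>m\<close> and write
  \<open>\<phi> (diag_field h)\<close> in the basis \<open>D i\<close> with coefficients
  \<open>F i\<close>. As the \<open>D i\<close> commute, comparing coefficients shows that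
  \<open>D m (F i)\<close> is \<open>h m\<close> for \<open>i = m\<close> and 0 otherwise; division
  by \<open>h i\<close> gives \<open>y i\<close>.\<close>

lemma dual_coordinates:
  fixes h :: "'n \<Rightarrow> 'k"
  assumes h: "(\<Sum>i\<in>UNIV. h i) = 0" "\<And>i. h i \<noteq> 0"
  obtains y where "\<And>m i. D m (y i) = (if m = i then 1 else 0)"
    and "\<And>p. \<phi> (diag_field h) p = (\<Sum>i\<in>UNIV. pconst (h i) * y i * D i p)"
proof -
  note dh = diag_field_div0[OF h(1)]
  obtain F where F: "\<And>p. \<phi> (diag_field h) p = (\<Sum>i\<in>UNIV. F i * D i p)"
    using D_basis[OF div0_derivation[OF lie_end_div0[OF \<phi> dh]]] by blast
  have DF: "D m (F i) = (if m = i then pconst (h m) else 0)" for m i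
  proof -
    have "(\<Sum>i\<in>UNIV. (D m (F i) - (if m = i then pconst (h m) else 0)) * D i p) = 0" for p
    proof -
      have "D m (\<phi> (diag_field h) p) = \<phi> (diag_field h) (D m p) + pconst (h m) * D m p"
        by (simp add: bracket_D[OF dh] bracket_partial_diag_field lie_end_scale[OF \<phi> partial_div0])
          (simp add: op_scale_def)
      moreover have "D m (\<phi> (diag_field h) p)
          = (\<Sum>i\<in>UNIV. D m (F i) * D i p) + (\<Sum>i\<in>UNIV. F i * D i (D m p))"
        unfolding F by (simp add: derivation_sum[OF D_derivation] derivation_mult[OF D_derivation]
            sum.distrib D_commute[of m])
      ultimately have "(\<Sum>i\<in>UNIV. D m (F i) * D i p) = pconst (h m) * D m p"
        by (simp add: F)
      then show ?thesis
        by (simp add: left_diff_distrib sum_subtractf if_distrib[of "\<lambda>x. x * _"] cong: if_cong)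
    qed
    then show ?thesis
      using D_independent[of "\<lambda>i. D m (F i) - (if m = i then pconst (h m) else 0)" i] by simp
  qed
  define y where "y i = pconst (1 / h i) * F i" for i
  have one: "pconst (h i) * pconst (1 / h i) = (1 :: ('n, 'k) mpoly)" for i
    using h(2) by (simp add: pconst_simps[symmetric])
  have one': "pconst (1 / h i) * pconst (h i) = (1 :: ('n, 'k) mpoly)" for i
    using one[of i] by (simp only: mult.commute)
  show thesis
  proof
    show "D m (y i) = (if m = i then 1 else 0)" for m i
      by (simp add: y_def derivation_pconst_mult[OF D_derivation] DF one')
    show "\<phi> (diag_field h) p = (\<Sum>i\<in>UNIV. pconst (h i) * y i * D i p)" for p
      by (simp add: F y_def mult.assoc[symmetric] one)
  qed
qed

text \<open>By \<open>bracket_D\<close>, applying \<open>D i\<close> to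
  \<open>\<phi> \<delta> p\<close> gives two summands: one lowers the level of \<open>p\<close>, the
  other that of the coefficients of \<open>\<delta>\<close>. Hence the induction on
  \<open>a + b\<close>.\<close>

lemma image_nilpotent_level:
  assumes "\<delta> \<in> div0" "\<And>k. \<delta> (pvar k) \<in> nilpotent_level partial a" "p \<in> nilpotent_level D b"
  shows "\<phi> \<delta> p \<in> nilpotent_level D (a + b)"
  using assms
proof (induction "a + b" arbitrary: a b \<delta> p)
  case 0
  then show ?case by (simp add: derivation_zero[OF div0_derivation[OF lie_end_div0[OF \<phi>]]])
next
  case (Suc m)
  consider "a = 0" | "b = 0" | a' b' where "a = Suc a'" "b = Suc b'" by (metis not0_implies_Suc)
  then show ?case
  proof cases
    case 1
    then have "\<delta> = (\<lambda>_. 0)"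
      using Suc.prems by (intro derivations_eqI div0_derivation div0_zero) auto
    then show ?thesis by (simp add: lie_end_zero[OF \<phi>] nilpotent_level_zero[OF D_derivation])
  next
    case 2
    then show ?thesis using Suc.prems
      by (simp add: derivation_zero[OF div0_derivation[OF lie_end_div0[OF \<phi>]]]
          nilpotent_level_zero[OF D_derivation])
  next
    case 3
    have "D i (\<phi> \<delta> p) \<in> nilpotent_level D m" for i
      unfolding bracket_D[OF Suc.prems(1)]
    proof (rule nilpotent_level_add[OF D_derivation])
      show "\<phi> \<delta> (D i p) \<in> nilpotent_level D m"
        using Suc.hyps(1)[of a b' \<delta> "D i p"] Suc.prems Suc.hyps(2) 3 by simp
      have "bracket (partial i) \<delta> (pvar k) = partial i (\<delta> (pvar k))" for k
        by (simp add: bracket_def partial_pvar derivation_zero[OF div0_derivation[OF Suc.prems(1)]]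
            derivation_one[OF div0_derivation[OF Suc.prems(1)]])
      then show "\<phi> (bracket (partial i) \<delta>) p \<in> nilpotent_level D m"
        using Suc.hyps(1)[of a' b "bracket (partial i) \<delta>" p] Suc.prems Suc.hyps(2) 3
        by (simp add: div0_bracket partial_div0)
    qed
    then show ?thesis by (simp add: Suc.hyps(2)[symmetric])
  qed
qed

text \<open>Surjectivity writes \<open>\<delta>\<close> as the image of some
  \<open>\<epsilon>\<close>, whose finitely many coefficients share a level for
  \<open>partial\<close>.\<close>

lemma locally_nilpotent_stable:
  assumes \<delta>: "\<delta> \<in> div0" and p: "\<exists>b. p \<in> nilpotent_level D b"
  shows "\<exists>b. \<delta> p \<in> nilpotent_level D b"
proof -
  obtain \<epsilon> where \<epsilon>: "\<epsilon> \<in> div0" "\<phi> \<epsilon> = \<delta>" using surj[OF \<delta>] by blast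
  obtain L where L: "\<And>p :: ('n, 'k) mpoly. p \<in> nilpotent_level partial (L p)"
    by (rule partial_level) blast
  have "\<epsilon> (pvar k) \<in> nilpotent_level partial (\<Sum>k\<in>UNIV. L (\<epsilon> (pvar k)))" for k
    by (rule nilpotent_level_mono[OF partial_derivation L]) (rule member_le_sum, auto)
  then show ?thesis using image_nilpotent_level[OF \<epsilon>(1)] p \<epsilon>(2) by blast
qed

text \<open>A non-constant element of least \<open>\<partial>\<close>-level in the \<open>div0\<close>-stable subalgebra of locally
  nilpotent elements is affine; the fields \<open>x\<^sub>i \<partial>\<^sub>j\<close> produce all variables from it.\<close>

lemma D_locally_nilpotent:
  assumes u: "\<exists>b. u \<in> nilpotent_level D b" "\<And>c. u \<noteq> pconst c"
  shows "\<exists>b. p \<in> nilpotent_level D b"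
proof -
  let ?U = "{p. \<exists>b. p \<in> nilpotent_level D b}"
  let ?P = "\<lambda>m. \<exists>u \<in> nilpotent_level partial m. u \<in> ?U \<and> (\<forall>c. u \<noteq> pconst c)"
  have ex: "\<exists>m. ?P m" using u partial_locally_nilpotent[of u] by blast
  define m where "m = (LEAST m. ?P m)"
  have "?P m" unfolding m_def by (rule LeastI_ex[OF ex])
  then obtain w where w: "w \<in> nilpotent_level partial m" "w \<in> ?U" "\<And>c. w \<noteq> pconst c" by blast
  have least: "\<not> ?P m'" if "m' < m" for m'
    using that unfolding m_def by (rule not_less_Least)
  have "m \<noteq> 0" using w(1) w(3)[of 0] by (cases m) (auto simp: pconst_simps)
  then obtain m' where m': "m = Suc m'" by (metis not0_implies_Suc)
  \<comment> \<open>The derivative is again locally nilpotent, by stability, and of lower level;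
    minimality of \<open>m\<close> forces it to be constant.\<close>
  have "\<exists>c. partial i w = pconst c" for i
  proof -
    have "partial i w \<in> ?U" using w(2) locally_nilpotent_stable[OF partial_div0] by blast
    moreover have "partial i w \<in> nilpotent_level partial m'" using w(1) m' by simp
    ultimately show ?thesis using least[of m'] m' by blast
  qed
  then have "\<exists>c. \<forall>i. partial i w = pconst (c i)" by (intro choice allI)
  then obtain c where c: "\<And>i. partial i w = pconst (c i)" by blast
  obtain j where j: "c j \<noteq> 0"
  proof (rule ccontr)
    assume "\<not> thesis"
    then have "partial i w = 0" for i
      by (metis that c pconst_simps(1))
    then show False using constant_if_partials_zero[of w] w(3) by blast
  qed
  \<comment> \<open>The field \<open>x\<^sub>i \<partial>\<^sub>k\<close> has divergence 0 because
    \<open>i \<noteq> k\<close>, and it sends \<open>q\<close> to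
    \<open>e x\<^sub>i\<close>.\<close>
  have var: "pvar i \<in> ?U" if "i \<noteq> k" "q \<in> ?U" "partial k q = pconst e" "e \<noteq> 0" for i k q e
  proof -
    have "op_scale (1 / e) (monomial_field (Poly_Mapping.single i 1) k) \<in> div0"
      using that(1) by (intro div0_op_scale monomial_field_div0) (simp add: lookup_single)
    then have "op_scale (1 / e) (monomial_field (Poly_Mapping.single i 1) k) q \<in> ?U"
      using locally_nilpotent_stable that(2) by blast
    moreover have "op_scale (1 / e) (monomial_field (Poly_Mapping.single i 1) k) q = pvar i"
    proof -
      have "pconst (1 / e) * pconst e = (1 :: ('n, 'k) mpoly)"
        using that(4) by (simp add: pconst_simps[symmetric])
      moreover have "pconst (1 / e) * (r * pconst e) = r * (pconst (1 / e) * pconst e)"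
        for r :: "('n, 'k) mpoly" by (simp only: ac_simps)
      ultimately show ?thesis
        by (simp add: op_scale_def monomial_field_def that(3) pvar_def)
    qed
    ultimately show ?thesis by simp
  qed
  have others: "pvar i \<in> ?U" if "i \<noteq> j" for i
    using var[OF that w(2) c j] .
  \<comment> \<open>\<open>x\<^sub>j \<partial>\<^sub>j\<close> is not divergence free, so
    \<open>x\<^sub>j\<close> is obtained from a second variable by means of
    \<open>x\<^sub>j \<partial>\<^sub>i\<close>.\<close>
  obtain i where i: "i \<noteq> j" by (rule exists_other_index[OF n2])
  have "pvar j \<in> ?U"
    using var[of j i "pvar i" 1] i others[OF i] by (auto simp: partial_pvar pconst_simps)
  then have "pvar k \<in> ?U" for k using others by (cases "k = j") auto
  then show ?thesis using locally_nilpotent_if_pvar[of "\<lambda>i. D i", OF D_derivation] by auto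
qed

text \<open>The substitution intertwines \<open>partial i\<close> with \<open>D i\<close>.
  Injectivity: by induction on the level, the derivatives of a kernel element vanish, so it is
  constant, and constants are fixed. Surjectivity, by induction on the level for \<open>D\<close>:
  preimages of the \<open>D i p\<close> form a closed system, whose integral maps to
  \<open>p\<close> up to a constant.\<close>

lemma dual_coordinates_bij:
  assumes y: "\<And>m i. D m (y i) = (if m = i then 1 else 0)"
  shows "bij (psubst y)" and "D i (psubst y p) = psubst y (partial i p)"
proof -
  let ?\<sigma> = "psubst y"
  note hom = alg_hom_psubst[of y]
  have chain: "D i (?\<sigma> p) = ?\<sigma> (partial i p)" for i p
    by (rule chain_rule[OF hom D_derivation partial_derivation])
      (simp add: psubst_pvar y partial_pvar alg_hom_zero[OF hom] alg_hom_one[OF hom])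
  then show "D i (psubst y p) = psubst y (partial i p)" .
  have ker: "p = 0" if "?\<sigma> p = 0" "p \<in> nilpotent_level partial m" for p m
    using that
  proof (induction m arbitrary: p)
    case (Suc m)
    have "partial i p = 0" for i
      using Suc chain[of i p] by (simp add: derivation_zero[OF D_derivation])
    then have p: "p = pconst (Poly_Mapping.lookup p 0)" by (rule constant_if_partials_zero)
    then have "?\<sigma> p = p" using alg_hom_pconst[OF hom] by metis
    then show ?case using Suc by simp
  qed simp
  have inj: "inj ?\<sigma>"
  proof (rule injI)
    show "p = q" if "?\<sigma> p = ?\<sigma> q" for p q
      using ker[of "p - q"] partial_locally_nilpotent[of "p - q"] that by (auto simp: alg_hom_diff[OF hom])
  qed
  have ran: "\<exists>q. ?\<sigma> q = p" if "p \<in> nilpotent_level D m" for p m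
    using that
  proof (induction m arbitrary: p)
    case 0
    then show ?case using alg_hom_zero[OF hom] by auto
  next
    case (Suc m)
    then have "\<exists>q. ?\<sigma> q = D i p" for i by simp
    then obtain q where q: "\<And>i. ?\<sigma> (q i) = D i p" by metis
    have "?\<sigma> (partial i (q j)) = ?\<sigma> (partial j (q i))" for i j
      by (simp only: chain[symmetric] q D_commute[of i j])
    then have "partial i (q j) = partial j (q i)" for i j
      using inj by (simp add: inj_eq)
    then obtain r where r: "\<And>i. partial i r = q i" using polynomial_poincare by blast
    have "D i (p - ?\<sigma> r) = 0" for i
      by (simp add: derivation_diff[OF D_derivation] chain r q)
    then obtain c where c: "p - ?\<sigma> r = pconst c" using constant_if_D_zero by blast
    have "?\<sigma> (r + pconst c) = p"
      by (simp add: alg_hom_add[OF hom] alg_hom_pconst[OF hom]) (simp flip: c)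
    then show ?case by blast
  qed
  fix l :: 'n
  \<comment> \<open>\<open>D i (y l)\<close> is 0 or 1, so \<open>y l\<close> serves as the
    nonconstant element that \<open>D_locally_nilpotent\<close> requires.\<close>
  have "y l \<in> nilpotent_level D (Suc (Suc 0))"
    by (simp add: y derivation_zero[OF D_derivation] derivation_one[OF D_derivation])
  moreover have "y l \<noteq> pconst c" for c
    using y[of l l] derivation_pconst[OF D_derivation, of l c] by auto
  ultimately have "\<exists>m. p \<in> nilpotent_level D m" for p using D_locally_nilpotent by blast
  then have "surj ?\<sigma>" unfolding surj_def using ran by metis
  then show "bij ?\<sigma>" using inj by (simp add: bij_def)
qed

lemma lie_end_is_conjugation:
  obtains \<sigma> where "bij \<sigma>" "alg_hom \<sigma>" "\<And>\<delta>. \<delta> \<in> div0 \<Longrightarrow> \<phi> \<delta> = \<sigma> \<circ> \<delta> \<circ> inv_into UNIV \<sigma>"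
proof -
  fix l :: 'n
  \<comment> \<open>The weights are \<open>1, ..., 1, 1 - n\<close>: their sum is 0 and none
    vanishes, as \<open>n \<ge> 2\<close> and the characteristic is zero.\<close>
  define h :: "'n \<Rightarrow> 'k" where "h k = (if k = l then 1 - of_nat CARD('n) else 1)" for k
  have "(\<Sum>k\<in>UNIV. h k) = h l + (\<Sum>k\<in>UNIV - {l}. h k)" by (rule sum.remove) auto
  also have "(\<Sum>k\<in>UNIV - {l}. h k) = of_nat (CARD('n) - 1)" by (simp add: h_def)
  finally have h0: "(\<Sum>k\<in>UNIV. h k) = 0" using n2 by (simp add: h_def of_nat_diff)
  have h1: "h k \<noteq> 0" for k
    using n2 of_nat_eq_1_iff[of "CARD('n)", where ?'a = 'k] by (auto simp: h_def)
  obtain y where y: "\<And>m i. D m (y i) = (if m = i then 1 else 0)"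
    "\<And>p. \<phi> (diag_field h) p = (\<Sum>i\<in>UNIV. pconst (h i) * y i * D i p)"
    by (rule dual_coordinates[OF h0 h1]) blast
  define \<sigma> where "\<sigma> = psubst y"
  have bij: "bij \<sigma>" unfolding \<sigma>_def by (rule dual_coordinates_bij(1)[OF y(1)])
  have chain: "D i (\<sigma> p) = \<sigma> (partial i p)" for i p
    unfolding \<sigma>_def by (rule dual_coordinates_bij(2)[OF y(1)])
  have hom: "alg_hom \<sigma>" unfolding \<sigma>_def by (rule alg_hom_psubst)
  note inv = alg_aut_inv[OF bij hom]
  have inv_inv: "inv_into UNIV (inv_into UNIV \<sigma>) = \<sigma>" using bij by (rule inv_inv_eq)
  \<comment> \<open>Undoing the conjugation by \<open>\<sigma>\<close> leaves an endomorphism that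
    fixes all \<open>partial i\<close> and \<open>diag_field h\<close>, so rigidity makes it the
    identity on \<open>div0\<close>.\<close>
  define \<theta> where "\<theta> \<delta> = inv_into UNIV \<sigma> \<circ> \<phi> \<delta> \<circ> \<sigma>" for \<delta>
  have "lie_end \<theta>"
    unfolding lie_end_def
  proof (intro conjI ballI allI)
    show "\<theta> \<delta> \<in> div0" if "\<delta> \<in> div0" for \<delta>
      using conj_div0[OF inv(3,4) lie_end_div0[OF \<phi> that]] by (simp add: \<theta>_def inv_inv)
    show "\<theta> (op_plus \<delta> \<epsilon>) = op_plus (\<theta> \<delta>) (\<theta> \<epsilon>)" if "\<delta> \<in> div0" "\<epsilon> \<in> div0" for \<delta> \<epsilon>
      by (simp add: \<theta>_def lie_end_plus[OF \<phi> that] fun_eq_iff)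
        (simp add: op_plus_def alg_hom_add[OF inv(4)])
    show "\<theta> (op_scale c \<delta>) = op_scale c (\<theta> \<delta>)" if "\<delta> \<in> div0" for c \<delta>
      by (simp add: \<theta>_def lie_end_scale[OF \<phi> that] fun_eq_iff)
        (simp add: op_scale_def alg_hom_mult[OF inv(4)] alg_hom_pconst[OF inv(4)])
    show "\<theta> (bracket \<delta> \<epsilon>) = bracket (\<theta> \<delta>) (\<theta> \<epsilon>)" if "\<delta> \<in> div0" "\<epsilon> \<in> div0" for \<delta> \<epsilon>
      by (simp add: \<theta>_def lie_end_bracket[OF \<phi> that] fun_eq_iff)
        (simp add: bracket_def alg_hom_diff[OF inv(4)] inv)
  qed
  moreover have "\<theta> (partial i) = partial i" for i
    by (simp add: \<theta>_def fun_eq_iff chain inv)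
  moreover have "\<theta> (diag_field h) = diag_field h"
  proof -
    have "\<phi> (diag_field h) (\<sigma> p) = \<sigma> (diag_field h p)" for p
      unfolding y(2) chain
      by (simp add: diag_field_def vector_field_def alg_hom_sum[OF hom] alg_hom_mult[OF hom]
          alg_hom_pconst[OF hom]) (simp add: \<sigma>_def psubst_pvar)
    then show ?thesis by (simp add: \<theta>_def fun_eq_iff inv)
  qed
  ultimately have "\<theta> \<delta> = \<delta>" if "\<delta> \<in> div0" for \<delta>
    using rigidity[of \<theta> h] h0 h1 n2 that by blast
  then have "\<phi> \<delta> (\<sigma> p) = \<sigma> (\<delta> p)" if "\<delta> \<in> div0" for \<delta> p
    using that inv(1)[of "\<phi> \<delta> (\<sigma> p)"] by (metis \<theta>_def comp_apply)
  then have "\<phi> \<delta> = \<sigma> \<circ> \<delta> \<circ> inv_into UNIV \<sigma>" if "\<delta> \<in> div0" for \<delta>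
    using that inv(1) by (simp add: fun_eq_iff) metis
  then show thesis using that bij hom by blast
qed

end

section \<open>Automorphism groups\<close>

lemma lie_aut_carrier:
  "\<phi> \<in> carrier (lie_aut_group div0)
    \<longleftrightarrow> \<phi> \<in> extensional div0 \<and> bij_betw \<phi> div0 div0 \<and> lie_end \<phi>"
  by (auto simp: lie_aut_group_def Bij_def lie_end_def bij_betw_apply)

lemma lie_aut_mult:
  "\<phi> \<in> carrier (lie_aut_group div0) \<Longrightarrow> \<psi> \<in> carrier (lie_aut_group div0)
    \<Longrightarrow> \<phi> \<otimes>\<^bsub>lie_aut_group div0\<^esub> \<psi> = compose div0 \<phi> \<psi>"
  by (simp add: lie_aut_group_def BijGroup_def)

lemma lie_aut_one: "\<one>\<^bsub>lie_aut_group div0\<^esub> = (\<lambda>\<delta>\<in>div0. \<delta>)"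
  by (simp add: lie_aut_group_def BijGroup_def)

lemma alg_aut_mult:
  "\<sigma> \<in> carrier alg_aut_group \<Longrightarrow> \<tau> \<in> carrier alg_aut_group
    \<Longrightarrow> \<sigma> \<otimes>\<^bsub>alg_aut_group\<^esub> \<tau> = \<sigma> \<circ> \<tau>"
  by (simp add: alg_aut_group_def BijGroup_def compose_def fun_eq_iff)

lemma alg_aut_one: "\<one>\<^bsub>alg_aut_group\<^esub> = id"
  by (simp add: alg_aut_group_def BijGroup_def fun_eq_iff)

lemma conj_action_apply:
  "\<delta> \<in> div0 \<Longrightarrow> conj_action \<sigma> \<delta> = \<sigma> \<circ> \<delta> \<circ> inv_into UNIV \<sigma>"
  by (simp add: conj_action_def)

lemma conj_action_carrier:
  fixes \<sigma> :: "('n::finite, 'k::field_char_0) mpoly \<Rightarrow> ('n, 'k) mpoly"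
  assumes "\<sigma> \<in> carrier alg_aut_group"
  shows "conj_action \<sigma> \<in> carrier (lie_aut_group div0)"
proof -
  have \<sigma>: "bij \<sigma>" "alg_hom \<sigma>" using assms by (simp_all add: alg_aut_carrier)
  note inv = alg_aut_inv[OF \<sigma>]
  have inv_inv: "inv_into UNIV (inv_into UNIV \<sigma>) = \<sigma>" using \<sigma>(1) by (rule inv_inv_eq)
  have mem: "conj_action \<sigma> \<delta> \<in> div0" "conj_action (inv_into UNIV \<sigma>) \<delta> \<in> div0" if "\<delta> \<in> div0" for \<delta>
    using that by (simp_all only: conj_action_apply conj_div0[OF \<sigma>] conj_div0[OF inv(3,4)])
  have "bij_betw (conj_action \<sigma>) div0 div0"
  proof (rule bij_betw_byWitness[where f' = "conj_action (inv_into UNIV \<sigma>)"])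
    show "\<forall>\<delta>\<in>div0. conj_action (inv_into UNIV \<sigma>) (conj_action \<sigma> \<delta>) = \<delta>"
      using mem by (auto simp: conj_action_apply inv_inv inv fun_eq_iff)
    show "\<forall>\<delta>\<in>div0. conj_action \<sigma> (conj_action (inv_into UNIV \<sigma>) \<delta>) = \<delta>"
      using mem by (auto simp: conj_action_apply inv_inv inv fun_eq_iff)
  qed (use mem in auto)
  moreover have "lie_end (conj_action \<sigma>)"
    unfolding lie_end_def
  proof (intro conjI ballI allI)
    show "conj_action \<sigma> (op_plus \<delta> \<epsilon>) = op_plus (conj_action \<sigma> \<delta>) (conj_action \<sigma> \<epsilon>)"
      if "\<delta> \<in> div0" "\<epsilon> \<in> div0" for \<delta> \<epsilon>
      by (simp add: that conj_action_apply div0_op_plus fun_eq_iff) (simp add: op_plus_def alg_hom_add[OF \<sigma>(2)])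
    show "conj_action \<sigma> (op_scale c \<delta>) = op_scale c (conj_action \<sigma> \<delta>)" if "\<delta> \<in> div0" for c \<delta>
      by (simp add: that conj_action_apply div0_op_scale fun_eq_iff)
        (simp add: op_scale_def alg_hom_mult[OF \<sigma>(2)] alg_hom_pconst[OF \<sigma>(2)])
    show "conj_action \<sigma> (bracket \<delta> \<epsilon>) = bracket (conj_action \<sigma> \<delta>) (conj_action \<sigma> \<epsilon>)"
      if "\<delta> \<in> div0" "\<epsilon> \<in> div0" for \<delta> \<epsilon>
      by (simp add: that conj_action_apply div0_bracket fun_eq_iff)
        (simp add: bracket_apply alg_hom_diff[OF \<sigma>(2)] inv)
  qed (rule mem)
  ultimately show ?thesis by (simp add: lie_aut_carrier) (simp add: conj_action_def)
qed

lemma conj_action_hom: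
  "conj_action \<in> hom (alg_aut_group :: (('n::finite, 'k::field_char_0) mpoly \<Rightarrow> _) monoid)
    (lie_aut_group div0)"
proof (rule homI)
  fix \<sigma> \<tau> :: "('n, 'k) mpoly \<Rightarrow> ('n, 'k) mpoly"
  assume \<sigma>: "\<sigma> \<in> carrier alg_aut_group" and \<tau>: "\<tau> \<in> carrier alg_aut_group"
  have b: "bij \<sigma>" "bij \<tau>" using \<sigma> \<tau> by (simp_all add: alg_aut_carrier)
  have mem: "conj_action \<tau> \<delta> \<in> div0" if "\<delta> \<in> div0" for \<delta>
    using conj_action_carrier[OF \<tau>] that lie_end_div0 by (auto simp: lie_aut_carrier)
  have "conj_action (\<sigma> \<circ> \<tau>) \<delta> = compose div0 (conj_action \<sigma>) (conj_action \<tau>) \<delta>" for \<delta>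
  proof (cases "\<delta> \<in> div0")
    case True
    then show ?thesis
      using mem[OF True]
      by (simp add: compose_def conj_action_apply o_inv_distrib[OF b] comp_assoc)
  qed (simp add: compose_def conj_action_def)
  then show "conj_action (\<sigma> \<otimes>\<^bsub>alg_aut_group\<^esub> \<tau>)
      = conj_action \<sigma> \<otimes>\<^bsub>lie_aut_group div0\<^esub> conj_action \<tau>"
    by (simp add: alg_aut_mult \<sigma> \<tau> lie_aut_mult conj_action_carrier fun_eq_iff)
qed (rule conj_action_carrier)

lemma group_hom_conj_action:
  "group_hom (alg_aut_group :: (('n::finite, 'k::field_char_0) mpoly \<Rightarrow> _) monoid)
    (lie_aut_group div0) conj_action"
  by (simp add: group_hom_def group_hom_axioms_def group_alg_aut_group group_lie_aut_group_div0
      conj_action_hom)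

section \<open>Kernel of the conjugation action\<close>

lemma conj_action_eq_one_commute:
  assumes \<sigma>: "\<sigma> \<in> carrier alg_aut_group" and one: "conj_action \<sigma> = (\<lambda>\<delta>\<in>div0. \<delta>)"
    and \<delta>: "\<delta> \<in> div0"
  shows "\<delta> (\<sigma> p) = \<sigma> (\<delta> p)"
proof -
  have b: "bij \<sigma>" "alg_hom \<sigma>" using \<sigma> by (simp_all add: alg_aut_carrier)
  have "\<sigma> \<circ> \<delta> \<circ> inv_into UNIV \<sigma> = \<delta>" using fun_cong[OF one, of \<delta>] \<delta> by (simp add: conj_action_apply)
  then have "(\<sigma> \<circ> \<delta> \<circ> inv_into UNIV \<sigma>) (\<sigma> p) = \<delta> (\<sigma> p)" by simp
  then show ?thesis by (simp add: alg_aut_inv[OF b])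
qed

text \<open>Commuting with all \<open>partial j\<close> makes the derivatives of
  \<open>\<sigma> (pvar i) - pvar i\<close> vanish.\<close>

lemma conj_action_kernel_shift:
  fixes \<sigma> :: "('n::finite, 'k::field_char_0) mpoly \<Rightarrow> ('n, 'k) mpoly"
  assumes \<sigma>: "\<sigma> \<in> carrier alg_aut_group" and one: "conj_action \<sigma> = (\<lambda>\<delta>\<in>div0. \<delta>)"
  shows "\<exists>l. \<forall>i. \<sigma> (pvar i) = pvar i + pconst (l i)"
proof -
  have hom: "alg_hom \<sigma>" using \<sigma> by (simp add: alg_aut_carrier)
  have "partial j (\<sigma> (pvar i) - pvar i) = 0" for i j
    by (simp add: derivation_diff[OF partial_derivation]
        conj_action_eq_one_commute[OF \<sigma> one partial_div0] partial_pvar alg_hom_zero[OF hom] alg_hom_one[OF hom])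
  then have "\<sigma> (pvar i) - pvar i = pconst (Poly_Mapping.lookup (\<sigma> (pvar i) - pvar i) 0)" for i
    by (rule constant_if_partials_zero)
  then show ?thesis
    by (intro exI[of _ "\<lambda>i. Poly_Mapping.lookup (\<sigma> (pvar i) - pvar i) 0"]) (simp add: diff_eq_eq add.commute)
qed

text \<open>A shift that commutes with \<open>x\<^sub>i \<partial>\<^sub>j\<close> for some
  \<open>j \<noteq> i\<close> fixes \<open>x\<^sub>i\<close>, as evaluation at
  \<open>x\<^sub>j\<close> shows.\<close>

lemma conj_action_inj:
  fixes \<sigma> :: "('n::finite, 'k::field_char_0) mpoly \<Rightarrow> ('n, 'k) mpoly"
  assumes n2: "2 \<le> CARD('n)"
    and \<sigma>: "\<sigma> \<in> carrier alg_aut_group" and one: "conj_action \<sigma> = (\<lambda>\<delta>\<in>div0. \<delta>)"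
  shows "\<sigma> = id"
proof -
  have hom: "alg_hom \<sigma>" using \<sigma> by (simp add: alg_aut_carrier)
  obtain c where c: "\<And>i. \<sigma> (pvar i) = pvar i + pconst (c i)"
    using conj_action_kernel_shift[OF \<sigma> one] by blast
  have "c i = 0" for i
  proof -
    obtain j where j: "j \<noteq> i" by (rule exists_other_index[OF n2])
    let ?\<delta> = "monomial_field (Poly_Mapping.single i 1) j :: ('n, 'k) mpoly \<Rightarrow> _"
    have \<delta>: "?\<delta> \<in> div0" using j by (intro monomial_field_div0) (simp add: lookup_single)
    have "?\<delta> (\<sigma> (pvar j)) = pvar i"
      unfolding c derivation_add[OF div0_derivation[OF \<delta>]] derivation_pconst[OF div0_derivation[OF \<delta>]]
      using monomial_field_pvar[of "Poly_Mapping.single i 1" j j, where ?'b = 'k]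
      by (simp add: pvar_def[of i])
    moreover have "\<sigma> (?\<delta> (pvar j)) = \<sigma> (pvar i)"
      using monomial_field_pvar[of "Poly_Mapping.single i 1" j j, where ?'b = 'k]
      by (simp add: pvar_def[of i])
    ultimately have "pvar i = \<sigma> (pvar i)"
      using conj_action_eq_one_commute[OF \<sigma> one \<delta>] by metis
    then have "pconst (c i) = (pconst 0 :: ('n, 'k) mpoly)" using c by (simp add: pconst_simps)
    then show ?thesis by (simp only: pconst_inject)
  qed
  then have "\<sigma> (pvar i) = id (pvar i)" for i by (simp add: c pconst_simps)
  moreover have "alg_hom (id :: ('n, 'k) mpoly \<Rightarrow> _)" by (simp add: alg_hom_def)
  ultimately show ?thesis using hom by (intro alg_hom_eqI)
qed

lemma conj_action_iso:
  assumes n2: "2 \<le> CARD('n)"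
  shows "conj_action \<in> iso (alg_aut_group :: (('n::finite, 'k::field_char_0) mpoly \<Rightarrow> _) monoid)
    (lie_aut_group div0)"
  unfolding group_hom.iso_iff[OF group_hom_conj_action]
proof (intro conjI ballI impI subsetI)
  fix \<sigma> :: "('n, 'k) mpoly \<Rightarrow> ('n, 'k) mpoly"
  assume "\<sigma> \<in> carrier alg_aut_group" "conj_action \<sigma> = \<one>\<^bsub>lie_aut_group div0\<^esub>"
  then show "\<sigma> = \<one>\<^bsub>alg_aut_group\<^esub>"
    using conj_action_inj[OF n2] by (simp add: lie_aut_one alg_aut_one)
next
  fix \<phi> :: "(('n, 'k) mpoly \<Rightarrow> ('n, 'k) mpoly) \<Rightarrow> (('n, 'k) mpoly \<Rightarrow> ('n, 'k) mpoly)"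
  assume "\<phi> \<in> carrier (lie_aut_group div0)"
  then have \<phi>: "\<phi> \<in> extensional div0" "bij_betw \<phi> div0 div0" "lie_end \<phi>"
    by (simp_all add: lie_aut_carrier)
  have "\<exists>\<epsilon>\<in>div0. \<phi> \<epsilon> = \<delta>" if "\<delta> \<in> div0" for \<delta>
    using \<phi>(2) that by (metis bij_betw_iff_bijections)
  then obtain \<sigma> where \<sigma>: "bij \<sigma>" "alg_hom \<sigma>"
    "\<And>\<delta>. \<delta> \<in> div0 \<Longrightarrow> \<phi> \<delta> = \<sigma> \<circ> \<delta> \<circ> inv_into UNIV \<sigma>"
    using lie_end_is_conjugation[OF \<phi>(3) _ n2] by blast
  have "\<phi> = conj_action \<sigma>"
    using \<phi>(1) \<sigma>(3) by (intro extensionalityI[of _ div0]) (simp_all add: conj_action_def)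
  then show "\<phi> \<in> conj_action ` carrier alg_aut_group"
    using \<sigma>(1,2) by (simp add: alg_aut_carrier)
qed

section \<open>One variable\<close>

context
  fixes x :: "'n::finite"
  assumes x: "UNIV = {x}"
begin

text \<open>The single coefficient has derivative 0 and is thus constant, so \<open>div0\<close> is
  a line.\<close>

lemma div0_one_variable:
  fixes \<delta> :: "('n, 'k::field_char_0) mpoly \<Rightarrow> ('n, 'k) mpoly"
  assumes \<delta>: "\<delta> \<in> div0"
  shows "\<delta> = op_scale (Poly_Mapping.lookup (\<delta> (pvar x)) 0) (partial x)"
proof (rule derivations_eqI)
  have "partial x (\<delta> (pvar x)) = 0"
    using \<delta> by (simp add: div0_def divergence_def x)
  then have "partial i (\<delta> (pvar x)) = 0" for i using x by (metis UNIV_I singletonD)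
  then have "\<delta> (pvar x) = pconst (Poly_Mapping.lookup (\<delta> (pvar x)) 0)"
    by (rule constant_if_partials_zero)
  then have "\<delta> (pvar x) = op_scale (Poly_Mapping.lookup (\<delta> (pvar x)) 0) (partial x) (pvar x)"
    by (simp add: op_scale_def partial_pvar)
  moreover fix i
  have "i = x" using x by blast
  ultimately show "\<delta> (pvar i) = op_scale (Poly_Mapping.lookup (\<delta> (pvar x)) 0) (partial x) (pvar i)"
    by simp
qed (intro div0_derivation \<delta> op_scale_derivation partial_derivation)+

text \<open>\<open>div0\<close> is spanned by \<open>partial x\<close>, so linearity settles the
  values on \<open>div0\<close> and extensionality all others.\<close>

lemma lie_aut_eqI:
  fixes \<phi> \<psi> :: "(('n, 'k::field_char_0) mpoly \<Rightarrow> ('n, 'k) mpoly) \<Rightarrow> (('n, 'k) mpoly \<Rightarrow> ('n, 'k) mpoly)"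
  assumes "\<phi> \<in> carrier (lie_aut_group div0)" "\<psi> \<in> carrier (lie_aut_group div0)"
    and eq: "\<phi> (partial x) = \<psi> (partial x)"
  shows "\<phi> = \<psi>"
proof (rule extensionalityI[of _ div0])
  fix \<delta> :: "('n, 'k) mpoly \<Rightarrow> ('n, 'k) mpoly"
  assume \<delta>: "\<delta> \<in> div0"
  have "\<phi> (op_scale c (partial x)) = \<psi> (op_scale c (partial x))" for c
    using assms by (simp add: lie_aut_carrier lie_end_scale partial_div0)
  then show "\<phi> \<delta> = \<psi> \<delta>" by (subst (1 2) div0_one_variable[OF \<delta>])
qed (use assms in \<open>simp_all add: lie_aut_carrier\<close>)


lemma scaling:
  fixes c :: "'k::field_char_0"
  assumes c: "c \<noteq> 0"
  obtains \<sigma> :: "('n, 'k) mpoly \<Rightarrow> ('n, 'k) mpoly" where "\<sigma> \<in> carrier alg_aut_group"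
    and "conj_action \<sigma> (partial x) = op_scale c (partial x)"
proof -
  define s :: "'k \<Rightarrow> ('n, 'k) mpoly \<Rightarrow> ('n, 'k) mpoly"
    where "s a = psubst (\<lambda>i. pconst a * pvar i)" for a
  have hom: "alg_hom (s a)" for a unfolding s_def by (rule alg_hom_psubst)
  have s_pvar: "s a (pvar i) = pconst a * pvar i" for a i by (simp add: s_def psubst_pvar)
  have inverse: "s a (s b p) = p" if "a * b = 1" for a b p
  proof -
    have "alg_hom (s a \<circ> s b)" "alg_hom (id :: ('n, 'k) mpoly \<Rightarrow> _)"
      using hom by (simp_all add: alg_hom_def)
    moreover have "(s a \<circ> s b) (pvar i) = id (pvar i)" for i
    proof -
      have "(s a \<circ> s b) (pvar i) = pconst (a * b) * pvar i"
        by (simp add: s_pvar alg_hom_mult[OF hom] alg_hom_pconst[OF hom] pconst_simps mult.left_commute mult.assoc)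
      then show ?thesis by (simp add: that pconst_simps)
    qed
    ultimately have "s a \<circ> s b = id" by (intro alg_hom_eqI)
    then show ?thesis by (simp add: fun_eq_iff)
  qed
  \<comment> \<open>Conjugation scales \<open>partial x\<close> inversely to the variable:
    \<open>c \<partial>\<close> sends \<open>x / c\<close> to 1.\<close>
  let ?\<sigma> = "s (1 / c)"
  have bij: "bij ?\<sigma>"
    by (rule o_bij[of "s c"]) (use c in \<open>simp_all add: fun_eq_iff inverse\<close>)
  have "op_scale c (partial x) (?\<sigma> p) = ?\<sigma> (partial x p)" for p
  proof (rule chain_rule[OF hom op_scale_derivation[OF partial_derivation] partial_derivation])
    have "pconst c * pconst (1 / c) = (1 :: ('n, 'k) mpoly)"
      using c by (simp add: pconst_simps[symmetric])
    then show "op_scale c (partial x) (?\<sigma> (pvar j)) = ?\<sigma> (partial x (pvar j))" for j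
      by (simp add: op_scale_def s_pvar partial_pconst_mult partial_pvar alg_hom_zero[OF hom]
          alg_hom_one[OF hom])
  qed
  then have "conj_action ?\<sigma> (partial x) = op_scale c (partial x)"
    by (simp add: conj_action_apply partial_div0 fun_eq_iff) (metis alg_aut_inv(1)[OF bij hom])
  then show thesis by (rule that[rotated]) (simp add: alg_aut_carrier bij hom)
qed

lemma multiplier_exists:
  fixes \<phi> :: "(('n, 'k::field_char_0) mpoly \<Rightarrow> ('n, 'k) mpoly) \<Rightarrow> (('n, 'k) mpoly \<Rightarrow> ('n, 'k) mpoly)"
  assumes \<phi>: "\<phi> \<in> carrier (lie_aut_group div0)"
  obtains c where "c \<noteq> 0" "\<phi> (partial x) = op_scale c (partial x)"
proof -
  have \<phi>': "lie_end \<phi>" "inj_on \<phi> div0" using \<phi> by (simp_all add: lie_aut_carrier bij_betw_def)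
  define c where "c = Poly_Mapping.lookup (\<phi> (partial x) (pvar x)) 0"
  have eq: "\<phi> (partial x) = op_scale c (partial x)"
    unfolding c_def by (rule div0_one_variable[OF lie_end_div0[OF \<phi>'(1) partial_div0]])
  have "c \<noteq> 0"
  proof
    assume "c = 0"
    then have "\<phi> (partial x) = \<phi> (\<lambda>_. 0)"
      using eq lie_end_zero[OF \<phi>'(1)] by (simp add: op_scale_zero)
    then have "partial x = (\<lambda>_. 0 :: ('n, 'k) mpoly)"
      using \<phi>'(2) partial_div0 div0_zero by (auto dest: inj_onD)
    then have "partial x (pvar x) = (0 :: ('n, 'k) mpoly)" by metis
    then show False by (simp add: partial_pvar)
  qed
  then show thesis using that eq by blast
qed

lemma conj_action_image:
  "conj_action ` carrier (alg_aut_group :: (('n, 'k::field_char_0) mpoly \<Rightarrow> _) monoid)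
    = carrier (lie_aut_group div0)"
proof (intro equalityI subsetI)
  fix \<phi> :: "(('n, 'k) mpoly \<Rightarrow> ('n, 'k) mpoly) \<Rightarrow> (('n, 'k) mpoly \<Rightarrow> ('n, 'k) mpoly)"
  assume \<phi>: "\<phi> \<in> carrier (lie_aut_group div0)"
  obtain c where c: "c \<noteq> 0" "\<phi> (partial x) = op_scale c (partial x)"
    using multiplier_exists[OF \<phi>] by blast
  obtain \<sigma> :: "('n, 'k) mpoly \<Rightarrow> ('n, 'k) mpoly" where \<sigma>: "\<sigma> \<in> carrier alg_aut_group"
    "conj_action \<sigma> (partial x) = op_scale c (partial x)"
    using scaling[OF c(1)] by blast
  have "\<phi> = conj_action \<sigma>"
    using c \<sigma> by (intro lie_aut_eqI \<phi> conj_action_carrier) simp_all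
  then show "\<phi> \<in> conj_action ` carrier alg_aut_group" using \<sigma>(1) by blast
qed (auto intro: conj_action_carrier)

text \<open>Conversely to \<open>conj_action_kernel_shift\<close>, a shift commutes with
  \<open>partial x\<close>, which spans \<open>div0\<close>.\<close>

lemma kernel_conj_action:
  "kernel (alg_aut_group :: (('n, 'k::field_char_0) mpoly \<Rightarrow> _) monoid) (lie_aut_group div0) conj_action
    = shifts"
proof (intro equalityI subsetI)
  fix \<sigma> :: "('n, 'k) mpoly \<Rightarrow> ('n, 'k) mpoly"
  assume "\<sigma> \<in> kernel alg_aut_group (lie_aut_group div0) conj_action"
  then show "\<sigma> \<in> shifts"
    by (auto simp: kernel_def shifts_def lie_aut_one intro: conj_action_kernel_shift)
next
  fix \<sigma> :: "('n, 'k) mpoly \<Rightarrow> ('n, 'k) mpoly"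
  assume "\<sigma> \<in> shifts"
  then obtain l where \<sigma>: "\<sigma> \<in> carrier alg_aut_group" and l: "\<And>i. \<sigma> (pvar i) = pvar i + pconst (l i)"
    by (auto simp: shifts_def)
  then have b: "bij \<sigma>" "alg_hom \<sigma>" by (simp_all add: alg_aut_carrier)
  have "partial x (\<sigma> p) = \<sigma> (partial x p)" for p
    by (rule chain_rule[OF b(2) partial_derivation partial_derivation])
      (simp add: l partial_add partial_pconst partial_pvar alg_hom_zero[OF b(2)] alg_hom_one[OF b(2)])
  then have "conj_action \<sigma> (partial x) = partial x"
    by (simp add: conj_action_apply partial_div0 fun_eq_iff) (metis alg_aut_inv(1)[OF b])
  then have "conj_action \<sigma> = \<one>\<^bsub>lie_aut_group div0\<^esub>"
    by (intro lie_aut_eqI conj_action_carrier \<sigma> monoid.one_closed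
        group.is_monoid[OF group_lie_aut_group_div0]) (simp add: lie_aut_one partial_div0)
  then show "\<sigma> \<in> kernel alg_aut_group (lie_aut_group div0) conj_action"
    using \<sigma> by (simp add: kernel_def)
qed

lemma lie_aut_group_iso_mult_group:
  "lie_aut_group (div0 :: (('n, 'k::field_char_0) mpoly \<Rightarrow> _) set) \<cong> (mult_group :: 'k monoid)"
proof -
  let ?A = "lie_aut_group (div0 :: (('n, 'k) mpoly \<Rightarrow> _) set)"
  \<comment> \<open>The factor by which an automorphism scales \<open>partial x\<close>, read off
    from the constant term of the coefficient.\<close>
  define \<mu> where "\<mu> \<phi> = Poly_Mapping.lookup (\<phi> (partial x) (pvar x)) 0"
    for \<phi> :: "(('n, 'k) mpoly \<Rightarrow> ('n, 'k) mpoly) \<Rightarrow> (('n, 'k) mpoly \<Rightarrow> ('n, 'k) mpoly)"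
  have scale: "\<mu> \<phi> = c" if "\<phi> (partial x) = op_scale c (partial x)" for \<phi> c
    by (simp add: \<mu>_def that) (simp add: op_scale_def partial_pvar lookup_zero_pconst)
  have \<mu>: "\<mu> \<phi> \<noteq> 0" "\<phi> (partial x) = op_scale (\<mu> \<phi>) (partial x)" if "\<phi> \<in> carrier ?A" for \<phi>
    using multiplier_exists[OF that] scale by metis+
  have "\<mu> \<in> hom ?A mult_group"
  proof (rule homI)
    fix \<phi> \<psi> assume \<phi>: "\<phi> \<in> carrier ?A" and \<psi>: "\<psi> \<in> carrier ?A"
    have "lie_end \<phi>" using \<phi> by (simp add: lie_aut_carrier)
    then have "(\<phi> \<otimes>\<^bsub>?A\<^esub> \<psi>) (partial x) = op_scale (\<mu> \<psi>) (op_scale (\<mu> \<phi>) (partial x))"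
      by (simp add: lie_aut_mult \<phi> \<psi> compose_def partial_div0 \<mu>(2)[OF \<psi>] lie_end_scale)
        (simp add: \<mu>(2)[OF \<phi>, symmetric])
    also have "\<dots> = op_scale (\<mu> \<phi> * \<mu> \<psi>) (partial x)"
      by (simp add: op_scale_def fun_eq_iff pconst_simps ac_simps)
    finally show "\<mu> (\<phi> \<otimes>\<^bsub>?A\<^esub> \<psi>) = \<mu> \<phi> \<otimes>\<^bsub>mult_group\<^esub> \<mu> \<psi>"
      by (simp add: mult_group_def scale)
  qed (simp add: mult_group_def \<mu>(1))
  moreover have "bij_betw \<mu> (carrier ?A) (carrier mult_group)"
  proof (rule bij_betw_imageI)
    show "inj_on \<mu> (carrier ?A)"
    proof (rule inj_onI)
      fix \<phi> \<psi>
      assume \<phi>: "\<phi> \<in> carrier ?A" and \<psi>: "\<psi> \<in> carrier ?A" and eq: "\<mu> \<phi> = \<mu> \<psi>"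
      show "\<phi> = \<psi>"
        by (rule lie_aut_eqI[OF \<phi> \<psi>]) (simp only: \<mu>(2)[OF \<phi>] \<mu>(2)[OF \<psi>] eq)
    qed
    show "\<mu> ` carrier ?A = carrier mult_group"
    proof (intro equalityI subsetI)
      fix c :: 'k assume "c \<in> carrier mult_group"
      then have "c \<noteq> 0" by (simp add: mult_group_def)
      then obtain \<sigma> :: "('n, 'k) mpoly \<Rightarrow> ('n, 'k) mpoly" where \<sigma>: "\<sigma> \<in> carrier alg_aut_group"
        "conj_action \<sigma> (partial x) = op_scale c (partial x)"
        using scaling by blast
      then show "c \<in> \<mu> ` carrier ?A"
        using scale[of "conj_action \<sigma>" c, OF \<sigma>(2)] conj_action_carrier[OF \<sigma>(1)] by blast
    qed (use \<mu>(1) in \<open>auto simp: mult_group_def\<close>)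
  qed
  ultimately have "\<mu> \<in> iso ?A mult_group" by (rule isoI)
  then show ?thesis by (rule is_isoI)
qed

text \<open>The first isomorphism theorem; \<open>the_elem\<close> evaluates the induced map because
  the action is constant on each coset of its kernel.\<close>

lemma conj_action_quotient_iso:
  "\<exists>\<psi> \<in> iso (alg_aut_group Mod shifts) (lie_aut_group (div0 :: (('n, 'k::field_char_0) mpoly \<Rightarrow> _) set)).
    \<forall>\<sigma> \<in> carrier alg_aut_group. \<psi> (shifts #>\<^bsub>alg_aut_group\<^esub> \<sigma>) = conj_action \<sigma>"
proof -
  let ?G = "alg_aut_group :: (('n, 'k) mpoly \<Rightarrow> _) monoid"
    and ?A = "lie_aut_group (div0 :: (('n, 'k) mpoly \<Rightarrow> _) set)"
  interpret group_hom ?G ?A conj_action by (rule group_hom_conj_action)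
  have "the_elem (conj_action ` (shifts #>\<^bsub>?G\<^esub> \<sigma>)) = conj_action \<sigma>" if \<sigma>: "\<sigma> \<in> carrier ?G" for \<sigma>
  proof (rule the_elem_image_unique)
    have "shifts \<subseteq> carrier ?G" by (auto simp: shifts_def)
    then have "\<sigma> \<in> shifts #>\<^bsub>?G\<^esub> \<sigma>"
      using G.rcos_self[OF \<sigma>] subgroup_kernel by (simp add: kernel_conj_action)
    then show "shifts #>\<^bsub>?G\<^esub> \<sigma> \<noteq> {}" by blast
    fix \<tau> assume "\<tau> \<in> shifts #>\<^bsub>?G\<^esub> \<sigma>"
    then obtain s where s: "s \<in> kernel ?G ?A conj_action" "\<tau> = s \<otimes>\<^bsub>?G\<^esub> \<sigma>"
      by (auto simp: r_coset_def kernel_conj_action)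
    then show "conj_action \<tau> = conj_action \<sigma>" using \<sigma> by (simp add: kernel_def)
  qed
  moreover have "(\<lambda>X. the_elem (conj_action ` X)) \<in> iso (?G Mod shifts) ?A"
    using FactGroup_iso_set[OF conj_action_image] by (simp add: kernel_conj_action)
  ultimately show ?thesis
    by (intro bexI[of _ "\<lambda>X. the_elem (conj_action ` X)"] ballI)
qed

end

theorem theorem1p1:
  fixes G :: "(('n::finite, 'k::field_char_0) mpoly \<Rightarrow> ('n, 'k) mpoly) monoid"
    and A :: "((('n, 'k) mpoly \<Rightarrow> ('n, 'k) mpoly) \<Rightarrow> (('n, 'k) mpoly \<Rightarrow> ('n, 'k) mpoly)) monoid"
  assumes "G = alg_aut_group" and "A = lie_aut_group div0"
  shows "conj_action \<in> hom G A \<and>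
    (CARD('n) \<ge> 2 \<longrightarrow> conj_action \<in> iso G A) \<and>
    (CARD('n) = 1 \<longrightarrow>
      shifts \<lhd> G \<and>
      (\<exists>\<psi> \<in> iso (G Mod shifts) A. \<forall>\<sigma> \<in> carrier G. \<psi> (shifts #>\<^bsub>G\<^esub> \<sigma>) = conj_action \<sigma>) \<and>
      G Mod shifts \<cong> (mult_group :: 'k monoid))"
proof (intro conjI impI)
  show "conj_action \<in> hom G A" unfolding assms by (rule conj_action_hom)
  show "conj_action \<in> iso G A" if "CARD('n) \<ge> 2" unfolding assms by (rule conj_action_iso[OF that])
  assume "CARD('n) = 1"
  then obtain x :: 'n where x: "UNIV = {x}" by (rule card_1_singletonE)
  have "kernel G A conj_action \<lhd> G"
    unfolding assms by (rule group_hom.normal_kernel[OF group_hom_conj_action])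
  then show "shifts \<lhd> G" by (simp add: assms kernel_conj_action[OF x])
  show \<psi>: "\<exists>\<psi> \<in> iso (G Mod shifts) A. \<forall>\<sigma> \<in> carrier G. \<psi> (shifts #>\<^bsub>G\<^esub> \<sigma>) = conj_action \<sigma>"
    unfolding assms by (rule conj_action_quotient_iso[OF x])
  then have "G Mod shifts \<cong> A" by (auto intro: is_isoI)
  also have "A \<cong> (mult_group :: 'k monoid)" unfolding assms by (rule lie_aut_group_iso_mult_group[OF x])
  finally show "G Mod shifts \<cong> (mult_group :: 'k monoid)" .
qed

end
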